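(* Let $1<p<\infty$, $1/p+1/q=1$, let $(a,b)\in L^\infty\times L^\infty$ be a Fredholm matching pair with subordinated pair $(c,d)$, $\kappa_1:=\operatorname{ind}T(c)$, $\kappa_2:=\operatorname{ind}T(d)$ on $H^p$. Let $(\kappa_1,\kappa_2)\in\mathbb{Z}_-\times\mathbb{Z}_+$, and let $m\in\mathbb{N}$ satisfy $1\ge 2m-\kappa_2\ge0$. Write $\varphi_\pm=\varphi_\pm^{\overline at^{-m},\widetilde{\overline b}t^m}$. Then for the operators $T(a)\pm H(b)$ on $H^p$: (i) If $\kappa_2$ is odd, then $$\operatorname{coker}(T(a)\pm H(b))=T(t^{-m})\left(\left\{\frac{1\mp\boldsymbol\sigma(\overline d)}{2}\,\overline{d_-^{-1}}\,\mathbb{C}\dotplus\varphi_\pm(\operatorname{im}\mathbf{P}_{\overline c}^{\pm})\right\}\cap\operatorname{im}T(t^m)\right).$$ (ii) If $\kappa_2$ is even, then $$\operatorname{coker}(T(a)\pm H(b))=T(t^{-m})\left(\varphi_\pm(\operatorname{im}\mathbf{P}_{\overline c}^{\pm})\cap\operatorname{im}T(t^m)\right).$$ (In each formula either all upper or all lower signs are taken.)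
   Context: $\mathbb{T}$ is the unit circle, $L^p=L^p(\mathbb{T})$, $H^p=\{f\in L^p:\widehat f_n=0\text{ for }n<0\}$, $\overline{H^p}=\{f\in L^p:\widehat f_n=0\text{ for }n>0\}$; $f(0)=\widehat f_0$ for $f\in H^p$, $f(\infty)=\widehat f_0$ for $f\in\overline{H^p}$. $P$ is the Riesz projection of $L^p$ onto $H^p$, $Q=I-P$, $(Jf)(t)=\overline tf(\overline t)$, $\widetilde a(t)=a(1/t)$; $T(a)f=P(af)$, $H(a)f=PaQJf$ on $H^p$ for $a\in L^\infty$. $\mathbb{N}=\{1,2,\dots\}$, $\mathbb{Z}_+=\mathbb{N}\cup\{0\}$, $\mathbb{Z}_-$ is the set of negative integers. The index is $\dim\ker-\dim\operatorname{coker}$. A matching pair $(a,b)$ consists of $a\in L^\infty$ invertible in $L^\infty$ and $b\in L^\infty$ with $a\widetilde a=b\widetilde b$ (then $b$ is invertible too). Its subordinated pair is $(c,d)$ with $c=ab^{-1}=\widetilde b\widetilde a^{-1}$, $d=b\widetilde a^{-1}=a\widetilde b^{-1}$. It is Fredholm if $T(c)$ and $T(d)$ are Fredholm on $H^p$. $\operatorname{coker}A:=\ker A^*$, with the identification $(T(a)\pm H(b))^*=T(\overline a)\pm H(\widetilde{\overline b})$ acting on $H^q$. $(\overline a,\widetilde{\overline b})$ is a matching pair with subordinated pair $(\overline d,\overline c)$, and $(\overline at^{-m},\widetilde{\overline b}t^m)$ is a matching pair with subordinated pair $(\overline dt^{-2m},\overline c)$. All operators, spaces and the signature attached to $\overline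 c,\overline d$, as well as $T(t^{\pm m})$ in the formulas, are considered in $H^q$ (same definitions with $p,q$ interchanged). Wiener--Hopf factorization of $g\in L^\infty$ in $H^p$: $g=g_-t^{\nu}g_+$ with $\nu\in\mathbb{Z}$, $g_+\in H^q$, $g_+^{-1}\in H^p$, $g_-\in\overline{H^p}$, $g_-^{-1}\in\overline{H^q}$, $g_-(\infty)=1$, such that $g_+^{-1}Pg_-^{-1}I$, defined on $\operatorname{span}\{t^k:k\ge0\}$, extends boundedly to $H^p$. It is unique and exists iff $T(g)$ is Fredholm on $H^p$; then $\nu=-\operatorname{ind}T(g)$. $d_-$ is the minus-factor in the factorization of $d$ in $H^p$. If $g\widetilde g=1$ and $T(g)$ is Fredholm, then $\boldsymbol\sigma(g):=g_+(0)\in\{1,-1\}$ is the factorization signature. For $g\in L^\infty$ with $g\widetilde g=1$, $\mathbf{P}_g:=JQgP|_{\ker T(g)}$ maps $\ker T(g)$ into itself, $\mathbf{P}_g^2=I$, and $\mathbf{P}_g^{\pm}:=\frac12(I\pm\mathbf{P}_g)$. For $g$ with $T(g)$ Fredholm of index $\kappa\ge0$, $T_r^{-1}(g):=T^{-1}(gt^{\kappa})T(t^{\kappa})$, a right inverse of $T(g)$. For a matching pair $(\alpha,\beta)$ with subordinated pair $(\gamma,\delta)$ such that $T(\gamma)$ is Fredholm of nonnegative index, for $s\in\ker T(\delta)$, $$\varphi_\pm^{\alpha,\beta}(s):=T_r^{-1}(\gamma)T(\widetilde\alpha^{-1})s\mp JQ\gamma P\,T_r^{-1}(\gamma)T(\widetilde\alpha^{-1})s\pm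 JQ\widetilde\alpha^{-1}s.$$ *)

theory Defs
  imports "HOL-Analysis.Analysis"
begin

text \<open>Normalised arc length on the unit circle, as a measure on the complex plane.\<close>

definition circle_measure :: "complex measure" where
  "circle_measure = distr (uniform_measure lborel {-pi..pi}) borel cis"

lemma cis_borel_measurable: "cis \<in> borel_measurable borel"
  by (intro borel_measurable_continuous_onI continuous_intros)

lemma sets_circle_measure [measurable_cong, simp]: "sets circle_measure = sets borel"
  by (simp add: circle_measure_def)

lemma AE_circle_measure_iff:
  assumes "Measurable.pred borel R"
  shows "(AE t in circle_measure. R t) \<longleftrightarrow> (AE \<theta> in lborel. \<theta> \<in> {-pi..pi} \<longrightarrow> R (cis \<theta>))"
proof -
  have "cis \<in> measurable (uniform_measure lborel {-pi..pi}) borel"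
    using cis_borel_measurable by simp
  moreover have "{x \<in> space borel. R x} \<in> sets borel"
    using assms by measurable
  ultimately have "(AE t in circle_measure. R t)
      \<longleftrightarrow> (AE \<theta> in uniform_measure lborel {-pi..pi}. R (cis \<theta>))"
    unfolding circle_measure_def by (subst AE_distr_iff) auto
  also have "\<dots> \<longleftrightarrow> (AE \<theta> in lborel. \<theta> \<in> {-pi..pi} \<longrightarrow> R (cis \<theta>))"
    by (subst AE_uniform_measure) auto
  finally show ?thesis .
qed

lemma AE_circle_nonzero: "AE t in circle_measure. t \<noteq> 0"
  by (subst AE_circle_measure_iff) auto

lemma AE_circle_inverse:
  assumes R: "Measurable.pred borel R" and ae: "AE t in circle_measure. R t"
  shows "AE t in circle_measure. R (1 / t)"
proof -
  have "AE \<theta> in lborel. \<theta> \<in> {-pi..pi} \<longrightarrow> R (cis \<theta>)"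
    using ae AE_circle_measure_iff[OF R] by simp
  moreover have [measurable]: "Measurable.pred borel (\<lambda>\<theta>. \<theta> \<in> {-pi..pi} \<longrightarrow> R (cis \<theta>))"
    using R cis_borel_measurable by measurable
  ultimately have "AE \<theta> in lborel. 0 + (-1) * \<theta> \<in> {-pi..pi} \<longrightarrow> R (cis (0 + (-1) * \<theta>))"
    using AE_borel_affine[of "-1" "\<lambda>\<theta>. \<theta> \<in> {-pi..pi} \<longrightarrow> R (cis \<theta>)" 0] by (auto simp: lborel_distr_mult)
  then have "AE \<theta> in lborel. \<theta> \<in> {-pi..pi} \<longrightarrow> R (1 / cis \<theta>)"
    by eventually_elim (auto simp: divide_inverse)
  moreover have "Measurable.pred borel (\<lambda>t. R (1 / t))"
    using R by measurable
  ultimately show ?thesis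
    by (subst AE_circle_measure_iff) auto
qed


text \<open>Borel functions on the circle modulo equality almost everywhere. Values off the circle are
  irrelevant, since its complement is a null set of \<open>circle_measure\<close>. Every Lebesgue measurable
  function on the circle agrees almost everywhere with a Borel one.\<close>

definition ae_eq :: "(complex \<Rightarrow> complex) \<Rightarrow> (complex \<Rightarrow> complex) \<Rightarrow> bool" where
  "ae_eq f g \<longleftrightarrow> f \<in> borel_measurable borel \<and> g \<in> borel_measurable borel \<and>
     (AE t in circle_measure. f t = g t)"

quotient_type tfun = "complex \<Rightarrow> complex" / partial: ae_eq
proof (rule part_equivpI)
  show "\<exists>f. ae_eq f f"
    by (rule exI[of _ "\<lambda>_. 0"]) (simp add: ae_eq_def)
  show "symp ae_eq"
    by (rule sympI) (auto simp: ae_eq_def eq_commute)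
  show "transp ae_eq"
  proof (rule transpI)
    fix f g h assume "ae_eq f g" "ae_eq g h"
    then show "ae_eq f h"
      unfolding ae_eq_def by (auto elim: eventually_elim2)
  qed
qed

instantiation tfun :: comm_ring_1
begin

lift_definition zero_tfun :: tfun is "\<lambda>_. 0" by (simp add: ae_eq_def)
lift_definition one_tfun :: tfun is "\<lambda>_. 1" by (simp add: ae_eq_def)
lift_definition plus_tfun :: "tfun \<Rightarrow> tfun \<Rightarrow> tfun" is "\<lambda>f g t. f t + g t"
  unfolding ae_eq_def by (auto elim: eventually_elim2)
lift_definition minus_tfun :: "tfun \<Rightarrow> tfun \<Rightarrow> tfun" is "\<lambda>f g t. f t - g t"
  unfolding ae_eq_def by (auto elim: eventually_elim2)
lift_definition times_tfun :: "tfun \<Rightarrow> tfun \<Rightarrow> tfun" is "\<lambda>f g t. f t * g t"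
  unfolding ae_eq_def by (auto elim: eventually_elim2)
lift_definition uminus_tfun :: "tfun \<Rightarrow> tfun" is "\<lambda>f t. - f t"
  unfolding ae_eq_def by (auto elim: eventually_mono)

instance
proof
  show "(0::tfun) \<noteq> 1"
  proof transfer
    have "emeasure (uniform_measure lborel {-pi..pi}) UNIV = 1"
      using emeasure_uniform_measure_1[of lborel "{-pi..pi}"] by simp
    then have "emeasure circle_measure UNIV = 1"
      using cis_borel_measurable by (simp add: circle_measure_def emeasure_distr)
    moreover have "space circle_measure = UNIV"
      by (simp add: circle_measure_def)
    ultimately have "\<not> (AE t in circle_measure. False)"
      by (simp add: AE_iff_measurable[OF _ refl])
    then show "\<not> ae_eq (\<lambda>_. 0) (\<lambda>_. 1)" by (simp add: ae_eq_def)
  qed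
qed (transfer; auto simp: ae_eq_def algebra_simps)+

end

instantiation tfun :: inverse
begin
lift_definition inverse_tfun :: "tfun \<Rightarrow> tfun" is "\<lambda>f t. inverse (f t)"
  unfolding ae_eq_def by (auto elim: eventually_mono)
definition divide_tfun :: "tfun \<Rightarrow> tfun \<Rightarrow> tfun" where
  "divide_tfun f g = f * inverse g"
instance ..
end

lift_definition cscale :: "complex \<Rightarrow> tfun \<Rightarrow> tfun" is "\<lambda>z f t. z * f t"
  unfolding ae_eq_def by (auto elim: eventually_mono)

interpretation cvs: vector_space cscale
  by standard (transfer; auto simp: ae_eq_def algebra_simps)+

lift_definition conj_fun :: "tfun \<Rightarrow> tfun" is "\<lambda>f t. cnj (f t)"
  unfolding ae_eq_def
  by (auto elim: eventually_mono intro: measurable_compose[OF _ borel_measurable_continuous_onI]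
      continuous_intros)

lift_definition tilde :: "tfun \<Rightarrow> tfun" is "\<lambda>f t. f (1 / t)"
proof -
  fix f g assume fg: "ae_eq f g"
  then have [measurable]: "f \<in> borel_measurable borel" "g \<in> borel_measurable borel"
    by (auto simp: ae_eq_def)
  have "AE t in circle_measure. f (1 / t) = g (1 / t)"
    using fg by (intro AE_circle_inverse[where R = "\<lambda>t. f t = g t"]) (auto simp: ae_eq_def)
  then show "ae_eq (\<lambda>t. f (1 / t)) (\<lambda>t. g (1 / t))"
    by (simp add: ae_eq_def)
qed

lift_definition tpow :: "int \<Rightarrow> tfun" is "\<lambda>k t. t powi k"
  unfolding ae_eq_def power_int_def by auto

lift_definition in_Lp :: "real \<Rightarrow> tfun \<Rightarrow> bool"
  is "\<lambda>p f. integrable circle_measure (\<lambda>t. cmod (f t) powr p)"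
  unfolding ae_eq_def by (intro integrable_cong_AE) (auto elim: eventually_mono)

lift_definition Lp_norm :: "real \<Rightarrow> tfun \<Rightarrow> real"
  is "\<lambda>p f. (LINT t|circle_measure. cmod (f t) powr p) powr (1 / p)"
  unfolding ae_eq_def
  by (intro arg_cong[where f = "\<lambda>x. x powr _"] integral_cong_AE) (auto elim: eventually_mono)

lift_definition in_Linf :: "tfun \<Rightarrow> bool"
  is "\<lambda>f. \<exists>C. AE t in circle_measure. cmod (f t) \<le> C"
proof -
  fix f g assume "ae_eq f g"
  then have "AE t in circle_measure. f t = g t" by (simp add: ae_eq_def)
  then have "(AE t in circle_measure. cmod (f t) \<le> C) \<longleftrightarrow> (AE t in circle_measure. cmod (g t) \<le> C)" for C
    by (intro eventually_subst) (auto elim: eventually_mono)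
  then show "(\<exists>C. AE t in circle_measure. cmod (f t) \<le> C) \<longleftrightarrow> (\<exists>C. AE t in circle_measure. cmod (g t) \<le> C)"
    by simp
qed

lift_definition fourier :: "tfun \<Rightarrow> int \<Rightarrow> complex"
  is "\<lambda>f n. LINT t|circle_measure. f t * t powi (- n)"
  unfolding ae_eq_def power_int_def
  by (intro ext integral_cong_AE) (auto elim: eventually_mono)

definition Lp :: "real \<Rightarrow> tfun set" where "Lp p = {f. in_Lp p f}"

definition Linf :: "tfun set" where "Linf = {f. in_Linf f}"

definition Hp :: "real \<Rightarrow> tfun set" where
  "Hp p = {f \<in> Lp p. \<forall>n<0. fourier f n = 0}"

definition conj_Hp :: "real \<Rightarrow> tfun set" where
  "conj_Hp p = {f \<in> Lp p. \<forall>n>0. fourier f n = 0}"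

text \<open>The Riesz projection of \<open>f \<in> L\<^sup>p\<close>, for \<open>1 < p\<close>. Existence is the theorem of M. Riesz,
  uniqueness is the injectivity of the Fourier transform.\<close>

definition riesz_P :: "real \<Rightarrow> tfun \<Rightarrow> tfun" where
  "riesz_P p f = (THE g. g \<in> Hp p \<and> (\<forall>n\<ge>0. fourier g n = fourier f n))"

definition riesz_Q :: "real \<Rightarrow> tfun \<Rightarrow> tfun" where
  "riesz_Q p f = f - riesz_P p f"

definition flip_J :: "tfun \<Rightarrow> tfun" where
  "flip_J f = tpow (-1) * tilde f"

definition toeplitz :: "real \<Rightarrow> tfun \<Rightarrow> tfun \<Rightarrow> tfun" where
  "toeplitz p a f = riesz_P p (a * f)"

definition hankel :: "real \<Rightarrow> tfun \<Rightarrow> tfun \<Rightarrow> tfun" where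
  "hankel p b f = riesz_P p (b * riesz_Q p (flip_J f))"


text \<open>Operators on \<open>H\<^sup>p\<close> are functions on \<open>tfun\<close> of which only the values on \<open>H\<^sup>p\<close> matter.
  Throughout, \<open>q\<close> is the exponent conjugate to \<open>p\<close>.\<close>

definition bounded_op_Hp :: "real \<Rightarrow> (tfun \<Rightarrow> tfun) \<Rightarrow> bool" where
  "bounded_op_Hp p A \<longleftrightarrow>
     (\<forall>f\<in>Hp p. A f \<in> Hp p) \<and>
     (\<forall>f\<in>Hp p. \<forall>g\<in>Hp p. A (f + g) = A f + A g) \<and>
     (\<forall>z. \<forall>f\<in>Hp p. A (cscale z f) = cscale z (A f)) \<and>
     (\<exists>C. \<forall>f\<in>Hp p. Lp_norm p (A f) \<le> C * Lp_norm p f)"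

definition ker_op :: "real \<Rightarrow> (tfun \<Rightarrow> tfun) \<Rightarrow> tfun set" where
  "ker_op p A = {f \<in> Hp p. A f = 0}"

definition im_op :: "real \<Rightarrow> (tfun \<Rightarrow> tfun) \<Rightarrow> tfun set" where
  "im_op p A = A ` Hp p"

text \<open>The pairing \<open>\<integral> f \<cdot> cnj g\<close> identifies the dual of \<open>H\<^sup>p\<close> (antilinearly) with \<open>H\<^sup>q\<close>. Under it
  the adjoint of \<open>T(a) \<plusminus> H(b)\<close> is \<open>T(cnj a) \<plusminus> H(tilde (cnj b))\<close> acting on \<open>H\<^sup>q\<close>.\<close>

definition pairing :: "tfun \<Rightarrow> tfun \<Rightarrow> complex" where
  "pairing f g = fourier (f * conj_fun g) 0"

definition adjoint_op :: "real \<Rightarrow> real \<Rightarrow> (tfun \<Rightarrow> tfun) \<Rightarrow> tfun \<Rightarrow> tfun" where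
  "adjoint_op p q A g = (THE h. h \<in> Hp q \<and> (\<forall>f\<in>Hp p. pairing (A f) g = pairing f h))"

definition coker_op :: "real \<Rightarrow> real \<Rightarrow> (tfun \<Rightarrow> tfun) \<Rightarrow> tfun set" where
  "coker_op p q A = ker_op q (adjoint_op p q A)"

definition finite_dim :: "tfun set \<Rightarrow> bool" where
  "finite_dim S \<longleftrightarrow> (\<exists>B. finite B \<and> S \<subseteq> cvs.span B)"

definition Lp_closed :: "real \<Rightarrow> tfun set \<Rightarrow> bool" where
  "Lp_closed p S \<longleftrightarrow> (\<forall>X. \<forall>f\<in>Lp p. (\<forall>n. X n \<in> S) \<and> (\<lambda>n. Lp_norm p (X n - f)) \<longlonglongrightarrow> 0 \<longrightarrow> f \<in> S)"

definition fredholm_op :: "real \<Rightarrow> real \<Rightarrow> (tfun \<Rightarrow> tfun) \<Rightarrow> bool" where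
  "fredholm_op p q A \<longleftrightarrow> bounded_op_Hp p A \<and> Lp_closed p (im_op p A) \<and>
     finite_dim (ker_op p A) \<and> finite_dim (coker_op p q A)"

definition index_op :: "real \<Rightarrow> real \<Rightarrow> (tfun \<Rightarrow> tfun) \<Rightarrow> int" where
  "index_op p q A = int (cvs.dim (ker_op p A)) - int (cvs.dim (coker_op p q A))"


definition matching_pair :: "tfun \<Rightarrow> tfun \<Rightarrow> bool" where
  "matching_pair a b \<longleftrightarrow> a \<in> Linf \<and> (\<exists>a'\<in>Linf. a * a' = 1) \<and> b \<in> Linf \<and>
     a * tilde a = b * tilde b"

definition subordinated_pair :: "tfun \<Rightarrow> tfun \<Rightarrow> tfun \<times> tfun" where
  "subordinated_pair a b = (a * inverse b, b * inverse (tilde a))"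

definition fredholm_matching_pair :: "real \<Rightarrow> real \<Rightarrow> tfun \<Rightarrow> tfun \<Rightarrow> bool" where
  "fredholm_matching_pair p q a b \<longleftrightarrow> matching_pair a b \<and>
     (case subordinated_pair a b of (c, d) \<Rightarrow>
        fredholm_op p q (toeplitz p c) \<and> fredholm_op p q (toeplitz p d))"


text \<open>Since \<open>inverse\<close> on \<open>tfun\<close> is total (with \<open>inverse 0 = 0\<close> pointwise), invertibility of the
  factors is stated explicitly. The inner Riesz projection acts on \<open>L\<^sup>q\<close>, as \<open>inverse gm \<in> L\<^sup>q\<close>
  and \<open>f\<close> is a polynomial.\<close>

definition wiener_hopf :: "real \<Rightarrow> real \<Rightarrow> tfun \<Rightarrow> tfun \<Rightarrow> int \<Rightarrow> tfun \<Rightarrow> bool" where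
  "wiener_hopf p q g gm \<nu> gp \<longleftrightarrow>
     g = gm * tpow \<nu> * gp \<and>
     gp * inverse gp = 1 \<and> gp \<in> Hp q \<and> inverse gp \<in> Hp p \<and>
     gm * inverse gm = 1 \<and> gm \<in> conj_Hp p \<and> inverse gm \<in> conj_Hp q \<and>
     fourier gm 0 = 1 \<and>
     (\<exists>B. bounded_op_Hp p B \<and>
        (\<forall>f\<in>cvs.span (tpow ` {0..}). B f = inverse gp * riesz_P q (inverse gm * f)))"

definition wh_minus :: "real \<Rightarrow> real \<Rightarrow> tfun \<Rightarrow> tfun" where
  "wh_minus p q g = (THE gm. \<exists>\<nu> gp. wiener_hopf p q g gm \<nu> gp)"

definition wh_plus :: "real \<Rightarrow> real \<Rightarrow> tfun \<Rightarrow> tfun" where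
  "wh_plus p q g = (THE gp. \<exists>\<nu> gm. wiener_hopf p q g gm \<nu> gp)"

definition signature :: "real \<Rightarrow> real \<Rightarrow> tfun \<Rightarrow> complex" where
  "signature p q g = fourier (wh_plus p q g) 0"


text \<open>In the following the parameter \<open>\<epsilon> \<in> {1, -1}\<close> selects the upper (\<open>1\<close>) or lower (\<open>-1\<close>)
  signs.\<close>

definition bold_P :: "real \<Rightarrow> tfun \<Rightarrow> tfun \<Rightarrow> tfun" where
  "bold_P p g f = flip_J (riesz_Q p (g * riesz_P p f))"

definition bold_P_sgn :: "complex \<Rightarrow> real \<Rightarrow> tfun \<Rightarrow> tfun \<Rightarrow> tfun" where
  "bold_P_sgn \<epsilon> p g f = cscale (1/2) (f + cscale \<epsilon> (bold_P p g f))"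

definition im_bold_P :: "complex \<Rightarrow> real \<Rightarrow> tfun \<Rightarrow> tfun set" where
  "im_bold_P \<epsilon> p g = bold_P_sgn \<epsilon> p g ` ker_op p (toeplitz p g)"

definition toeplitz_rinv :: "real \<Rightarrow> real \<Rightarrow> tfun \<Rightarrow> tfun \<Rightarrow> tfun" where
  "toeplitz_rinv p q g f =
     (let \<kappa> = index_op p q (toeplitz p g)
      in inv_into (Hp p) (toeplitz p (g * tpow \<kappa>)) (toeplitz p (tpow \<kappa>) f))"

definition phi :: "complex \<Rightarrow> real \<Rightarrow> real \<Rightarrow> tfun \<Rightarrow> tfun \<Rightarrow> tfun \<Rightarrow> tfun" where
  "phi \<epsilon> p q \<alpha> \<beta> s =
     (let \<gamma> = fst (subordinated_pair \<alpha> \<beta>);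
          \<alpha>' = inverse (tilde \<alpha>);
          r = toeplitz_rinv p q \<gamma> (toeplitz p \<alpha>' s)
      in r - cscale \<epsilon> (flip_J (riesz_Q p (\<gamma> * riesz_P p r)))
           + cscale \<epsilon> (flip_J (riesz_Q p (\<alpha>' * s))))"

end

theory Submission
  imports Defs "HOL-Complex_Analysis.Complex_Analysis" "HOL-Probability.Probability_Measure"
begin

text \<open>The cokernel of \<open>T(a) + \<epsilon>H(b)\<close> is the kernel of its adjoint, which is again a Toeplitz plus Hankel
  operator, now on \<open>H\<^sup>q\<close> (\<open>coker_toeplitz_hankel\<close>). Applying the adjoint to \<open>f\<close> is the same as applying
  the operator of the pair \<open>\<alpha> = conj a \<cdot> t\<^sup>-\<^sup>m\<close>, \<open>\<beta> = tilde (conj b) \<cdot> t\<^sup>m\<close> to \<open>t\<^sup>m f\<close>; this produces the outer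
  \<open>T(t\<^sup>-\<^sup>m)\<close> and the intersection with the image of \<open>T(t\<^sup>m)\<close> (\<open>ker_toeplitz_hankel_shift\<close>). The point of
  the shift is that \<open>\<gamma> = \<alpha>/\<beta> = conj d \<cdot> t\<^sup>-\<^sup>2\<^sup>m\<close> has index \<open>2m - \<kappa>2 \<in> {0, 1}\<close>, so that \<open>T(\<gamma>)\<close> is onto and the
  maps \<open>\<phi>\<close> make sense.

  The kernel for the shifted pair is computed in \<open>ker_toeplitz_hankel\<close>. For \<open>f\<close> in the Hardy space,
  \<open>f\<close> is in the kernel iff \<open>\<alpha>f + \<epsilon>\<beta>Jf = Js\<close> for some \<open>s\<close> in the Hardy space. Flipping this equation and
  using \<open>\<alpha> tilde \<alpha> = \<beta> tilde \<beta>\<close> gives \<open>\<delta>s = \<epsilon>Js\<close> with \<open>\<delta> = conj c\<close>, that is, \<open>s\<close> belongs to the image of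
  the projection attached to \<open>\<delta>\<close> and \<open>\<epsilon>\<close>. Conversely \<open>\<phi>(s)\<close> solves the equation with \<open>2\<epsilon>s\<close> in place of
  \<open>s\<close>. Two solutions with the same \<open>s\<close> differ by an \<open>f\<close> with \<open>\<gamma>f = -\<epsilon>Jf\<close>; such an \<open>f\<close> lies in \<open>ker T(\<gamma>)\<close>.
  For index 0 this kernel is trivial. For index 1 it is spanned by one function \<open>v\<close> with
  \<open>\<gamma>v = \<sigma>Jv\<close>, where \<open>\<sigma>\<close> is the factorization signature (\<open>signature_generator\<close>); hence \<open>v\<close> contributes
  exactly when \<open>\<sigma> = -\<epsilon>\<close>, which is what the factor \<open>(1 - \<epsilon>\<sigma>)/2\<close> records.

  The symbol \<open>d\<close> enters through \<open>g = d \<cdot> t\<^sup>\<kappa>\<close> with \<open>\<kappa>\<close> the index of \<open>T(d)\<close>. By Coburn's lemma a Fredholm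
  \<open>T(d)\<close> of nonnegative index is onto, and each factor \<open>t\<close> removes one dimension of its kernel, so
  \<open>T(g)\<close> is bijective (\<open>fredholm_toeplitz_bijective\<close>). A gliding hump argument, together with the
  density of ranges, transfers bijectivity to the adjoint \<open>T(conj g)\<close> and gives bounded inverses
  (\<open>toeplitz_bij_conj\<close>, \<open>toeplitz_bij_bounded_below\<close>). The Wiener-Hopf factors are then explicit: with
  \<open>T(g)u = 1\<close> and \<open>T(conj g)v = 1\<close> the minus factor is \<open>gu\<close>, the plus factor is \<open>1/u\<close>, and \<open>1/(gu)\<close> is a
  multiple of \<open>conj v\<close> (\<open>wiener_hopf_of_bijective\<close>). This is why the span of \<open>conj (1/d\<^sub>-)\<close> is the
  kernel \<open>\<complex>v\<close> met above.

  All of this uses that the Riesz projection exists on \<open>L\<^sup>p\<close>. The theorem of M. Riesz is proved for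
  \<open>1 < p \<le> 2\<close> by applying the mean value property to the \<open>p\<close>-th power of an analytic polynomial with
  positive real part, and for \<open>p > 2\<close> by duality. Functionals are obtained throughout from nearest
  points in closed subspaces of \<open>L\<^sup>p\<close> (\<open>annihilator\<close>).\<close>

section \<open>Integration over the circle\<close>

lemma prob_space_circle: "prob_space circle_measure"
  unfolding circle_measure_def
  using cis_borel_measurable
  by (intro prob_space.prob_space_distr prob_space_uniform_measure) auto

interpretation circle: prob_space circle_measure
  by (rule prob_space_circle)

lemma space_circle [simp]: "space circle_measure = UNIV"
  by (simp add: circle_measure_def)

lemma borel_measurable_circle_iff [simp]:
  "f \<in> borel_measurable circle_measure \<longleftrightarrow> f \<in> borel_measurable borel"
  by (intro eqset_imp_iff measurable_cong_sets) auto

lemma circle_AE_norm: "AE t in circle_measure. cmod t = 1"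
  by (subst AE_circle_measure_iff) auto

lemma
  fixes f :: "complex \<Rightarrow> 'b :: {banach, second_countable_topology}"
  assumes [measurable]: "f \<in> borel_measurable borel"
  shows circle_integral_lborel:
      "(LINT t|circle_measure. f t) = (LINT \<theta>|lborel. indicator {-pi..pi} \<theta> *\<^sub>R f (cis \<theta>)) /\<^sub>R (2 * pi)"
    and circle_integrable_lborel:
      "integrable circle_measure f \<longleftrightarrow> integrable lborel (\<lambda>\<theta>. indicator {-pi..pi} \<theta> *\<^sub>R f (cis \<theta>))"
proof -
  note [measurable] = cis_borel_measurable
  have eq: "uniform_measure lborel {-pi..pi} = density lborel (\<lambda>\<theta>. ennreal (indicator {-pi..pi} \<theta> / (2 * pi)))"
    unfolding uniform_measure_def
    by (rule density_cong) (auto simp: indicator_def divide_ennreal[symmetric] ennreal_mult)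
  have "(LINT t|circle_measure. f t) = (LINT \<theta>|uniform_measure lborel {-pi..pi}. f (cis \<theta>))"
    unfolding circle_measure_def by (subst integral_distr) auto
  also have "\<dots> = (LINT \<theta>|lborel. (indicator {-pi..pi} \<theta> / (2 * pi)) *\<^sub>R f (cis \<theta>))"
    unfolding eq by (subst integral_density) auto
  also have "\<dots> = (LINT \<theta>|lborel. (1 / (2*pi)) *\<^sub>R (indicator {-pi..pi} \<theta> *\<^sub>R f (cis \<theta>)))"
    by (intro Bochner_Integration.integral_cong) auto
  also have "\<dots> = (1 / (2*pi)) *\<^sub>R (LINT \<theta>|lborel. indicator {-pi..pi} \<theta> *\<^sub>R f (cis \<theta>))"
    by (rule integral_scaleR_right)
  finally show "(LINT t|circle_measure. f t) = (LINT \<theta>|lborel. indicator {-pi..pi} \<theta> *\<^sub>R f (cis \<theta>)) /\<^sub>R (2 * pi)"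
    by (simp only: inverse_eq_divide)
  have "integrable circle_measure f \<longleftrightarrow> integrable (uniform_measure lborel {-pi..pi}) (\<lambda>\<theta>. f (cis \<theta>))"
    unfolding circle_measure_def by (subst integrable_distr_eq) auto
  also have "\<dots> \<longleftrightarrow> integrable lborel (\<lambda>\<theta>. (indicator {-pi..pi} \<theta> / (2 * pi)) *\<^sub>R f (cis \<theta>))"
    unfolding eq by (subst integrable_density) auto
  also have "\<dots> \<longleftrightarrow> integrable lborel (\<lambda>\<theta>. (1 / (2*pi)) *\<^sub>R (indicator {-pi..pi} \<theta> *\<^sub>R f (cis \<theta>)))"
    by (intro Bochner_Integration.integrable_cong) auto
  also have "\<dots> \<longleftrightarrow> integrable lborel (\<lambda>\<theta>. indicator {-pi..pi} \<theta> *\<^sub>R f (cis \<theta>))"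
    (is "integrable lborel (\<lambda>\<theta>. (1 / (2*pi)) *\<^sub>R ?h \<theta>) = _")
  proof
    assume "integrable lborel (\<lambda>\<theta>. (1 / (2*pi)) *\<^sub>R ?h \<theta>)"
    from integrable_scaleR_right[of "2*pi", OF this] show "integrable lborel ?h" by simp
  qed (rule integrable_scaleR_right)
  finally show "integrable circle_measure f \<longleftrightarrow> integrable lborel (\<lambda>\<theta>. indicator {-pi..pi} \<theta> *\<^sub>R f (cis \<theta>))" .
qed

lemma
  fixes f :: "complex \<Rightarrow> 'b :: {banach, second_countable_topology}"
  assumes [measurable]: "f \<in> borel_measurable borel"
  shows circle_integral_inverse: "(LINT t|circle_measure. f (1 / t)) = (LINT t|circle_measure. f t)"
    and circle_integrable_inverse: "integrable circle_measure (\<lambda>t. f (1 / t)) \<longleftrightarrow> integrable circle_measure f"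
proof -
  note [measurable] = cis_borel_measurable
  have *: "(\<lambda>\<theta>. indicator {-pi..pi} (0 + (-1) * \<theta>) *\<^sub>R f (cis (0 + (-1) * \<theta>)))
     = (\<lambda>\<theta>. indicator {-pi..pi} \<theta> *\<^sub>R f (1 / cis \<theta>))"
    by (rule ext) (auto simp: indicator_def divide_inverse)
  show "(LINT t|circle_measure. f (1 / t)) = (LINT t|circle_measure. f t)"
    using lborel_integral_real_affine[of "-1" "\<lambda>\<theta>. indicator {-pi..pi} \<theta> *\<^sub>R f (cis \<theta>)" 0]
    unfolding * by (simp add: circle_integral_lborel)
  show "integrable circle_measure (\<lambda>t. f (1 / t)) \<longleftrightarrow> integrable circle_measure f"
    using lborel_integrable_real_affine_iff[of "-1" "\<lambda>\<theta>. indicator {-pi..pi} \<theta> *\<^sub>R f (cis \<theta>)" 0]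
    unfolding * by (simp add: circle_integrable_lborel)
qed

lemma circle_integrable_bounded:
  fixes f :: "complex \<Rightarrow> 'b :: {banach, second_countable_topology}"
  assumes "f \<in> borel_measurable borel" "\<And>t. cmod t = 1 \<Longrightarrow> norm (f t) \<le> B"
  shows "integrable circle_measure f"
  using assms circle_AE_norm
  by (intro circle.integrable_const_bound[where B = B]) (auto elim: eventually_mono)

lemma circle_mean_value:
  assumes cont: "continuous_on (cball 0 1) F" and hol: "F holomorphic_on ball 0 1"
    and [measurable]: "F \<in> borel_measurable borel"
  shows "(LINT t|circle_measure. F t) = F 0"
proof -
  have sub: "(\<lambda>x. - x) ` cball 0 1 \<subseteq> cball (0::complex) 1" "(\<lambda>x. - x) ` ball 0 1 \<subseteq> ball (0::complex) 1" by auto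
  \<comment> \<open>The reflection u \<mapsto> -u moves the parameter interval of the Cauchy integral from \<open>{0..2*pi}\<close> to \<open>{-pi..pi}\<close>.\<close>
  have "((\<lambda>u. F (- u) / (u - 0)) has_contour_integral (2 * of_real pi * \<i> * F (-0))) (circlepath 0 1)"
  proof (rule Cauchy_integral_circlepath)
    show "continuous_on (cball 0 1) (\<lambda>u. F (- u))"
      using sub(1) by (intro continuous_on_compose2[OF cont]) (auto intro: continuous_on_minus)
    show "(\<lambda>u. F (- u)) holomorphic_on ball 0 1"
      using holomorphic_on_compose_gen[OF _ hol sub(2)] by (simp add: o_def holomorphic_on_minus)
    show "norm (0 - 0 :: complex) < 1" by simp
  qed
  then have "((\<lambda>t. F (- cis t) / cis t * (\<i> * cis t)) has_integral (2 * of_real pi * \<i> * F 0)) {0..2*pi}"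
    unfolding circlepath_def by (subst (asm) has_contour_integral_part_circlepath_iff) (auto simp: mult_ac)
  then have "((\<lambda>t. (- \<i>) * (F (- cis t) / cis t * (\<i> * cis t))) has_integral (- \<i> * (2 * of_real pi * \<i> * F 0))) {0..2*pi}"
    by (rule has_integral_mult_right)
  moreover have "(\<lambda>t. (- \<i>) * (F (- cis t) / cis t * (\<i> * cis t))) = (\<lambda>t. F (- cis t))"
    by (rule ext) (simp add: field_simps)
  moreover have "- \<i> * (2 * of_real pi * \<i> * F 0) = 2 * of_real pi * F 0"
    by (simp add: field_simps)
  ultimately have "((\<lambda>t. F (- cis t)) has_integral (2 * of_real pi * F 0)) (cbox 0 (2*pi))"
    by (simp only: cbox_interval)
  then have "((\<lambda>t. F (- cis (t + pi))) has_integral (2 * of_real pi * F 0)) (cbox (0 - pi) (2*pi - pi))"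
    using has_integral_affinity[of "\<lambda>t. F (- cis t)" "2 * of_real pi * F 0" 0 "2*pi" 1 pi] by (simp add: add.commute)
  then have hi: "((\<lambda>t. F (cis t)) has_integral (2 * of_real pi * F 0)) {-pi..pi}"
    by (simp add: cis_mult[symmetric])
  have ci: "continuous_on {-pi..pi} (\<lambda>\<theta>. F (cis \<theta>))"
    by (rule continuous_on_compose2[OF cont]) (auto intro!: continuous_intros)
  have si: "set_integrable lborel {-pi..pi} (\<lambda>\<theta>. F (cis \<theta>))"
    by (rule borel_integrable_compact[OF _ ci, folded set_integrable_def]) auto
  have "(LINT \<theta>|lborel. indicator {-pi..pi} \<theta> *\<^sub>R F (cis \<theta>)) = 2 * of_real pi * F 0"
    using set_borel_integral_eq_integral(2)[OF si] hi
    by (simp add: set_lebesgue_integral_def integral_unique)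
  then show ?thesis
    by (simp add: circle_integral_lborel scaleR_conv_of_real)
qed

lemma powi_borel_measurable [measurable]: "(\<lambda>t::complex. t powi k) \<in> borel_measurable borel"
  unfolding power_int_def by auto

lemma circle_integral_powi: "(LINT t|circle_measure. t powi k) = (if k = 0 then 1 else 0)"
proof -
  have pos: "(LINT t|circle_measure. t powi k) = 0" if "k > 0" for k :: int
  proof -
    have "(LINT t|circle_measure. t ^ nat k) = (0::complex) ^ nat k"
      by (rule circle_mean_value) (auto intro!: continuous_intros holomorphic_intros)
    then show ?thesis using that by (simp add: power_int_def)
  qed
  consider "k = 0" | "k > 0" | "k < 0" by linarith
  then show ?thesis
  proof cases
    case 1
    then show ?thesis using circle.prob_space by simp
  next
    case 3
    have "(LINT t|circle_measure. t powi k) = (LINT t|circle_measure. (1 / t) powi (-k))"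
      by (simp add: power_int_minus divide_inverse power_int_inverse)
    also have "\<dots> = (LINT t|circle_measure. t powi (-k))"
      by (rule circle_integral_inverse) measurable
    finally show ?thesis using pos[of "-k"] 3 by simp
  qed (use pos in auto)
qed

section \<open>Representatives and algebraic identities\<close>

text \<open>Identities in the quotient type are proved pointwise, almost everywhere, on representatives.\<close>

abbreviation rp :: "tfun \<Rightarrow> complex \<Rightarrow> complex" where "rp \<equiv> rep_tfun"

lemma rp_borel [measurable, simp]: "rp f \<in> borel_measurable borel"
  using Quotient_rep_reflp[OF Quotient_tfun, of f] by (simp add: ae_eq_def)

lemma ae_eq_rp [simp]: "ae_eq (rp f) (rp f)"
  using Quotient_rep_reflp[OF Quotient_tfun] .

lemma abs_rp [simp]: "abs_tfun (rp f) = f"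
  using Quotient_abs_rep[OF Quotient_tfun] .

lemma rp_abs: "F \<in> borel_measurable borel \<Longrightarrow> AE t in circle_measure. rp (abs_tfun F) t = F t"
  using Quotient_rep_abs[OF Quotient_tfun, of F] by (simp add: ae_eq_def)

lemma tfun_eqI: "AE t in circle_measure. rp f t = rp g t \<Longrightarrow> f = g"
  using Quotient_rel_rep[OF Quotient_tfun, of f g] by (simp add: ae_eq_def)

lemma rp_zero: "AE t in circle_measure. rp 0 t = 0"
  unfolding zero_tfun_def by (rule rp_abs) simp
lemma rp_one: "AE t in circle_measure. rp 1 t = 1"
  unfolding one_tfun_def by (rule rp_abs) simp
lemma rp_tpow: "AE t in circle_measure. rp (tpow k) t = t powi k"
  unfolding tpow_def by (auto intro: rp_abs)

lemma rp_plus: "AE t in circle_measure. rp (f + g) t = rp f t + rp g t"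
  using rp_abs[of "\<lambda>t. rp f t + rp g t"] plus_tfun.abs_eq[of "rp f" "rp g"] by simp
lemma rp_minus: "AE t in circle_measure. rp (f - g) t = rp f t - rp g t"
  using rp_abs[of "\<lambda>t. rp f t - rp g t"] minus_tfun.abs_eq[of "rp f" "rp g"] by simp
lemma rp_times: "AE t in circle_measure. rp (f * g) t = rp f t * rp g t"
  using rp_abs[of "\<lambda>t. rp f t * rp g t"] times_tfun.abs_eq[of "rp f" "rp g"] by simp
lemma rp_uminus: "AE t in circle_measure. rp (- f) t = - rp f t"
  using rp_abs[of "\<lambda>t. - rp f t"] uminus_tfun.abs_eq[of "rp f"] by simp
lemma rp_inverse: "AE t in circle_measure. rp (inverse f) t = inverse (rp f t)"
  using rp_abs[of "\<lambda>t. inverse (rp f t)"] inverse_tfun.abs_eq[of "rp f"] by simp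
lemma rp_cscale: "AE t in circle_measure. rp (cscale z f) t = z * rp f t"
  using rp_abs[of "\<lambda>t. z * rp f t"] cscale.abs_eq[of "rp f" z] by simp
lemma rp_conj: "AE t in circle_measure. rp (conj_fun f) t = cnj (rp f t)"
proof -
  have [measurable]: "cnj \<in> borel_measurable borel"
    by (intro borel_measurable_continuous_onI continuous_intros)
  show ?thesis
    using rp_abs[of "\<lambda>t. cnj (rp f t)"] conj_fun.abs_eq[of "rp f"] by simp
qed
lemma rp_tilde: "AE t in circle_measure. rp (tilde f) t = rp f (1 / t)"
  using rp_abs[of "\<lambda>t. rp f (1 / t)"] tilde.abs_eq[of "rp f"] by simp

lemma in_Lp_iff: "f \<in> Lp p \<longleftrightarrow> integrable circle_measure (\<lambda>t. cmod (rp f t) powr p)"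
  using in_Lp.abs_eq[of "rp f" p] by (simp add: Lp_def)
lemma in_Linf_iff: "f \<in> Linf \<longleftrightarrow> (\<exists>C. AE t in circle_measure. cmod (rp f t) \<le> C)"
  using in_Linf.abs_eq[of "rp f"] by (simp add: Linf_def)
lemma Lp_norm_eq: "Lp_norm p f = (LINT t|circle_measure. cmod (rp f t) powr p) powr (1 / p)"
  using Lp_norm.abs_eq[of "rp f" p] by simp
lemma fourier_eq: "fourier f n = (LINT t|circle_measure. rp f t * t powi (- n))"
  using fourier.abs_eq[of "rp f"] by simp

lemma cscale_times_left [simp]: "cscale z f * g = cscale z (f * g)"
  by transfer (auto simp: ae_eq_def)
lemma cscale_times_right [simp]: "f * cscale z g = cscale z (f * g)"
  by transfer (auto simp: ae_eq_def)
lemma cscale_minus_one: "cscale (-1) f = - f"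
  by transfer (auto simp: ae_eq_def)
lemma cscale_cscale [simp]: "cscale z (cscale w f) = cscale (z * w) f"
  by (rule cvs.scale_scale)
lemma cscale_add: "cscale z (f + g) = cscale z f + cscale z g"
  by (rule cvs.scale_right_distrib)
lemma cscale_diff: "cscale z (f - g) = cscale z f - cscale z g"
  by (rule cvs.scale_right_diff_distrib)

lemma tilde_simps [simp]:
  "tilde (f + g) = tilde f + tilde g" "tilde (f - g) = tilde f - tilde g"
  "tilde (f * g) = tilde f * tilde g" "tilde (inverse f) = inverse (tilde f)"
  "tilde (tilde f) = f" "tilde 1 = 1" "tilde 0 = 0" "tilde (cscale z f) = cscale z (tilde f)"
  "tilde (- f) = - tilde f"
  by (transfer, auto simp: ae_eq_def)+
lemma tilde_conj: "tilde (conj_fun f) = conj_fun (tilde f)"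
  by transfer (auto simp: ae_eq_def intro: measurable_compose[OF _ borel_measurable_continuous_onI]
      continuous_intros)
lemma tilde_tpow [simp]: "tilde (tpow k) = tpow (- k)"
proof (rule tfun_eqI)
  have "AE t in circle_measure. rp (tpow k) (1 / t) = (1 / t) powi k"
    using AE_circle_inverse[OF _ rp_tpow, of k] by measurable
  with rp_tilde[of "tpow k"] rp_tpow[of "-k"]
  show "AE t in circle_measure. rp (tilde (tpow k)) t = rp (tpow (-k)) t"
    by eventually_elim (simp add: power_int_minus divide_inverse power_int_inverse)
qed

lemma conj_simps [simp]:
  "conj_fun (f + g) = conj_fun f + conj_fun g" "conj_fun (f - g) = conj_fun f - conj_fun g"
  "conj_fun (f * g) = conj_fun f * conj_fun g" "conj_fun (inverse f) = inverse (conj_fun f)"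
  "conj_fun (conj_fun f) = f" "conj_fun 1 = 1" "conj_fun 0 = 0"
  "conj_fun (cscale z f) = cscale (cnj z) (conj_fun f)"  "conj_fun (- f) = - conj_fun f"
  by (transfer, auto simp: ae_eq_def intro!: measurable_compose[OF _ borel_measurable_continuous_onI[of cnj]]
      borel_measurable_add borel_measurable_diff borel_measurable_times borel_measurable_inverse borel_measurable_uminus continuous_intros)+

lemma conj_tpow [simp]: "conj_fun (tpow k) = tpow (- k)"
proof (rule tfun_eqI)
  show "AE t in circle_measure. rp (conj_fun (tpow k)) t = rp (tpow (-k)) t"
    using rp_conj[of "tpow k"] rp_tpow[of "-k"] rp_tpow[of k] circle_AE_norm
  proof eventually_elim
    case (elim t)
    then have "cnj t = inverse t"
      by (metis complex_cnj_cancel_iff complex_cnj_one complex_mod_mult_cnj complex_norm_square inverse_unique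
           of_real_1 power_one)
    with elim show ?case by (simp add: power_int_def power_inverse)
  qed
qed

lemma tpow_0 [simp]: "tpow 0 = 1"
  by transfer (auto simp: ae_eq_def)
lemma tpow_add: "tpow (j + k) = tpow j * tpow k"
proof (rule tfun_eqI)
  show "AE t in circle_measure. rp (tpow (j + k)) t = rp (tpow j * tpow k) t"
    using rp_times[of "tpow j" "tpow k"] rp_tpow[of j] rp_tpow[of k] rp_tpow[of "j+k"] AE_circle_nonzero
    by eventually_elim (simp add: power_int_add)
qed
lemma tpow_mult_left: "tpow j * (tpow k * f) = tpow (j + k) * f"
  by (simp add: tpow_add mult.assoc)
lemma tpow_inverse [simp]: "tpow k * tpow (- k) = 1" "tpow (- k) * tpow k = 1"
  by (simp_all flip: tpow_add)

lemma inverse_tfun_unique: "f * g = 1 \<Longrightarrow> inverse f = (g :: tfun)"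
proof (rule tfun_eqI)
  assume fg: "f * g = 1"
  have "AE t in circle_measure. rp f t * rp g t = 1"
    using rp_times[of f g, unfolded fg] rp_one by eventually_elim simp
  with rp_inverse[of f] show "AE t in circle_measure. rp (inverse f) t = rp g t"
    by eventually_elim (simp add: inverse_unique)
qed

lemma inverse_inverse_tfun [simp]: "inverse (inverse f) = (f :: tfun)"
  by transfer (auto simp: ae_eq_def)
lemma inverse_mult_tfun [simp]: "inverse (f * g) = inverse f * inverse (g :: tfun)"
  by transfer (auto simp: ae_eq_def)
lemma inverse_tpow [simp]: "inverse (tpow k) = tpow (- k)"
  by (rule inverse_tfun_unique) simp

lemma flip_J_simps [simp]:
  "flip_J (f + g) = flip_J f + flip_J g" "flip_J (f - g) = flip_J f - flip_J g"
  "flip_J (cscale z f) = cscale z (flip_J f)" "flip_J 0 = 0"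
  by (simp_all add: flip_J_def algebra_simps)
lemma flip_J_flip_J [simp]: "flip_J (flip_J f) = f"
  by (simp add: flip_J_def flip: mult.assoc tpow_add)
lemma flip_J_mult: "flip_J (a * f) = tilde a * flip_J f"
  by (simp add: flip_J_def mult_ac)

section \<open>The spaces \<open>L\<^sup>p\<close>\<close>

locale conjugate_exponents =
  fixes p q :: real
  assumes p_gt_1: "1 < p" and pq: "1 / p + 1 / q = 1"
begin

lemma q_gt_1: "1 < q"
proof -
  have "1 / q = 1 - 1 / p" "0 < 1 / p" "1 / p < 1" using pq p_gt_1 by (auto simp: field_simps)
  then have "0 < 1 / q" "1 / q < 1" by linarith+
  then show ?thesis by (cases "q > 0") (auto simp: field_simps)
qed

lemma exponent_eqs: "(p - 1) * q = p" "p + q = p * q" "(p - 1) / p = 1 / q"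
  using pq p_gt_1 q_gt_1 by (auto simp: field_simps)

lemma conjugate_exponents_sym: "conjugate_exponents q p"
  using pq q_gt_1 by (intro conjugate_exponents.intro) linarith+

end

lemma powr_add_le:
  fixes x y p :: real
  assumes "0 \<le> x" "0 \<le> y" "0 \<le> p"
  shows "(x + y) powr p \<le> 2 powr p * (x powr p + y powr p)"
proof -
  have "(x + y) powr p \<le> (2 * max x y) powr p"
    using assms by (intro powr_mono2) auto
  also have "\<dots> = 2 powr p * (max x y) powr p"
    by (simp add: powr_mult)
  also have "(max x y) powr p \<le> x powr p + y powr p"
    by (auto simp: max_def)
  finally show ?thesis by simp
qed

text \<open>When one of the points is 0 the inequality reduces to \<open>l powr p \<le> l\<close> for weights \<open>l \<le> 1\<close>.\<close>

lemma powr_convex_nonneg: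
  fixes x y p :: real
  assumes p: "1 \<le> p" and xy: "0 \<le> x" "0 \<le> y" and l: "0 \<le> l" "0 \<le> m" "l + m = 1"
  shows "(l * x + m * y) powr p \<le> l * x powr p + m * y powr p"
proof -
  have aux: "(l * x) powr p \<le> l * x powr p" if "0 \<le> l" "l \<le> 1" "0 \<le> x" for l x :: real
  proof -
    have "l powr p \<le> l powr 1" using that p by (intro powr_mono') auto
    then show ?thesis using that by (simp add: powr_mult mult_right_mono)
  qed
  show ?thesis
  proof (cases "x = 0 \<or> y = 0")
    case True
    then show ?thesis using aux[of l x] aux[of m y] xy l p by auto
  next
    case False
    then show ?thesis using powr_convex[OF p] xy l unfolding convex_on_def by auto
  qed
qed

lemma Lp_I:
  assumes "integrable circle_measure G" "AE t in circle_measure. cmod (rp f t) powr p \<le> G t"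
  shows "f \<in> Lp p"
  unfolding in_Lp_iff
  by (rule Bochner_Integration.integrable_bound[OF assms(1)]) (use assms(2) in \<open>auto elim: eventually_mono\<close>)

lemma Lp_integrable: "f \<in> Lp p \<Longrightarrow> integrable circle_measure (\<lambda>t. cmod (rp f t) powr p)"
  by (simp add: in_Lp_iff)

lemma Lp_zero [simp]: "0 \<in> Lp p"
  unfolding in_Lp_iff
  by (rule integrable_cong_AE_imp[of _ "\<lambda>_. 0"]) (use rp_zero in \<open>auto elim: eventually_mono\<close>)

lemma Lp_add: assumes "0 \<le> p" "f \<in> Lp p" "g \<in> Lp p" shows "f + g \<in> Lp p"
proof (rule Lp_I)
  show "integrable circle_measure (\<lambda>t. 2 powr p * (cmod (rp f t) powr p + cmod (rp g t) powr p))"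
    using assms by (auto simp: in_Lp_iff)
  show "AE t in circle_measure. cmod (rp (f + g) t) powr p \<le> 2 powr p * (cmod (rp f t) powr p + cmod (rp g t) powr p)"
    using rp_plus[of f g]
  proof eventually_elim
    case (elim t)
    have "cmod (rp (f + g) t) powr p \<le> (cmod (rp f t) + cmod (rp g t)) powr p"
      unfolding elim by (intro powr_mono2 norm_triangle_ineq) (use assms in auto)
    also have "\<dots> \<le> 2 powr p * (cmod (rp f t) powr p + cmod (rp g t) powr p)"
      by (rule powr_add_le) (use assms in auto)
    finally show ?case .
  qed
qed

lemma Lp_norm_nonneg [simp]: "0 \<le> Lp_norm p f"
  by (simp add: Lp_norm_eq)

lemma Lp_integral_cscale:
  "(LINT t|circle_measure. cmod (rp (cscale z f) t) powr p) = cmod z powr p * (LINT t|circle_measure. cmod (rp f t) powr p)"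
proof -
  have "(LINT t|circle_measure. cmod (rp (cscale z f) t) powr p) = (LINT t|circle_measure. cmod z powr p * cmod (rp f t) powr p)"
    by (rule integral_cong_AE) (use rp_cscale[of z f] in \<open>auto elim!: eventually_mono simp: norm_mult powr_mult\<close>)
  then show ?thesis by simp
qed

lemma Lp_cscale: assumes "f \<in> Lp p" shows "cscale z f \<in> Lp p"
proof (rule Lp_I)
  show "integrable circle_measure (\<lambda>t. cmod z powr p * cmod (rp f t) powr p)"
    using assms by (auto simp: in_Lp_iff)
qed (use rp_cscale[of z f] in \<open>auto elim!: eventually_mono simp: norm_mult powr_mult\<close>)

lemma Lp_uminus: "f \<in> Lp p \<Longrightarrow> - f \<in> Lp p"
  using Lp_cscale[of f p "-1"] by (simp add: cscale_minus_one)

lemma Lp_diff: "0 \<le> p \<Longrightarrow> f \<in> Lp p \<Longrightarrow> g \<in> Lp p \<Longrightarrow> f - g \<in> Lp p"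
  using Lp_add[of p f "-g"] by (simp add: Lp_uminus)

lemma Lp_norm_powr: "0 < p \<Longrightarrow> Lp_norm p f powr p = (LINT t|circle_measure. cmod (rp f t) powr p)"
  unfolding Lp_norm_eq by (simp add: powr_powr integral_nonneg_AE)

lemma Lp_norm_cscale: "0 < p \<Longrightarrow> Lp_norm p (cscale z f) = cmod z * Lp_norm p f"
  unfolding Lp_norm_eq Lp_integral_cscale by (simp add: powr_mult powr_powr)

lemma Lp_norm_uminus [simp]: "Lp_norm p (- f) = Lp_norm p f"
  unfolding Lp_norm_eq
  by (intro arg_cong[where f = "\<lambda>x. x powr _"] integral_cong_AE) (use rp_uminus[of f] in \<open>auto elim: eventually_mono\<close>)

lemma Lp_norm_minus_commute: "Lp_norm p (f - g) = Lp_norm p (g - f)"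
  using Lp_norm_uminus[of p "g - f"] by simp

lemma Lp_norm_zero [simp]: "Lp_norm p 0 = 0"
proof -
  have "(LINT t|circle_measure. cmod (rp 0 t) powr p) = (LINT t|circle_measure. 0)"
    by (rule integral_cong_AE) (use rp_zero in \<open>auto elim: eventually_mono\<close>)
  then show ?thesis by (simp add: Lp_norm_eq)
qed

lemma Lp_norm_eq_0_iff: assumes "0 < p" "f \<in> Lp p" shows "Lp_norm p f = 0 \<longleftrightarrow> f = 0"
proof
  assume "Lp_norm p f = 0"
  then have "(LINT t|circle_measure. cmod (rp f t) powr p) = 0"
    using Lp_norm_powr[OF \<open>0 < p\<close>, of f] assms by simp
  then have "AE t in circle_measure. cmod (rp f t) powr p = 0"
    using integral_nonneg_eq_0_iff_AE[OF Lp_integrable[OF assms(2)]] by simp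
  then have "AE t in circle_measure. rp f t = rp 0 t"
    using rp_zero by eventually_elim simp
  then show "f = 0" by (rule tfun_eqI)
qed simp

text \<open>Convexity of the power function, applied to the normalised functions with weights
  \<open>A/(A+B)\<close> and \<open>B/(A+B)\<close>.\<close>

lemma Lp_norm_triangle:
  assumes p: "1 \<le> p" and f: "f \<in> Lp p" and g: "g \<in> Lp p"
  shows "Lp_norm p (f + g) \<le> Lp_norm p f + Lp_norm p g"
proof (cases "Lp_norm p f = 0 \<or> Lp_norm p g = 0")
  case True
  then show ?thesis using Lp_norm_eq_0_iff assms by fastforce
next
  case False
  define A B where "A = Lp_norm p f" and "B = Lp_norm p g"
  have AB: "A > 0" "B > 0" using False Lp_norm_nonneg[of p] by (auto simp: A_def B_def less_le)
  let ?G = "\<lambda>t. (A + B) powr p * (A / (A + B) * (cmod (rp f t) powr p / A powr p) + B / (A + B) * (cmod (rp g t) powr p / B powr p))"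
  have "(LINT t|circle_measure. cmod (rp (f + g) t) powr p) \<le> (LINT t|circle_measure. ?G t)"
  proof (rule integral_mono_AE)
    show "integrable circle_measure (\<lambda>t. cmod (rp (f + g) t) powr p)"
      using Lp_add[of p f g] p f g by (simp add: in_Lp_iff)
    show "integrable circle_measure ?G" using f g by (simp add: in_Lp_iff)
    show "AE t in circle_measure. cmod (rp (f + g) t) powr p \<le> ?G t"
      using rp_plus[of f g]
    proof eventually_elim
      case (elim t)
      let ?x = "cmod (rp f t)" and ?y = "cmod (rp g t)"
      have "cmod (rp (f + g) t) powr p \<le> (?x + ?y) powr p"
        unfolding elim by (intro powr_mono2 norm_triangle_ineq) (use p in auto)
      also have "?x + ?y = (A + B) * (A / (A + B) * (?x / A) + B / (A + B) * (?y / B))"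
      proof -
        have "A / (A + B) * (?x / A) + B / (A + B) * (?y / B) = (?x + ?y) / (A + B)"
          using AB by (simp add: add_divide_distrib)
        then show ?thesis using AB by simp
      qed
      also have "\<dots> powr p = (A + B) powr p * (A / (A + B) * (?x / A) + B / (A + B) * (?y / B)) powr p"
        by (rule powr_mult)
      also have "\<dots> \<le> (A + B) powr p * (A / (A + B) * (?x / A) powr p + B / (A + B) * (?y / B) powr p)"
        by (intro mult_left_mono powr_convex_nonneg) (use AB p in \<open>auto simp: divide_simps\<close>)
      also have "\<dots> = ?G t" using AB by (simp add: powr_divide)
      finally show ?case .
    qed
  qed
  also have "\<dots> = (A + B) powr p * (A / (A + B) * ((LINT t|circle_measure. cmod (rp f t) powr p) / A powr p)
      + B / (A + B) * ((LINT t|circle_measure. cmod (rp g t) powr p) / B powr p))"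
    using f g by (simp add: in_Lp_iff)
  also have "\<dots> = (A + B) powr p"
  proof -
    have "(LINT t|circle_measure. cmod (rp f t) powr p) = A powr p" "(LINT t|circle_measure. cmod (rp g t) powr p) = B powr p"
      using p by (simp_all add: Lp_norm_powr A_def B_def)
    then show ?thesis using AB by (simp flip: add_divide_distrib)
  qed
  finally have "Lp_norm p (f + g) powr p \<le> (A + B) powr p"
    using p by (simp add: Lp_norm_powr)
  then show ?thesis unfolding A_def[symmetric] B_def[symmetric]
    using AB p powr_less_mono2[of p "A + B" "Lp_norm p (f + g)"] by fastforce
qed

lemma Lp_norm_triangle_diff:
  assumes "1 \<le> p" "f \<in> Lp p" "g \<in> Lp p" "h \<in> Lp p"
  shows "Lp_norm p (f - h) \<le> Lp_norm p (f - g) + Lp_norm p (g - h)"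
  using Lp_norm_triangle[of p "f - g" "g - h"] assms by (simp add: Lp_diff)

lemma Lp_norm_1: "Lp_norm 1 f = (LINT t|circle_measure. cmod (rp f t))"
  by (simp add: Lp_norm_eq integral_nonneg_AE)

lemma Lp_1_iff: "f \<in> Lp 1 \<longleftrightarrow> integrable circle_measure (rp f)"
  by (simp add: in_Lp_iff integrable_norm_iff)

lemma (in conjugate_exponents) Holder:
  assumes f: "f \<in> Lp p" and g: "g \<in> Lp q"
  shows "f * g \<in> Lp 1" "Lp_norm 1 (f * g) \<le> Lp_norm p f * Lp_norm q g"
proof -
  have young: "cmod (rp f t) * cmod (rp g t) \<le> cmod (rp f t) powr p / p + cmod (rp g t) powr q / q" for t
    using Youngs_inequality p_gt_1 q_gt_1 pq by simp
  show 1: "f * g \<in> Lp 1"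
  proof (rule Lp_I)
    show "integrable circle_measure (\<lambda>t. cmod (rp f t) powr p / p + cmod (rp g t) powr q / q)"
      using f g by (simp add: in_Lp_iff)
    show "AE t in circle_measure. cmod (rp (f * g) t) powr 1 \<le> cmod (rp f t) powr p / p + cmod (rp g t) powr q / q"
      using rp_times[of f g] by eventually_elim (use young in \<open>simp add: norm_mult\<close>)
  qed
  show "Lp_norm 1 (f * g) \<le> Lp_norm p f * Lp_norm q g"
  proof (cases "Lp_norm p f = 0 \<or> Lp_norm q g = 0")
    case True
    then show ?thesis using Lp_norm_eq_0_iff f g p_gt_1 q_gt_1 by fastforce
  next
    case False
    define A B where "A = Lp_norm p f" and "B = Lp_norm q g"
    have AB: "A > 0" "B > 0" using False Lp_norm_nonneg by (auto simp: A_def B_def less_le)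
    let ?G = "\<lambda>t. A * B * (cmod (rp f t) powr p / A powr p / p + cmod (rp g t) powr q / B powr q / q)"
    have "Lp_norm 1 (f * g) \<le> (LINT t|circle_measure. ?G t)"
      unfolding Lp_norm_1
    proof (rule integral_mono_AE)
      show "integrable circle_measure (\<lambda>t. cmod (rp (f * g) t))" using 1 by (simp add: Lp_1_iff)
      show "integrable circle_measure ?G" using f g by (simp add: in_Lp_iff)
      show "AE t in circle_measure. cmod (rp (f * g) t) \<le> ?G t"
        using rp_times[of f g]
      proof eventually_elim
        case (elim t)
        have "cmod (rp (f * g) t) = A * B * ((cmod (rp f t) / A) * (cmod (rp g t) / B))"
          using AB elim by (simp add: norm_mult)
        also have "\<dots> \<le> A * B * ((cmod (rp f t) / A) powr p / p + (cmod (rp g t) / B) powr q / q)"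
          by (intro mult_left_mono Youngs_inequality) (use AB p_gt_1 q_gt_1 pq in auto)
        finally show ?case using AB by (simp add: powr_divide)
      qed
    qed
    also have "\<dots> = A * B * ((LINT t|circle_measure. cmod (rp f t) powr p) / A powr p / p
        + (LINT t|circle_measure. cmod (rp g t) powr q) / B powr q / q)"
      using f g by (simp add: in_Lp_iff)
    also have "\<dots> = A * B * (1 / p + 1 / q)"
    proof -
      have "(LINT t|circle_measure. cmod (rp f t) powr p) = A powr p" "(LINT t|circle_measure. cmod (rp g t) powr q) = B powr q"
        using p_gt_1 q_gt_1 by (simp_all add: Lp_norm_powr A_def B_def)
      then show ?thesis using AB by simp
    qed
    finally show ?thesis using pq by (simp add: A_def B_def)
  qed
qed

lemma Linf_mult_Lp:
  assumes "0 \<le> p" "a \<in> Linf" "f \<in> Lp p" shows "a * f \<in> Lp p"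
proof -
  obtain C where C: "AE t in circle_measure. cmod (rp a t) \<le> C" using assms by (auto simp: in_Linf_iff)
  show ?thesis
  proof (rule Lp_I)
    show "integrable circle_measure (\<lambda>t. C powr p * cmod (rp f t) powr p)"
      using assms by (auto simp: in_Lp_iff)
    show "AE t in circle_measure. cmod (rp (a * f) t) powr p \<le> C powr p * cmod (rp f t) powr p"
      using C rp_times[of a f]
      by eventually_elim (use assms in \<open>auto simp: norm_mult powr_mult intro!: mult_right_mono powr_mono2\<close>)
  qed
qed

lemma Linf_mult_bound:
  assumes "a \<in> Linf"
  obtains C where "C \<ge> 0" "\<And>p f. 0 < p \<Longrightarrow> f \<in> Lp p \<Longrightarrow> Lp_norm p (a * f) \<le> C * Lp_norm p f"
proof -
  obtain C0 where C0: "AE t in circle_measure. cmod (rp a t) \<le> C0" using assms by (auto simp: in_Linf_iff)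
  define C where "C = max C0 0"
  have C: "AE t in circle_measure. cmod (rp a t) \<le> C" "C \<ge> 0" using C0 by (auto simp: C_def elim!: eventually_mono)
  have "Lp_norm p (a * f) \<le> C * Lp_norm p f" if "0 < p" "f \<in> Lp p" for p f
  proof -
    have "(LINT t|circle_measure. cmod (rp (a * f) t) powr p) \<le> (LINT t|circle_measure. C powr p * cmod (rp f t) powr p)"
    proof (rule integral_mono_AE)
      show "integrable circle_measure (\<lambda>t. cmod (rp (a * f) t) powr p)"
        using Linf_mult_Lp[OF _ assms, of p f] that by (simp add: in_Lp_iff)
      show "integrable circle_measure (\<lambda>t. C powr p * cmod (rp f t) powr p)" using that by (simp add: in_Lp_iff)
      show "AE t in circle_measure. cmod (rp (a * f) t) powr p \<le> C powr p * cmod (rp f t) powr p"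
        using C(1) rp_times[of a f]
        by eventually_elim (use that in \<open>auto simp: norm_mult powr_mult intro!: mult_right_mono powr_mono2\<close>)
    qed
    also have "\<dots> = (C * Lp_norm p f) powr p"
      using C that by (simp add: powr_mult Lp_norm_powr)
    finally have "Lp_norm p (a * f) powr p \<le> (C * Lp_norm p f) powr p" using that by (simp add: Lp_norm_powr)
    then show ?thesis using that C powr_less_mono2[of p "C * Lp_norm p f" "Lp_norm p (a * f)"] by fastforce
  qed
  then show thesis using that C(2) by blast
qed

lemma Linf_tpow [simp]: "tpow k \<in> Linf"
  unfolding in_Linf_iff using rp_tpow[of k] circle_AE_norm
  by (intro exI[of _ 1], eventually_elim) (simp add: norm_power_int)

lemma Linf_mult: assumes "a \<in> Linf" "b \<in> Linf" shows "a * b \<in> Linf"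
proof -
  obtain A B where "AE t in circle_measure. cmod (rp a t) \<le> A" "AE t in circle_measure. cmod (rp b t) \<le> B"
    using assms by (auto simp: in_Linf_iff)
  then have "AE t in circle_measure. cmod (rp (a * b) t) \<le> A * B"
    using rp_times[of a b]
    by eventually_elim (simp add: norm_mult mult_mono' order_trans[OF norm_ge_zero])
  then show ?thesis by (auto simp: in_Linf_iff)
qed

lemma Linf_conj [simp]: "a \<in> Linf \<Longrightarrow> conj_fun a \<in> Linf"
  unfolding in_Linf_iff
proof (elim exE)
  fix C assume "AE t in circle_measure. cmod (rp a t) \<le> C"
  with rp_conj[of a] have "AE t in circle_measure. cmod (rp (conj_fun a) t) \<le> C"
    by eventually_elim simp
  then show "\<exists>C. AE t in circle_measure. cmod (rp (conj_fun a) t) \<le> C" by blast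
qed

lemma Linf_tilde: "a \<in> Linf \<Longrightarrow> tilde a \<in> Linf"
  unfolding in_Linf_iff
proof -
  assume "\<exists>C. AE t in circle_measure. cmod (rp a t) \<le> C"
  then obtain C where "AE t in circle_measure. cmod (rp a t) \<le> C" by blast
  then have "AE t in circle_measure. cmod (rp a (1 / t)) \<le> C"
    by (intro AE_circle_inverse[where R = "\<lambda>t. cmod (rp a t) \<le> C"]) auto
  with rp_tilde[of a] have "AE t in circle_measure. cmod (rp (tilde a) t) \<le> C"
    by eventually_elim simp
  then show "\<exists>C. AE t in circle_measure. cmod (rp (tilde a) t) \<le> C" by blast
qed

lemma Lp_1_in [simp]: "1 \<in> Lp p"
  by (rule Lp_I[of "\<lambda>_. 1"]) (use rp_one in \<open>auto elim: eventually_mono\<close>)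

lemma Linf_subset_Lp: "0 \<le> p \<Longrightarrow> a \<in> Linf \<Longrightarrow> a \<in> Lp p"
  using Linf_mult_Lp[of p a 1] by simp

lemma Lp_norm_one [simp]: "Lp_norm p 1 = 1"
proof -
  have "(LINT t|circle_measure. cmod (rp 1 t) powr p) = (LINT t|circle_measure. 1)"
    by (rule integral_cong_AE) (use rp_one in \<open>auto elim: eventually_mono\<close>)
  then show ?thesis using circle.prob_space by (simp add: Lp_norm_eq)
qed

lemma Lp_mono: assumes "0 < r" "r \<le> p" "f \<in> Lp p" shows "f \<in> Lp r"
proof (rule Lp_I)
  show "integrable circle_measure (\<lambda>t. 1 + cmod (rp f t) powr p)" using assms by (simp add: in_Lp_iff)
  have "x powr r \<le> 1 + x powr p" if "0 \<le> x" for x :: real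
  proof (cases "x \<le> 1")
    case True
    then have "x powr r \<le> 1" using that assms powr_mono2[of r x 1] by simp
    then show ?thesis using powr_ge_zero[of x p] by linarith
  next
    case False
    then have "x powr r \<le> x powr p" using assms by (intro powr_mono) auto
    then show ?thesis by linarith
  qed
  then show "AE t in circle_measure. cmod (rp f t) powr r \<le> 1 + cmod (rp f t) powr p" by simp
qed

lemma Lp_conj [simp]: "conj_fun f \<in> Lp p \<longleftrightarrow> f \<in> Lp p"
proof -
  have "f \<in> Lp p \<Longrightarrow> conj_fun f \<in> Lp p" for f
    unfolding in_Lp_iff
    by (erule integrable_cong_AE_imp) (use rp_conj[of f] in \<open>auto elim: eventually_mono\<close>)
  from this[of f] this[of "conj_fun f"] show ?thesis by auto
qed

lemma Lp_norm_conj [simp]: "Lp_norm p (conj_fun f) = Lp_norm p f"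
  unfolding Lp_norm_eq
  by (intro arg_cong[where f = "\<lambda>x. x powr _"] integral_cong_AE) (use rp_conj[of f] in \<open>auto elim: eventually_mono\<close>)

lemma Lp_tilde [simp]: "tilde f \<in> Lp p \<longleftrightarrow> f \<in> Lp p"
proof -
  have "f \<in> Lp p \<Longrightarrow> tilde f \<in> Lp p" for f
    unfolding in_Lp_iff
    by (subst (asm) circle_integrable_inverse[symmetric], simp, erule integrable_cong_AE_imp)
      (use rp_tilde[of f] in \<open>auto elim: eventually_mono\<close>)
  from this[of f] this[of "tilde f"] show ?thesis by auto
qed

lemma Lp_tpow_mult: assumes "0 \<le> p" shows "tpow k * f \<in> Lp p \<longleftrightarrow> f \<in> Lp p"
  using Linf_mult_Lp[OF assms Linf_tpow, of f k] Linf_mult_Lp[OF assms Linf_tpow, of "tpow k * f" "-k"]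
  by (auto simp flip: mult.assoc)

lemma Lp_flip_J: "0 \<le> p \<Longrightarrow> flip_J f \<in> Lp p \<longleftrightarrow> f \<in> Lp p"
  by (simp add: flip_J_def Lp_tpow_mult)

lemma (in conjugate_exponents) Lp_subset_L1: "f \<in> Lp p \<Longrightarrow> f \<in> Lp 1"
  using Lp_mono[of 1 p f] p_gt_1 by simp

lemma (in conjugate_exponents) Lp_norm_1_le: "f \<in> Lp p \<Longrightarrow> Lp_norm 1 f \<le> Lp_norm p f"
  using Holder(2)[of f 1] by simp

section \<open>Fourier coefficients\<close>

lemma integrable_rp_tpow: "f \<in> Lp 1 \<Longrightarrow> integrable circle_measure (\<lambda>t. rp f t * t powi n)"
proof (rule Bochner_Integration.integrable_bound[of _ "rp f"])
  show "f \<in> Lp 1 \<Longrightarrow> integrable circle_measure (rp f)" by (simp add: Lp_1_iff)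
  show "(\<lambda>t. rp f t * t powi n) \<in> borel_measurable circle_measure" by simp
qed (use circle_AE_norm in \<open>auto simp: norm_mult norm_power_int elim!: eventually_mono\<close>)

lemma fourier_bound: "f \<in> Lp 1 \<Longrightarrow> cmod (fourier f n) \<le> Lp_norm 1 f"
proof -
  assume f: "f \<in> Lp 1"
  have "cmod (fourier f n) \<le> (LINT t|circle_measure. cmod (rp f t * t powi (- n)))"
    unfolding fourier_eq by (rule integral_norm_bound)
  also have "\<dots> = (LINT t|circle_measure. cmod (rp f t))"
  proof (rule integral_cong_AE)
    show "(\<lambda>t. cmod (rp f t * t powi - n)) \<in> borel_measurable circle_measure"
      unfolding borel_measurable_circle_iff by measurable
  qed (use circle_AE_norm in \<open>auto simp: norm_mult norm_power_int elim!: eventually_mono\<close>)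
  finally show ?thesis by (simp add: Lp_norm_1)
qed

lemma fourier_add: assumes "f \<in> Lp 1" "g \<in> Lp 1" shows "fourier (f + g) n = fourier f n + fourier g n"
proof -
  have "fourier (f + g) n = (LINT t|circle_measure. rp f t * t powi (- n) + rp g t * t powi (- n))"
    unfolding fourier_eq
    by (rule integral_cong_AE) (use rp_plus[of f g] in \<open>auto simp: ring_distribs elim!: eventually_mono\<close>)
  then show ?thesis using assms by (simp add: fourier_eq integrable_rp_tpow)
qed

lemma fourier_cscale [simp]: "fourier (cscale z f) n = z * fourier f n"
proof -
  have "fourier (cscale z f) n = (LINT t|circle_measure. z * (rp f t * t powi (- n)))"
    unfolding fourier_eq
    by (rule integral_cong_AE) (use rp_cscale[of z f] in \<open>auto simp: mult_ac elim!: eventually_mono\<close>)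
  then show ?thesis by (simp add: fourier_eq)
qed

lemma fourier_uminus [simp]: "fourier (- f) n = - fourier f n"
  using fourier_cscale[of "-1" f n] by (simp add: cscale_minus_one)

lemma fourier_diff: assumes "f \<in> Lp 1" "g \<in> Lp 1" shows "fourier (f - g) n = fourier f n - fourier g n"
  using fourier_add[of f "-g" n] assms by (simp add: Lp_uminus)

lemma fourier_zero [simp]: "fourier 0 n = 0"
  using fourier_cscale[of 0 0 n] by simp

lemma fourier_tpow_mult [simp]: "fourier (tpow k * f) n = fourier f (n - k)"
  unfolding fourier_eq
proof (rule integral_cong_AE)
  show "AE t in circle_measure. rp (tpow k * f) t * t powi - n = rp f t * t powi - (n - k)"
    using rp_times[of "tpow k" f] rp_tpow[of k] AE_circle_nonzero
    by eventually_elim (simp add: power_int_add[symmetric] mult_ac power_int_diff power_int_minus field_simps)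
qed auto

lemma fourier_tpow: "fourier (tpow k) n = (if n = k then 1 else 0)"
proof -
  have "fourier 1 n = (LINT t|circle_measure. t powi (-n))" for n
    unfolding fourier_eq by (rule integral_cong_AE) (use rp_one in \<open>auto elim!: eventually_mono\<close>)
  then show ?thesis using fourier_tpow_mult[of k 1 n] by (simp add: circle_integral_powi)
qed

lemma fourier_one: "fourier 1 n = (if n = 0 then 1 else 0)"
  using fourier_tpow[of 0 n] by simp

lemma fourier_tilde [simp]: "fourier (tilde f) n = fourier f (- n)"
proof -
  have "fourier (tilde f) n = (LINT t|circle_measure. rp f (1 / t) * (1 / t) powi (- (- n)))"
    unfolding fourier_eq
    by (rule integral_cong_AE) (use rp_tilde[of f] in \<open>auto simp: power_int_minus divide_inverse power_int_inverse elim!: eventually_mono\<close>)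
  also have "\<dots> = fourier f (- n)"
    unfolding fourier_eq by (rule circle_integral_inverse) measurable
  finally show ?thesis .
qed

lemma fourier_conj [simp]: "fourier (conj_fun f) n = cnj (fourier f (- n))"
proof -
  have "fourier (conj_fun f) n = (LINT t|circle_measure. cnj (rp (tpow n * f) t))"
    unfolding fourier_eq
  proof (rule integral_cong_AE)
    show "AE t in circle_measure. rp (conj_fun f) t * t powi - n = cnj (rp (tpow n * f) t)"
      using rp_times[of "tpow (-n)" "conj_fun f"] rp_tpow[of "-n"] rp_conj[of "tpow n * f"]
      by eventually_elim (simp add: mult_ac)
    have [measurable]: "cnj \<in> borel_measurable borel"
      by (intro borel_measurable_continuous_onI continuous_intros)
    show "(\<lambda>t. cnj (rp (tpow n * f) t)) \<in> borel_measurable circle_measure" by simp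
  qed auto
  also have "\<dots> = cnj (fourier (tpow n * f) 0)"
    by (simp add: fourier_eq)
  finally show ?thesis by simp
qed

lemma fourier_flip_J [simp]: "fourier (flip_J f) n = fourier f (- n - 1)"
  by (simp add: flip_J_def)

lemma tendsto_norm_powr:
  fixes f :: "'a \<Rightarrow> 'b :: real_normed_vector"
  assumes "(f \<longlongrightarrow> a) F" "0 < p"
  shows "((\<lambda>x. norm (f x) powr p) \<longlongrightarrow> norm a powr p) F"
  by (rule tendsto_powr'[OF tendsto_norm[OF assms(1)] tendsto_const]) (use assms in auto)

section \<open>Completeness of \<open>L\<^sup>p\<close>\<close>

text \<open>Since the \<open>L\<^sup>1\<close> norm is dominated by the \<open>L\<^sup>p\<close> norm, a subsequence converges almost everywhere;
  Fatou's lemma then bounds the \<open>L\<^sup>p\<close> distance to the pointwise limit.\<close>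

lemma Lp_complete:
  assumes p: "1 < p" and X: "\<And>n. X n \<in> Lp p"
    and Cauchy: "\<And>e. e > 0 \<Longrightarrow> \<exists>N. \<forall>i\<ge>N. \<forall>j\<ge>N. Lp_norm p (X i - X j) < e"
  obtains f where "f \<in> Lp p" "(\<lambda>n. Lp_norm p (X n - f)) \<longlonglongrightarrow> 0"
proof -
  interpret conjugate_exponents p "p / (p - 1)"
    by unfold_locales (use p in \<open>auto simp: field_simps\<close>)
  have Xd: "X i - X j \<in> Lp p" for i j using Lp_diff[of p] X p by simp
  have L1: "(LINT t|circle_measure. cmod (rp (X i) t - rp (X j) t)) \<le> Lp_norm p (X i - X j)" for i j
  proof -
    have "(LINT t|circle_measure. cmod (rp (X i) t - rp (X j) t)) = Lp_norm 1 (X i - X j)"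
      unfolding Lp_norm_1
      by (rule integral_cong_AE) (use rp_minus[of "X i" "X j"] in \<open>auto elim: eventually_mono\<close>)
    then show ?thesis using Lp_norm_1_le[OF Xd] by simp
  qed
  have int: "integrable circle_measure (rp (X n))" for n using Lp_subset_L1[OF X] by (simp add: Lp_1_iff)
  have "\<exists>N. \<forall>i\<ge>N. \<forall>j\<ge>N. (LINT t|circle_measure. cmod (rp (X i) t - rp (X j) t)) < e" if "e > 0" for e
    using Cauchy[OF that] L1 le_less_trans by meson
  from cauchy_L1_AE_cauchy_subseq[where s = "\<lambda>n. rp (X n)", OF int this]
  obtain r where r: "strict_mono r" and ae: "AE t in circle_measure. Cauchy (\<lambda>i. rp (X (r i)) t)" by auto
  define F where "F = (\<lambda>t. lim (\<lambda>i. rp (X (r i)) t))"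
  have F: "F \<in> borel_measurable borel" unfolding F_def by (rule borel_measurable_lim_metric) simp
  define f where "f = abs_tfun F"
  have lim: "AE t in circle_measure. (\<lambda>i. rp (X (r i)) t) \<longlonglongrightarrow> rp f t"
    using ae rp_abs[OF F] unfolding f_def[symmetric]
    by eventually_elim (simp add: F_def Cauchy_convergent convergent_LIMSEQ_iff[symmetric])
  have key: "(\<integral>\<^sup>+ t. ennreal (cmod (rp (X n - f) t) powr p) \<partial>circle_measure) \<le> ennreal (e powr p)"
    if "e > 0" and N: "\<forall>i\<ge>N. \<forall>j\<ge>N. Lp_norm p (X i - X j) < e" and n: "n \<ge> N" for e N n
  proof -
    let ?u = "\<lambda>i t. ennreal (cmod (rp (X n - X (r i)) t) powr p)"
    have "AE t in circle_measure. \<forall>i. rp (X n - X (r i)) t = rp (X n) t - rp (X (r i)) t"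
      unfolding AE_all_countable using rp_minus by blast
    with lim rp_minus[of "X n" f]
    have "AE t in circle_measure. ennreal (cmod (rp (X n - f) t) powr p) = liminf (\<lambda>i. ?u i t)"
    proof eventually_elim
      case (elim t)
      have "(\<lambda>i. rp (X n) t - rp (X (r i)) t) \<longlonglongrightarrow> rp (X n) t - rp f t"
        using elim by (intro tendsto_intros)
      then have "(\<lambda>i. rp (X n - X (r i)) t) \<longlonglongrightarrow> rp (X n - f) t"
        using elim by simp
      then have "(\<lambda>i. ?u i t) \<longlonglongrightarrow> ennreal (cmod (rp (X n - f) t) powr p)"
        using p by (intro tendsto_ennrealI tendsto_norm_powr) auto
      then show ?case by (rule lim_imp_Liminf[OF trivial_limit_sequentially, symmetric])
    qed
    then have "(\<integral>\<^sup>+ t. ennreal (cmod (rp (X n - f) t) powr p) \<partial>circle_measure) = (\<integral>\<^sup>+ t. liminf (\<lambda>i. ?u i t) \<partial>circle_measure)"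
      by (rule nn_integral_cong_AE)
    also have "\<dots> \<le> liminf (\<lambda>i. \<integral>\<^sup>+ t. ?u i t \<partial>circle_measure)"
      by (rule nn_integral_liminf) simp
    also have "\<dots> \<le> ennreal (e powr p)"
    proof (rule Liminf_le)
      show "\<forall>\<^sub>F i in sequentially. (\<integral>\<^sup>+ t. ?u i t \<partial>circle_measure) \<le> ennreal (e powr p)"
        using eventually_ge_at_top[of N]
      proof eventually_elim
        case (elim i)
        then have "r i \<ge> N" using seq_suble[OF r, of i] by simp
        then have "Lp_norm p (X n - X (r i)) powr p \<le> e powr p"
          using N n p by (intro powr_mono2) (auto intro: less_imp_le)
        then show ?case
          using p Lp_integrable[OF Xd] by (simp add: nn_integral_eq_integral Lp_norm_powr)
      qed
    qed simp
    finally show ?thesis .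
  qed
  have mem: "X n - f \<in> Lp p" if "e > 0" and N: "\<forall>i\<ge>N. \<forall>j\<ge>N. Lp_norm p (X i - X j) < e" and n: "n \<ge> N" for e N n
    unfolding in_Lp_iff using key[OF that]
    by (intro integrableI_bounded) (auto simp: top_unique less_top[symmetric])
  have bound: "Lp_norm p (X n - f) \<le> e" if "e > 0" and N: "\<forall>i\<ge>N. \<forall>j\<ge>N. Lp_norm p (X i - X j) < e" and n: "n \<ge> N" for e N n
  proof -
    have "Lp_norm p (X n - f) powr p \<le> e powr p"
      using integral_real_bounded[OF _ key[OF that]] p by (simp add: Lp_norm_powr)
    then show ?thesis using powr_less_mono2[of p e "Lp_norm p (X n - f)"] p that(1) by fastforce
  qed
  obtain N1 where N1: "\<forall>i\<ge>N1. \<forall>j\<ge>N1. Lp_norm p (X i - X j) < 1" using Cauchy[of 1] by auto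
  have "X N1 - (X N1 - f) \<in> Lp p"
    by (rule Lp_diff[OF _ X mem[OF _ N1]]) (use p in auto)
  then have "f \<in> Lp p" by simp
  moreover have "(\<lambda>n. Lp_norm p (X n - f)) \<longlonglongrightarrow> 0"
  proof (rule LIMSEQ_I)
    fix e :: real assume "e > 0"
    then obtain N where N: "\<forall>i\<ge>N. \<forall>j\<ge>N. Lp_norm p (X i - X j) < e / 2" using Cauchy[of "e / 2"] by auto
    show "\<exists>N. \<forall>n\<ge>N. norm (Lp_norm p (X n - f) - 0) < e"
      using bound[OF _ N] \<open>e > 0\<close> by (intro exI[of _ N]) force
  qed
  ultimately show thesis by (rule that)
qed

section \<open>Nearest points and annihilators\<close>

lemma powr_strictly_convex:
  fixes a b p :: real
  assumes "1 < p" "0 \<le> a" "a < b"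
  shows "((a + b) / 2) powr p < (a powr p + b powr p) / 2"
proof -
  have D: "\<exists>z. x < z \<and> z < y \<and> y powr p - x powr p = (y - x) * (p * z powr (p - 1))" if "0 \<le> x" "x < y" for x y :: real
  proof -
    have "continuous_on {x..y} (\<lambda>u. u powr p)"
      using that assms by (intro continuous_on_powr') (auto intro: continuous_intros)
    moreover have "(\<lambda>u. u powr p) differentiable (at z)" if "x < z" for z
      using has_real_derivative_powr[of z p] \<open>0 \<le> x\<close> that real_differentiable_def by fastforce
    ultimately have "\<exists>l z. x < z \<and> z < y \<and> ((\<lambda>u. u powr p) has_real_derivative l) (at z) \<and>
        y powr p - x powr p = (y - x) * l"
      by (intro MVT[OF \<open>x < y\<close>])
    then obtain l z where z: "x < z" "z < y" "((\<lambda>u. u powr p) has_real_derivative l) (at z)"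
        "y powr p - x powr p = (y - x) * l"
      by auto
    moreover have "l = p * z powr (p - 1)"
      using DERIV_unique[OF z(3) has_real_derivative_powr] z that by simp
    ultimately show ?thesis by blast
  qed
  let ?c = "(a + b) / 2"
  obtain z1 where z1: "a < z1" "z1 < ?c" "?c powr p - a powr p = (?c - a) * (p * z1 powr (p - 1))"
    using D[of a ?c] assms by auto
  obtain z2 where z2: "?c < z2" "z2 < b" "b powr p - ?c powr p = (b - ?c) * (p * z2 powr (p - 1))"
    using D[of ?c b] assms by auto
  have "z1 powr (p - 1) < z2 powr (p - 1)"
    using z1 z2 assms by (intro powr_less_mono2) auto
  then have "(?c - a) * (p * z1 powr (p - 1)) < (?c - a) * (p * z2 powr (p - 1))"
    using assms by (intro mult_strict_left_mono) auto
  moreover have "?c - a = b - ?c" by (simp add: field_simps)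
  ultimately have "?c powr p - a powr p < b powr p - ?c powr p" unfolding z1(3) z2(3) by metis
  moreover have "u - v < w - u \<Longrightarrow> u < (v + w) / 2" for u v w :: real by simp
  ultimately show ?thesis by blast
qed

lemma norm_powr_strictly_convex:
  fixes x y :: complex
  assumes p: "1 < p" and xy: "x \<noteq> y"
  shows "norm ((x + y) / 2) powr p < (norm x powr p + norm y powr p) / 2"
proof (cases "norm x = norm y")
  case True
  have "norm (x + y)^2 + norm (x - y)^2 = 2 * norm x^2 + 2 * norm y^2"
    unfolding power2_norm_eq_inner by (simp add: inner_add inner_diff inner_commute)
  moreover have "norm (x - y)^2 > 0" using xy by simp
  ultimately have "norm (x + y)^2 < (2 * norm x)^2" using True by (simp add: power2_eq_square)
  then have "norm ((x + y) / 2) < norm x"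
    using power2_less_imp_less[of "norm (x+y)" "2 * norm x"] by (simp add: norm_divide)
  then have "norm ((x + y) / 2) powr p < norm x powr p"
    using p by (intro powr_less_mono2) auto
  then show ?thesis using True by simp
next
  case False
  have "norm ((x + y) / 2) powr p \<le> ((norm x + norm y) / 2) powr p"
    using p norm_triangle_ineq[of x y] by (intro powr_mono2) (auto simp: norm_divide)
  also have "\<dots> < (norm x powr p + norm y powr p) / 2"
    using powr_strictly_convex[OF p, of "norm x" "norm y"] powr_strictly_convex[OF p, of "norm y" "norm x"] False
    by (cases "norm x < norm y") (auto simp: add.commute)
  finally show ?thesis .
qed

text \<open>By homogeneity it suffices to consider the compact set of pairs whose larger modulus is 1, where
  strict convexity leaves a positive gap. This qualitative form of uniform convexity treats all
  exponents \<open>p > 1\<close> alike, whereas Clarkson's inequalities distinguish \<open>p < 2\<close> from \<open>p > 2\<close>.\<close>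

lemma norm_powr_uniformly_convex:
  assumes p: "1 < p" and \<eta>: "0 < \<eta>"
  shows "\<exists>\<delta>>0. \<forall>x y :: complex. \<eta> * max (norm x) (norm y) \<le> norm (x - y) \<longrightarrow>
    \<delta> * (norm x powr p + norm y powr p) \<le> (norm x powr p + norm y powr p) / 2 - norm ((x + y) / 2) powr p"
proof -
  define G where "G = (\<lambda>z :: complex \<times> complex. (norm (fst z) powr p + norm (snd z) powr p) / 2 - norm ((fst z + snd z) / 2) powr p)"
  define K where "K = {z :: complex \<times> complex. max (norm (fst z)) (norm (snd z)) = 1 \<and> \<eta> \<le> norm (fst z - snd z)}"
  have cG: "continuous_on K G" unfolding G_def
    using p by (intro continuous_intros continuous_on_powr') auto
  have "closed K" unfolding K_def
    by (intro closed_Collect_conj closed_Collect_eq closed_Collect_le continuous_intros)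
  moreover have "K \<subseteq> cball 0 1 \<times> cball 0 1" by (auto simp: K_def)
  then have "bounded K" by (rule bounded_subset[rotated]) (intro bounded_Times bounded_cball)
  ultimately have "compact K" by (simp add: compact_eq_bounded_closed)
  have Gpos: "G z > 0" if "z \<in> K" for z
  proof -
    have "fst z \<noteq> snd z" using that \<eta> by (auto simp: K_def)
    then show ?thesis using norm_powr_strictly_convex[OF p, of "fst z" "snd z"] by (simp add: G_def)
  qed
  obtain g where g: "g > 0" "\<And>z. z \<in> K \<Longrightarrow> g \<le> G z"
  proof (cases "K = {}")
    case False
    obtain z0 where "z0 \<in> K" "\<forall>z\<in>K. G z0 \<le> G z"
      using continuous_attains_inf[OF \<open>compact K\<close> False cG] by blast
    then show thesis using that[of "G z0"] Gpos by auto
  qed (use that[of 1] in auto)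
  have "g / 2 * (norm x powr p + norm y powr p) \<le> (norm x powr p + norm y powr p) / 2 - norm ((x + y) / 2) powr p"
    if h: "\<eta> * max (norm x) (norm y) \<le> norm (x - y)" for x y :: complex
  proof (cases "x = 0 \<and> y = 0")
    case False
    define M where "M = max (norm x) (norm y)"
    have M: "M > 0" using False by (auto simp: M_def max_def not_le)
    define x' y' where "x' = x / of_real M" and "y' = y / of_real M"
    have n: "norm x = M * norm x'" "norm y = M * norm y'" "norm ((x + y) / 2) = M * norm ((x' + y') / 2)"
      "norm (x - y) = M * norm (x' - y')"
    proof -
      have xy: "x = of_real M * x'" "y = of_real M * y'" using M by (auto simp: x'_def y'_def)
      then have "(x + y) / 2 = of_real M * ((x' + y') / 2)" "x - y = of_real M * (x' - y')"
        by (simp_all add: ring_distribs)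
      with xy show "norm x = M * norm x'" "norm y = M * norm y'" "norm ((x + y) / 2) = M * norm ((x' + y') / 2)"
        "norm (x - y) = M * norm (x' - y')"
        using M by (simp_all only: norm_mult norm_of_real abs_of_pos)
    qed
    have mx: "max (norm x') (norm y') = 1"
    proof -
      have "max (M * norm x') (M * norm y') = M" unfolding n(1,2)[symmetric] by (simp only: M_def)
      then have "M * max (norm x') (norm y') = M * 1" using M by (simp add: max_mult_distrib_left)
      then show ?thesis using M by simp
    qed
    have "(x', y') \<in> K"
    proof -
      have "\<eta> * M \<le> norm (x - y)" using h by (simp only: M_def)
      then have "M * \<eta> \<le> M * norm (x' - y')" unfolding n(4) by (simp only: mult.commute)
      then have "\<eta> \<le> norm (x' - y')" using M by simp
      then show ?thesis using mx by (simp add: K_def)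
    qed
    then have A: "g \<le> (norm x' powr p + norm y' powr p) / 2 - norm ((x' + y') / 2) powr p"
      using g(2) by (force simp: G_def)
    have "norm x' powr p \<le> 1" "norm y' powr p \<le> 1"
      using mx p powr_mono2[of p "norm x'" 1] powr_mono2[of p "norm y'" 1] by auto
    then have "g / 2 * (norm x' powr p + norm y' powr p) \<le> g / 2 * 2"
      using g(1) by (intro mult_left_mono) auto
    then have "g / 2 * (norm x' powr p + norm y' powr p) \<le> g" by (simp only: times_divide_eq_left nonzero_mult_div_cancel_right)
    from order_trans[OF this A]
    have "g / 2 * (norm x' powr p + norm y' powr p) \<le> (norm x' powr p + norm y' powr p) / 2 - norm ((x' + y') / 2) powr p" .
    then have "M powr p * (g / 2 * (norm x' powr p + norm y' powr p)) \<le> M powr p * ((norm x' powr p + norm y' powr p) / 2 - norm ((x' + y') / 2) powr p)"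
      by (rule mult_left_mono) simp
    then show ?thesis unfolding n powr_mult by (simp add: algebra_simps)
  qed auto
  then show ?thesis using g(1) by (intro exI[of _ "g / 2"]) auto
qed

lemma norm_powr_midpoint_le:
  fixes x y :: complex
  assumes "1 < p" shows "norm ((x + y) / 2) powr p \<le> (norm x powr p + norm y powr p) / 2"
  using norm_powr_strictly_convex[OF assms, of x y] by (cases "x = y") auto

text \<open>After integration: two functions whose midpoint has almost the same norm as they have are close.\<close>

lemma norm_powr_diff_bound:
  assumes p: "1 < p" and \<eta>: "0 < \<eta>"
  obtains K where "K > 0" "\<And>x y :: complex. norm (x - y) powr p \<le> \<eta> * (norm x powr p + norm y powr p)
    + K * ((norm x powr p + norm y powr p) / 2 - norm ((x + y) / 2) powr p)"
proof -
  define h where "h = \<eta> powr (1 / p)"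
  have h: "h > 0" "h powr p = \<eta>" using p \<eta> by (auto simp: h_def powr_powr)
  obtain \<delta> where \<delta>: "\<delta> > 0" "\<And>x y :: complex. h * max (norm x) (norm y) \<le> norm (x - y) \<Longrightarrow>
    \<delta> * (norm x powr p + norm y powr p) \<le> (norm x powr p + norm y powr p) / 2 - norm ((x + y) / 2) powr p"
    using norm_powr_uniformly_convex[OF p h(1)] by blast
  define K where "K = 2 powr p / \<delta>"
  have K: "K > 0" using \<delta> by (simp add: K_def)
  have "norm (x - y) powr p \<le> \<eta> * (norm x powr p + norm y powr p)
    + K * ((norm x powr p + norm y powr p) / 2 - norm ((x + y) / 2) powr p)" for x y :: complex
  proof (cases "h * max (norm x) (norm y) \<le> norm (x - y)")
    case True
    have "norm (x - y) powr p \<le> (norm x + norm y) powr p"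
      using p by (intro powr_mono2 norm_triangle_ineq4) auto
    also have "\<dots> \<le> 2 powr p * (norm x powr p + norm y powr p)"
      using p by (intro powr_add_le) auto
    also have "\<dots> = K * (\<delta> * (norm x powr p + norm y powr p))"
      using \<delta> by (simp add: K_def)
    also have "\<dots> \<le> K * ((norm x powr p + norm y powr p) / 2 - norm ((x + y) / 2) powr p)"
      using K by (intro mult_left_mono \<delta>(2)[OF True]) auto
    finally show ?thesis using \<eta> by (smt (verit) mult_nonneg_nonneg powr_ge_zero)
  next
    case False
    have "norm (x - y) powr p \<le> (h * max (norm x) (norm y)) powr p"
      using p False by (intro powr_mono2) auto
    also have "\<dots> = \<eta> * max (norm x) (norm y) powr p" by (simp add: powr_mult h)
    also have "\<dots> \<le> \<eta> * (norm x powr p + norm y powr p)"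
      using \<eta> by (intro mult_left_mono) (auto simp: max_def)
    also have "\<dots> \<le> \<eta> * (norm x powr p + norm y powr p)
    + K * ((norm x powr p + norm y powr p) / 2 - norm ((x + y) / 2) powr p)"
      using K norm_powr_midpoint_le[OF p, of x y] by simp
    finally show ?thesis .
  qed
  with K show thesis by (rule that)
qed

text \<open>The midpoint of two elements of a minimising sequence has distance at least the infimum, so by
  uniform convexity the sequence \<open>f - Y n\<close> is Cauchy; its limit \<open>e\<close> is the shortest distance vector.\<close>

lemma Lp_nearest_point:
  assumes p: "1 < p" and S: "cvs.subspace S" "S \<subseteq> Lp p" and f: "f \<in> Lp p"
  obtains e Y where "e \<in> Lp p" "\<And>n. Y n \<in> S" "(\<lambda>n. Lp_norm p (f - Y n - e)) \<longlonglongrightarrow> 0"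
    "\<And>m. m \<in> S \<Longrightarrow> Lp_norm p e \<le> Lp_norm p (e - m)"
proof -
  have p0: "0 \<le> p" "0 < p" "1 \<le> p" using p by auto
  define D where "D = Inf ((\<lambda>s. Lp_norm p (f - s)) ` S)"
  have "0 \<in> S" using S(1) by (rule cvs.subspace_0)
  have bdd: "bdd_below ((\<lambda>s. Lp_norm p (f - s)) ` S)" by (intro bdd_belowI[of _ 0]) auto
  have D_le: "D \<le> Lp_norm p (f - s)" if "s \<in> S" for s
    unfolding D_def using that bdd by (intro cInf_lower) auto
  have D0: "0 \<le> D" unfolding D_def using \<open>0 \<in> S\<close> by (intro cInf_greatest) auto
  have "\<exists>s\<in>S. Lp_norm p (f - s) < D + 1 / Suc n" for n
    using cInf_lessD[of "(\<lambda>s. Lp_norm p (f - s)) ` S" "D + 1 / Suc n"] \<open>0 \<in> S\<close> by (auto simp: D_def)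
  then obtain Y where Y: "\<And>n. Y n \<in> S" "\<And>n. Lp_norm p (f - Y n) < D + 1 / Suc n" by metis
  define W where "W n = f - Y n" for n
  have W: "W n \<in> Lp p" for n unfolding W_def using Y S f p0 by (intro Lp_diff) auto
  have Wn: "D \<le> Lp_norm p (W n)" "Lp_norm p (W n) < D + 1 / Suc n" for n
    using Y D_le by (auto simp: W_def)
  have lim0: "(\<lambda>n. D + 1 / real (Suc n)) \<longlonglongrightarrow> D + 0"
    by (intro tendsto_intros LIMSEQ_Suc[OF lim_1_over_n])
  have lim: "(\<lambda>n. (D + 1 / real (Suc n)) powr p) \<longlonglongrightarrow> D powr p"
    using tendsto_norm_powr[OF lim0 p0(2)] D0 by simp
  have mid: "D powr p \<le> (LINT t|circle_measure. cmod ((rp (W i) t + rp (W j) t) / 2) powr p)" for i j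
  proof -
    have "cscale (1/2) (Y i + Y j) \<in> S" using Y S(1) by (intro cvs.subspace_scale cvs.subspace_add)
    moreover have "cscale (1/2) (W i + W j) = f - cscale (1/2) (Y i + Y j)"
    proof -
      have "cscale (1/2) (f + f) = f"
        using cvs.scale_left_distrib[of "1/2" "1/2" f] by (simp add: cscale_add)
      moreover have "W i + W j = (f + f) - (Y i + Y j)" by (simp add: W_def)
      ultimately show ?thesis by (simp only: cscale_diff)
    qed
    ultimately have "D \<le> Lp_norm p (cscale (1/2) (W i + W j))" using D_le by simp
    then have "D powr p \<le> Lp_norm p (cscale (1/2) (W i + W j)) powr p"
      using D0 p0 by (intro powr_mono2) auto
    also have "\<dots> = (LINT t|circle_measure. cmod ((rp (W i) t + rp (W j) t) / 2) powr p)"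
      unfolding Lp_norm_powr[OF p0(2)]
    proof (rule integral_cong_AE)
      show "AE t in circle_measure. cmod (rp (cscale (1/2) (W i + W j)) t) powr p = cmod ((rp (W i) t + rp (W j) t) / 2) powr p"
        using rp_cscale[of "1/2" "W i + W j"] rp_plus[of "W i" "W j"]
      proof eventually_elim
        case (elim t)
        then have "rp (cscale (1/2) (W i + W j)) t = (rp (W i) t + rp (W j) t) / 2" by simp
        then show ?case by (simp only:)
      qed
    qed auto
    finally show ?thesis .
  qed
  have Cauchy: "\<exists>N. \<forall>i\<ge>N. \<forall>j\<ge>N. Lp_norm p (W i - W j) < e" if e: "e > 0" for e
  proof -
    define B where "B = (D + 1) powr p"
    have B: "B > 0" using D0 by (simp add: B_def)
    have WB: "Lp_norm p (W n) powr p \<le> B" for n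
    proof -
      have "D + 1 / Suc n \<le> D + 1" by simp
      then have "Lp_norm p (W n) \<le> D + 1" using Wn(2)[of n] by linarith
      then show ?thesis unfolding B_def using p0 by (intro powr_mono2) auto
    qed
    \<comment> \<open>\<open>\<eta>\<close> and \<open>\<tau>\<close> make each of the two terms of the integrated bound equal to \<open>e powr p / 4\<close>.\<close>
    define \<eta> where "\<eta> = e powr p / (8 * B)"
    have \<eta>: "\<eta> > 0" using e B by (simp add: \<eta>_def)
    obtain K where K: "K > 0" "\<And>x y :: complex. norm (x - y) powr p \<le> \<eta> * (norm x powr p + norm y powr p)
      + K * ((norm x powr p + norm y powr p) / 2 - norm ((x + y) / 2) powr p)"
      using norm_powr_diff_bound[OF p \<eta>] by blast
    define \<tau> where "\<tau> = e powr p / (4 * K)"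
    have \<tau>: "\<tau> > 0" using K e by (simp add: \<tau>_def)
    have "\<forall>\<^sub>F n in sequentially. (D + 1 / real (Suc n)) powr p < D powr p + \<tau>"
      by (rule order_tendstoD[OF lim]) (use \<tau> in auto)
    then obtain N where N: "\<And>n. n \<ge> N \<Longrightarrow> (D + 1 / real (Suc n)) powr p < D powr p + \<tau>"
      by (auto simp: eventually_sequentially)
    have WN: "Lp_norm p (W n) powr p \<le> D powr p + \<tau>" if "n \<ge> N" for n
    proof -
      have "Lp_norm p (W n) powr p \<le> (D + 1 / real (Suc n)) powr p"
        using p0 Wn(2)[of n] by (intro powr_mono2) auto
      then show ?thesis using N[OF that] by linarith
    qed
    have "Lp_norm p (W i - W j) < e" if ij: "i \<ge> N" "j \<ge> N" for i j
    proof -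
      let ?x = "\<lambda>t. cmod (rp (W i) t) powr p" and ?y = "\<lambda>t. cmod (rp (W j) t) powr p"
      let ?m = "\<lambda>t. cmod ((rp (W i) t + rp (W j) t) / 2) powr p"
      have ix: "integrable circle_measure ?x" "integrable circle_measure ?y" using W by (auto simp: in_Lp_iff)
      have im: "integrable circle_measure ?m"
        by (rule Bochner_Integration.integrable_bound[of _ "\<lambda>t. (?x t + ?y t) / 2"])
          (use ix norm_powr_midpoint_le[OF p] in auto)
      have "Lp_norm p (W i - W j) powr p \<le> (LINT t|circle_measure. \<eta> * (?x t + ?y t) + K * ((?x t + ?y t) / 2 - ?m t))"
        unfolding Lp_norm_powr[OF p0(2)]
      proof (rule integral_mono_AE)
        show "integrable circle_measure (\<lambda>t. cmod (rp (W i - W j) t) powr p)"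
          using Lp_diff[OF p0(1) W W] by (simp add: in_Lp_iff)
        show "integrable circle_measure (\<lambda>t. \<eta> * (?x t + ?y t) + K * ((?x t + ?y t) / 2 - ?m t))"
          using ix im by auto
        show "AE t in circle_measure. cmod (rp (W i - W j) t) powr p \<le> \<eta> * (?x t + ?y t) + K * ((?x t + ?y t) / 2 - ?m t)"
          using rp_minus[of "W i" "W j"] by eventually_elim (use K(2) in simp)
      qed
      also have "\<dots> = \<eta> * (Lp_norm p (W i) powr p + Lp_norm p (W j) powr p)
          + K * ((Lp_norm p (W i) powr p + Lp_norm p (W j) powr p) / 2 - (LINT t|circle_measure. ?m t))"
        using ix im unfolding Lp_norm_powr[OF p0(2)] by simp
      also have "\<dots> \<le> \<eta> * (B + B) + K * (((D powr p + \<tau>) + (D powr p + \<tau>)) / 2 - D powr p)"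
        using \<eta> K(1) WB WN ij mid
        by (intro add_mono mult_left_mono diff_mono divide_right_mono) auto
      also have "((D powr p + \<tau>) + (D powr p + \<tau>)) / 2 - D powr p = \<tau>" by (simp add: add_divide_distrib)
      also have "\<eta> * (B + B) + K * \<tau> = e powr p / 2" using B K(1) by (simp add: \<eta>_def \<tau>_def)
      also have "\<dots> < e powr p" using e by simp
      finally have "Lp_norm p (W i - W j) powr p < e powr p" .
      then show ?thesis using powr_mono2[of p e "Lp_norm p (W i - W j)"] p0 e by fastforce
    qed
    then show ?thesis by blast
  qed
  obtain e where e: "e \<in> Lp p" "(\<lambda>n. Lp_norm p (W n - e)) \<longlonglongrightarrow> 0"
    using Lp_complete[OF p W Cauchy] by blast
  have e_le: "Lp_norm p e \<le> D"
  proof (rule LIMSEQ_le_const)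
    show "(\<lambda>n. Lp_norm p (W n - e) + (D + 1 / real (Suc n))) \<longlonglongrightarrow> D"
      using tendsto_add[OF e(2) lim0] by simp
    have "Lp_norm p e \<le> Lp_norm p (W n - e) + (D + 1 / real (Suc n))" for n
      using Lp_norm_triangle[OF p0(3) Lp_diff[OF p0(1) e(1) W[of n]] W[of n]] Wn(2)[of n]
        Lp_norm_minus_commute[of p e "W n"] by simp
    then show "\<exists>N. \<forall>n\<ge>N. Lp_norm p e \<le> Lp_norm p (W n - e) + (D + 1 / real (Suc n))" by blast
  qed
  have le_em: "D \<le> Lp_norm p (e - m)" if m: "m \<in> S" for m
  proof (rule LIMSEQ_le_const)
    show "(\<lambda>n. Lp_norm p (W n - e) + Lp_norm p (e - m)) \<longlonglongrightarrow> Lp_norm p (e - m)"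
      using tendsto_add[OF e(2) tendsto_const] by simp
    have "D \<le> Lp_norm p (W n - e) + Lp_norm p (e - m)" for n
    proof -
      have "Y n + m \<in> S" using Y m S(1) by (intro cvs.subspace_add)
      from D_le[OF this] have "D \<le> Lp_norm p (W n - m)" by (simp add: W_def diff_diff_eq)
      also have "\<dots> \<le> Lp_norm p (W n - e) + Lp_norm p (e - m)"
        by (rule Lp_norm_triangle_diff) (use p0 W e m S in auto)
      finally show ?thesis .
    qed
    then show "\<exists>N. \<forall>n\<ge>N. D \<le> Lp_norm p (W n - e) + Lp_norm p (e - m)" by blast
  qed
  show thesis
    by (rule that[OF e(1) Y(1)]) (use e(2) e_le le_em in \<open>auto simp: W_def intro: order_trans\<close>)
qed

text \<open>The gradient \<open>|z|\<^sup>p\<^sup>-\<^sup>2 z\<close> of \<open>|z|\<^sup>p / p\<close>, written so that it is continuous with value 0 at 0.\<close>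

definition dual_value :: "real \<Rightarrow> complex \<Rightarrow> complex" where
  "dual_value p z = of_real (cmod z powr (p - 1)) * sgn z"

definition dual_elt :: "real \<Rightarrow> tfun \<Rightarrow> tfun" where
  "dual_elt p e = abs_tfun (\<lambda>t. dual_value p (rp e t))"

lemma norm_dual_value: "cmod (dual_value p z) = cmod z powr (p - 1)"
  by (auto simp: dual_value_def norm_mult norm_sgn)

lemma dual_value_mult_cnj: "z * cnj (dual_value p z) = of_real (cmod z powr p)"
proof (cases "z = 0")
  case False
  have "z * cnj (sgn z) = of_real (cmod z)"
    using False complex_norm_square[of z] by (simp add: sgn_eq power2_eq_square divide_simps)
  then have "z * cnj (dual_value p z) = of_real (cmod z powr (p - 1) * cmod z)"
    by (simp add: dual_value_def mult_ac)
  also have "cmod z powr (p - 1) * cmod z = cmod z powr p"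
    using False powr_add[of "cmod z" "p - 1" 1] by simp
  finally show ?thesis .
qed (simp add: dual_value_def)

lemma dual_value_tendsto:
  assumes "1 < p" "X \<longlonglongrightarrow> x"
  shows "(\<lambda>n. dual_value p (X n)) \<longlonglongrightarrow> dual_value p x"
proof (cases "x = 0")
  case True
  have "(\<lambda>n. cmod (X n) powr (p - 1)) \<longlonglongrightarrow> cmod x powr (p - 1)"
    using assms by (intro tendsto_norm_powr) auto
  then have "(\<lambda>n. cmod (dual_value p (X n))) \<longlonglongrightarrow> 0"
    using True by (simp add: norm_dual_value)
  then show ?thesis using True tendsto_norm_zero_iff by (auto simp: dual_value_def)
next
  case False
  then show ?thesis unfolding dual_value_def
    using assms by (intro tendsto_intros tendsto_of_real tendsto_norm_powr tendsto_sgn) auto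
qed

lemma dual_value_continuous: "1 < p \<Longrightarrow> continuous_on A (dual_value p)"
  using dual_value_tendsto[of p] by (auto simp: continuous_on_sequentially o_def)

lemma dual_value_borel: "1 < p \<Longrightarrow> dual_value p \<in> borel_measurable borel"
  by (intro borel_measurable_continuous_onI dual_value_continuous)

text \<open>The convex function \<open>|z|\<^sup>p\<close> lies above its tangent plane at \<open>x\<close>; this is Young's inequality for
  \<open>|e|\<close> and \<open>|x|\<^sup>p\<^sup>-\<^sup>1\<close>.\<close>

lemma (in conjugate_exponents) dual_value_tangent:
  "cmod x powr p + p * Re ((e - x) * cnj (dual_value p x)) \<le> cmod e powr p"
proof -
  have "Re (e * cnj (dual_value p x)) \<le> cmod e * cmod x powr (p - 1)"
    using complex_Re_le_cmod[of "e * cnj (dual_value p x)"] by (simp add: norm_mult norm_dual_value)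
  also have "\<dots> \<le> cmod e powr p / p + (cmod x powr (p - 1)) powr q / q"
    using p_gt_1 q_gt_1 pq by (intro Youngs_inequality) auto
  also have "(cmod x powr (p - 1)) powr q = cmod x powr p"
    by (simp add: powr_powr exponent_eqs)
  finally have "p * Re (e * cnj (dual_value p x)) \<le> p * (cmod e powr p / p + cmod x powr p / q)"
    using p_gt_1 by (intro mult_left_mono) auto
  also have "\<dots> = cmod e powr p + p / q * cmod x powr p" using p_gt_1 by (simp add: field_simps)
  also have "p / q = p - 1" using p_gt_1 q_gt_1 exponent_eqs by (simp add: field_simps)
  finally show ?thesis
    by (simp add: left_diff_distrib dual_value_mult_cnj algebra_simps)
qed

lemma pairing_eq: "pairing f g = (LINT t|circle_measure. rp f t * cnj (rp g t))"
proof -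
  have [measurable]: "cnj \<in> borel_measurable borel"
    by (intro borel_measurable_continuous_onI continuous_intros)
  show ?thesis unfolding pairing_def fourier_eq
    by (rule integral_cong_AE) (use rp_times[of f "conj_fun g"] rp_conj[of g] in \<open>auto elim: eventually_elim2\<close>)
qed

context conjugate_exponents
begin

lemma rp_dual_elt: "AE t in circle_measure. rp (dual_elt p e) t = dual_value p (rp e t)"
  unfolding dual_elt_def using measurable_compose[OF rp_borel dual_value_borel[OF p_gt_1]] by (intro rp_abs)

lemma dual_elt_Lq: "e \<in> Lp p \<Longrightarrow> dual_elt p e \<in> Lp q"
  and dual_elt_norm: "Lp_norm q (dual_elt p e) powr q = Lp_norm p e powr p"
proof -
  have ae: "AE t in circle_measure. cmod (rp e t) powr p = cmod (rp (dual_elt p e) t) powr q"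
    using rp_dual_elt[of e] by eventually_elim (simp add: norm_dual_value powr_powr exponent_eqs)
  show "e \<in> Lp p \<Longrightarrow> dual_elt p e \<in> Lp q" unfolding in_Lp_iff
    by (rule integrable_cong_AE_imp[OF _ _ ae]) auto
  show "Lp_norm q (dual_elt p e) powr q = Lp_norm p e powr p"
    using p_gt_1 q_gt_1 integral_cong_AE[OF _ _ ae] by (simp add: Lp_norm_powr)
qed

lemma pairing_dual_elt: "pairing e (dual_elt p e) = of_real (Lp_norm p e powr p)"
proof -
  have "pairing e (dual_elt p e) = (LINT t|circle_measure. of_real (cmod (rp e t) powr p))"
    unfolding pairing_eq
  proof (rule integral_cong_AE)
    show "AE t in circle_measure. rp e t * cnj (rp (dual_elt p e) t) = of_real (cmod (rp e t) powr p)"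
      using rp_dual_elt[of e] by eventually_elim (simp add: dual_value_mult_cnj)
    have [measurable]: "cnj \<in> borel_measurable borel"
      by (intro borel_measurable_continuous_onI continuous_intros)
    show "(\<lambda>t. rp e t * cnj (rp (dual_elt p e) t)) \<in> borel_measurable circle_measure" by simp
  qed auto
  then show ?thesis using p_gt_1 by (simp add: Lp_norm_powr)
qed

text \<open>The tangent inequality at \<open>x = e - s m\<close> and minimality of \<open>e\<close> show that the pairing of \<open>m\<close> with the
  dual element of \<open>e - s m\<close> has real part at most 0 for every \<open>s > 0\<close>; then \<open>s \<rightarrow> 0\<close> by dominated
  convergence. Taking the tangent at the moving point avoids differentiating the norm.\<close>

lemma nearest_variation_Re:
  assumes e: "e \<in> Lp p" and m: "m \<in> Lp p" and min: "\<And>s. Lp_norm p e \<le> Lp_norm p (e - cscale s m)"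
  shows "Re (pairing m (dual_elt p e)) \<le> 0"
proof -
  note [measurable] = dual_value_borel[OF p_gt_1]
  have [measurable]: "cnj \<in> borel_measurable borel" "Re \<in> borel_measurable borel"
    by (intro borel_measurable_continuous_onI continuous_intros)+
  let ?E = "rp e" and ?M = "rp m"
  define s where "s n = 1 / real (Suc n)" for n
  have s: "0 < s n" "s n \<le> 1" for n by (auto simp: s_def)
  let ?k = "\<lambda>n t. ?M t * cnj (dual_value p (?E t - of_real (s n) * ?M t))"
  let ?G = "\<lambda>t. 2 powr p * (cmod (?E t) powr p + cmod (?M t) powr p)"
  have iG: "integrable circle_measure ?G" using e m by (auto simp: in_Lp_iff)
  have bd: "cmod (?k n t) \<le> ?G t" for n t
  proof -
    have le: "cmod (?E t - of_real (s n) * ?M t) \<le> cmod (?E t) + cmod (?M t)"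
    proof -
      have "cmod (?E t - of_real (s n) * ?M t) \<le> cmod (?E t) + cmod (of_real (s n) * ?M t)" by (rule norm_triangle_ineq4)
      also have "cmod (of_real (s n) * ?M t) = s n * cmod (?M t)" using s[of n] by (simp add: norm_mult)
      also have "\<dots> \<le> 1 * cmod (?M t)" using s[of n] by (intro mult_right_mono) auto
      finally show ?thesis by simp
    qed
    have "cmod (?k n t) \<le> (cmod (?E t) + cmod (?M t)) * (cmod (?E t) + cmod (?M t)) powr (p - 1)"
      unfolding norm_mult complex_mod_cnj norm_dual_value
      using p_gt_1 le by (intro mult_mono powr_mono2) auto
    also have "\<dots> = (cmod (?E t) + cmod (?M t)) powr p"
      using powr_mult_base[of "cmod (?E t) + cmod (?M t)" "p - 1"] by simp
    also have "\<dots> \<le> ?G t" using p_gt_1 by (intro powr_add_le) auto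
    finally show ?thesis .
  qed
  have ik: "integrable circle_measure (?k n)" for n
    by (rule Bochner_Integration.integrable_bound[OF iG]) (use bd in \<open>auto intro: order_trans[OF _ abs_ge_self]\<close>)
  have neg: "Re (LINT t|circle_measure. ?k n t) \<le> 0" for n
  proof -
    let ?x = "e - cscale (of_real (s n)) m"
    have x: "?x \<in> Lp p" using e m p_gt_1 by (intro Lp_diff Lp_cscale) auto
    have "(LINT t|circle_measure. cmod (rp ?x t) powr p + p * s n * Re (?k n t)) \<le> (LINT t|circle_measure. cmod (?E t) powr p)"
    proof (rule integral_mono_AE)
      show "integrable circle_measure (\<lambda>t. cmod (rp ?x t) powr p + p * s n * Re (?k n t))"
        using x ik by (intro Bochner_Integration.integrable_add integrable_mult_right integrable_Re) (auto simp: in_Lp_iff)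
      show "integrable circle_measure (\<lambda>t. cmod (?E t) powr p)" using e by (simp add: in_Lp_iff)
      show "AE t in circle_measure. cmod (rp ?x t) powr p + p * s n * Re (?k n t) \<le> cmod (?E t) powr p"
        using rp_minus[of e "cscale (of_real (s n)) m"] rp_cscale[of "of_real (s n)" m]
      proof eventually_elim
        case (elim t)
        have "(?E t - (?E t - of_real (s n) * ?M t)) * cnj (dual_value p (?E t - of_real (s n) * ?M t)) = of_real (s n) * ?k n t"
          by simp
        with dual_value_tangent[of "?E t - of_real (s n) * ?M t" "?E t"] elim
        show ?case by (simp del: of_real_divide add: mult.assoc)
      qed
    qed
    also have "(LINT t|circle_measure. cmod (rp ?x t) powr p + p * s n * Re (?k n t))
       = Lp_norm p ?x powr p + p * s n * Re (LINT t|circle_measure. ?k n t)"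
      using x ik[of n] p_gt_1 integral_Re[OF ik[of n]] integrable_Re[OF ik[of n]] by (simp add: in_Lp_iff Lp_norm_powr)
    also have "(LINT t|circle_measure. cmod (?E t) powr p) = Lp_norm p e powr p"
      using p_gt_1 by (simp add: Lp_norm_powr)
    finally have "Lp_norm p ?x powr p + p * s n * Re (LINT t|circle_measure. ?k n t) \<le> Lp_norm p e powr p" .
    moreover have "Lp_norm p e powr p \<le> Lp_norm p ?x powr p"
      using p_gt_1 min by (intro powr_mono2) auto
    ultimately have "(p * s n) * Re (LINT t|circle_measure. ?k n t) \<le> 0" by linarith
    then show ?thesis using p_gt_1 s[of n] by (simp add: mult_le_0_iff)
  qed
  have "(\<lambda>n. LINT t|circle_measure. ?k n t) \<longlonglongrightarrow> (LINT t|circle_measure. ?M t * cnj (dual_value p (?E t)))"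
  proof (rule integral_dominated_convergence[OF _ _ iG])
    have s0: "s \<longlonglongrightarrow> 0" unfolding s_def by (rule LIMSEQ_Suc[OF lim_1_over_n])
    have "(\<lambda>n. ?k n t) \<longlonglongrightarrow> ?M t * cnj (dual_value p (?E t))" for t
    proof -
      have "(\<lambda>n. ?E t - of_real (s n) * ?M t) \<longlonglongrightarrow> ?E t - of_real 0 * ?M t"
        by (intro tendsto_intros s0)
      then have "(\<lambda>n. dual_value p (?E t - of_real (s n) * ?M t)) \<longlonglongrightarrow> dual_value p (?E t)"
        using p_gt_1 by (intro dual_value_tendsto) auto
      then show ?thesis by (intro tendsto_intros)
    qed
    then show "AE t in circle_measure. (\<lambda>n. ?k n t) \<longlonglongrightarrow> ?M t * cnj (dual_value p (?E t))" by simp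
    show "AE t in circle_measure. norm (?k n t) \<le> ?G t" for n using bd by simp
  qed auto
  also have "(LINT t|circle_measure. ?M t * cnj (dual_value p (?E t))) = pairing m (dual_elt p e)"
    unfolding pairing_eq
  proof (rule integral_cong_AE)
    show "AE t in circle_measure. ?M t * cnj (dual_value p (?E t)) = rp m t * cnj (rp (dual_elt p e) t)"
      using rp_dual_elt[of e] by eventually_elim simp
  qed auto
  finally have "(\<lambda>n. Re (LINT t|circle_measure. ?k n t)) \<longlonglongrightarrow> Re (pairing m (dual_elt p e))"
    by (rule tendsto_Re)
  then show ?thesis using neg by (intro LIMSEQ_le_const2) auto
qed

lemma pairing_cscale_left: "pairing (cscale z f) g = z * pairing f g"
  by (simp add: pairing_def)

text \<open>The choice of scalar \<open>cnj (pairing m k)\<close> turns the one-sided inequality into \<open>|pairing m k|\<^sup>2 \<le> 0\<close>.\<close>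

lemma nearest_variation:
  assumes "e \<in> Lp p" "m \<in> Lp p" "\<And>s. Lp_norm p e \<le> Lp_norm p (e - cscale s m)"
  shows "pairing m (dual_elt p e) = 0"
proof -
  let ?I = "pairing m (dual_elt p e)"
  have "Re (pairing (cscale (cnj ?I) m) (dual_elt p e)) \<le> 0"
    by (rule nearest_variation_Re) (use assms in \<open>auto intro: Lp_cscale\<close>)
  then have "Re (cnj ?I * ?I) \<le> 0" by (simp add: pairing_cscale_left)
  then show ?thesis by (simp add: complex_eq_iff sum_squares_le_zero_iff)
qed

lemma pairing_bound:
  assumes "f \<in> Lp p" "g \<in> Lp q"
  shows "cmod (pairing f g) \<le> Lp_norm p f * Lp_norm q g"
  using fourier_bound[OF Holder(1)[of f "conj_fun g"], of 0] Holder(2)[of f "conj_fun g"] assms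
  by (simp add: pairing_def)

lemma pairing_diff_left:
  assumes "f \<in> Lp p" "f' \<in> Lp p" "g \<in> Lp q"
  shows "pairing (f - f') g = pairing f g - pairing f' g"
  using assms Holder(1)[of f "conj_fun g"] Holder(1)[of f' "conj_fun g"]
  by (simp add: pairing_def left_diff_distrib fourier_diff)

text \<open>The dual element of the shortest vector from the subspace to \<open>f\<close> is the separating functional that
  the Hahn-Banach theorem and the duality of \<open>L\<^sup>p\<close> and \<open>L\<^sup>q\<close> would provide.\<close>

lemma annihilator:
  assumes S: "cvs.subspace S" "S \<subseteq> Lp p" and f: "f \<in> Lp p"
    and far: "\<not> (\<forall>e>0. \<exists>s\<in>S. Lp_norm p (f - s) < e)"
  obtains k where "k \<in> Lp q" "\<And>s. s \<in> S \<Longrightarrow> pairing s k = 0" "pairing f k \<noteq> 0"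
proof -
  obtain e Y where e: "e \<in> Lp p" "\<And>n. Y n \<in> S" "(\<lambda>n. Lp_norm p (f - Y n - e)) \<longlonglongrightarrow> 0"
    "\<And>m. m \<in> S \<Longrightarrow> Lp_norm p e \<le> Lp_norm p (e - m)"
    using Lp_nearest_point[OF p_gt_1 S f] by blast
  define k where "k = dual_elt p e"
  have k: "k \<in> Lp q" using e(1) dual_elt_Lq by (simp add: k_def)
  have orth: "pairing s k = 0" if "s \<in> S" for s
    unfolding k_def using S that e by (intro nearest_variation) (auto intro!: e(4) cvs.subspace_scale)
  have e0: "e \<noteq> 0"
  proof
    assume "e = 0"
    then have "(\<lambda>n. Lp_norm p (f - Y n)) \<longlonglongrightarrow> 0" using e(3) by simp
    then have "\<forall>e>0. \<exists>s\<in>S. Lp_norm p (f - s) < e"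
      using e(2) by (metis LIMSEQ_D Lp_norm_nonneg abs_of_nonneg diff_zero order_refl real_norm_def)
    then show False using far by blast
  qed
  have fe: "f - e \<in> Lp p" and fY: "f - Y n \<in> Lp p" for n using f e(1,2) S(2) p_gt_1 by (auto intro!: Lp_diff)
  have "(\<lambda>n. Lp_norm p (f - Y n - e) * Lp_norm q k) \<longlonglongrightarrow> 0 * Lp_norm q k"
    by (intro tendsto_intros e(3))
  moreover have "cmod (pairing (f - e) k) \<le> Lp_norm p (f - Y n - e) * Lp_norm q k" for n
  proof -
    have "pairing (f - e) k = pairing (f - Y n - e) k"
      using orth[OF e(2)[of n]] pairing_diff_left[of f "Y n" k] pairing_diff_left[of "f - Y n" e k] pairing_diff_left[of f e k]
        f fY e(1) k S(2) e(2)[of n] by auto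
    then show ?thesis using pairing_bound[of "f - Y n - e" k] Lp_diff[OF _ fY e(1)] p_gt_1 k by simp
  qed
  ultimately have "cmod (pairing (f - e) k) \<le> 0" by (intro LIMSEQ_le_const) auto
  then have "pairing f k = pairing e k" using pairing_diff_left[OF f e(1) k] by simp
  also have "\<dots> \<noteq> 0"
    using e0 e(1) p_gt_1 Lp_norm_eq_0_iff[of p e] by (simp add: k_def pairing_dual_elt)
  finally show thesis using that k orth by blast
qed

end

section \<open>Trigonometric polynomials and uniqueness of Fourier coefficients\<close>

definition trig_polys :: "int set \<Rightarrow> tfun set" where
  "trig_polys K = cvs.span (tpow ` K)"

lemma trig_polys_subspace: "cvs.subspace (trig_polys K)"
  by (simp add: trig_polys_def cvs.subspace_span)

lemma trig_polys_zero: "0 \<in> trig_polys K"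
  and trig_polys_add: "f \<in> trig_polys K \<Longrightarrow> g \<in> trig_polys K \<Longrightarrow> f + g \<in> trig_polys K"
  and trig_polys_diff: "f \<in> trig_polys K \<Longrightarrow> g \<in> trig_polys K \<Longrightarrow> f - g \<in> trig_polys K"
  and trig_polys_cscale: "f \<in> trig_polys K \<Longrightarrow> cscale z f \<in> trig_polys K"
  and trig_polys_tpow: "k \<in> K \<Longrightarrow> tpow k \<in> trig_polys K"
  by (auto simp: trig_polys_def intro: cvs.span_zero cvs.span_add cvs.span_diff cvs.span_scale cvs.span_base)

lemma trig_polys_one: "0 \<in> K \<Longrightarrow> 1 \<in> trig_polys K"
  using trig_polys_tpow[of 0 K] by simp

lemma trig_polys_mono: "K \<subseteq> L \<Longrightarrow> trig_polys K \<subseteq> trig_polys L"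
  unfolding trig_polys_def by (intro cvs.span_mono image_mono)

lemma trig_polys_induct [consumes 1, case_names zero step]:
  assumes "f \<in> trig_polys K" "P 0" "\<And>c k g. k \<in> K \<Longrightarrow> g \<in> trig_polys K \<Longrightarrow> P g \<Longrightarrow> P (cscale c (tpow k) + g)"
  shows "P f"
proof -
  have "f \<in> trig_polys K \<and> P f"
    using assms(1)[unfolded trig_polys_def]
  proof (induction rule: cvs.span_induct_alt)
    case base then show ?case using assms(2) by (simp add: trig_polys_zero)
  next
    case (step c x y)
    then obtain k where "k \<in> K" "x = tpow k" by auto
    with step assms(3) show ?case by (auto intro!: trig_polys_add trig_polys_cscale trig_polys_tpow)
  qed
  then show ?thesis ..
qed

lemma trig_polys_mult:
  assumes "f \<in> trig_polys UNIV" "g \<in> trig_polys UNIV" shows "f * g \<in> trig_polys UNIV"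
  using assms(1)
proof (induction rule: trig_polys_induct)
  case zero then show ?case by (simp add: trig_polys_zero)
next
  case (step c k f)
  have "tpow k * g \<in> trig_polys UNIV"
    using assms(2)
  proof (induction rule: trig_polys_induct)
    case zero then show ?case by (simp add: trig_polys_zero)
  next
    case (step d j h)
    then show ?case
      by (auto simp: distrib_left trig_polys_tpow simp flip: tpow_add intro!: trig_polys_add trig_polys_cscale)
  qed
  then show ?case using step by (auto simp: distrib_right intro!: trig_polys_add trig_polys_cscale)
qed

lemma trig_polys_conj: "f \<in> trig_polys UNIV \<Longrightarrow> conj_fun f \<in> trig_polys UNIV"
  by (induction rule: trig_polys_induct)
    (auto simp: trig_polys_zero trig_polys_tpow intro!: trig_polys_add trig_polys_cscale)

lemma trig_polys_Linf: "f \<in> trig_polys K \<Longrightarrow> f \<in> Linf"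
proof (induction rule: trig_polys_induct)
  case zero then show ?case using rp_zero by (auto simp: in_Linf_iff intro!: exI[of _ 0] elim: eventually_mono)
next
  case (step c k g)
  then obtain C where C: "AE t in circle_measure. cmod (rp g t) \<le> C" by (auto simp: in_Linf_iff)
  have "AE t in circle_measure. cmod (rp (cscale c (tpow k) + g) t) \<le> cmod c + C"
    using C rp_plus[of "cscale c (tpow k)" g] rp_cscale[of c "tpow k"] rp_tpow[of k] circle_AE_norm
  proof eventually_elim
    case (elim t)
    have "cmod (c * t powi k) = cmod c" using elim by (simp add: norm_mult norm_power_int)
    then show ?case using elim norm_triangle_ineq[of "c * t powi k" "rp g t"] by simp
  qed
  then show ?case by (auto simp: in_Linf_iff)
qed

lemma trig_polys_Lp: "0 \<le> p \<Longrightarrow> f \<in> trig_polys K \<Longrightarrow> f \<in> Lp p"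
  using trig_polys_Linf Linf_subset_Lp by blast

lemma trig_polys_fourier_outside: "f \<in> trig_polys K \<Longrightarrow> n \<notin> K \<Longrightarrow> fourier f n = 0"
proof (induction rule: trig_polys_induct)
  case (step c k g)
  then show ?case
    by (auto simp: fourier_add[OF Lp_cscale[OF Linf_subset_Lp] trig_polys_Lp[of 1]] fourier_tpow)
qed simp

lemma abs_tfun_add: "F \<in> borel_measurable borel \<Longrightarrow> G \<in> borel_measurable borel \<Longrightarrow>
    abs_tfun (\<lambda>t. F t + G t) = abs_tfun F + abs_tfun G"
  by (subst plus_tfun.abs_eq) (auto simp: ae_eq_def)
lemma abs_tfun_mult: "F \<in> borel_measurable borel \<Longrightarrow> G \<in> borel_measurable borel \<Longrightarrow>
    abs_tfun (\<lambda>t. F t * G t) = abs_tfun F * abs_tfun G"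
  by (subst times_tfun.abs_eq) (auto simp: ae_eq_def)

lemma abs_tfun_eqI:
  "F \<in> borel_measurable borel \<Longrightarrow> AE t in circle_measure. F t = rp g t \<Longrightarrow> abs_tfun F = g"
  by (rule tfun_eqI) (use rp_abs[of F] in \<open>auto elim: eventually_elim2\<close>)

lemma Re_Im_borel [measurable]: "Re \<in> borel_measurable borel" "Im \<in> borel_measurable borel" "cnj \<in> borel_measurable borel"
  by (intro borel_measurable_continuous_onI continuous_intros)+

lemma circle_cnj_eq: "cmod t = 1 \<Longrightarrow> cnj t = inverse t"
  using complex_norm_square[of t] by (simp add: inverse_unique)

lemma abs_Re_Im_trig:
  "abs_tfun (\<lambda>t. of_real (Re t)) \<in> trig_polys UNIV" "abs_tfun (\<lambda>t. of_real (Im t)) \<in> trig_polys UNIV"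
proof -
  have "abs_tfun (\<lambda>t. of_real (Re t)) = cscale (1/2) (tpow 1 + tpow (-1))"
  proof (rule abs_tfun_eqI)
    show "AE t in circle_measure. of_real (Re t) = rp (cscale (1/2) (tpow 1 + tpow (-1))) t"
      using rp_cscale[of "1/2" "tpow 1 + tpow (-1)"] rp_plus[of "tpow 1" "tpow (-1)"] rp_tpow[of 1] rp_tpow[of "-1"] circle_AE_norm
    proof eventually_elim
      case (elim t)
      then have "rp (cscale (1/2) (tpow 1 + tpow (-1))) t = 1/2 * (t + cnj t)" by (simp add: circle_cnj_eq)
      then show ?case by (simp add: complex_eq_iff)
    qed
  qed simp
  then show "abs_tfun (\<lambda>t. of_real (Re t)) \<in> trig_polys UNIV"
    by (auto intro!: trig_polys_add trig_polys_cscale trig_polys_tpow)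
  have "abs_tfun (\<lambda>t. of_real (Im t)) = cscale (-\<i>/2) (tpow 1 - tpow (-1))"
  proof (rule abs_tfun_eqI)
    show "AE t in circle_measure. of_real (Im t) = rp (cscale (-\<i>/2) (tpow 1 - tpow (-1))) t"
      using rp_cscale[of "-\<i>/2" "tpow 1 - tpow (-1)"] rp_minus[of "tpow 1" "tpow (-1)"] rp_tpow[of 1] rp_tpow[of "-1"] circle_AE_norm
    proof eventually_elim
      case (elim t)
      then have "rp (cscale (-\<i>/2) (tpow 1 - tpow (-1))) t = -\<i>/2 * (t - cnj t)" by (simp add: circle_cnj_eq)
      then show ?case by (simp add: complex_eq_iff)
    qed
  qed simp
  moreover have "cscale (-\<i>/2) (tpow 1 - tpow (-1)) \<in> trig_polys UNIV"
    by (intro trig_polys_diff trig_polys_cscale trig_polys_tpow UNIV_I)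
  ultimately show "abs_tfun (\<lambda>t. of_real (Im t)) \<in> trig_polys UNIV"
    by (simp only:)
qed

text \<open>On the circle \<open>Re t = (t + 1/t)/2\<close> and \<open>Im t = (t - 1/t)/(2\<i>)\<close>. Hence the Stone-Weierstrass theorem
  for real polynomials on the plane gives uniform approximation by trigonometric polynomials.\<close>

lemma real_polynomial_function_trig:
  assumes "real_polynomial_function (g :: complex \<Rightarrow> real)"
  shows "abs_tfun (\<lambda>t. of_real (g t)) \<in> trig_polys UNIV"
  using assms
proof (induction rule: real_polynomial_function.induct)
  case (linear f)
  have f: "f t = Re t * f 1 + Im t * f \<i>" for t
  proof -
    have "t = Re t *\<^sub>R 1 + Im t *\<^sub>R \<i>" by (simp add: complex_eq_iff)
    then have "f t = f (Re t *\<^sub>R 1 + Im t *\<^sub>R \<i>)" by simp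
    then show ?thesis using linear by (simp add: bounded_linear.linear linear_add linear_scale)
  qed
  have "abs_tfun (\<lambda>t. of_real (f t)) = abs_tfun (\<lambda>t. of_real (Re t) * of_real (f 1) + of_real (Im t) * of_real (f \<i>))"
    by (intro arg_cong[where f = abs_tfun] ext) (subst f, simp only: of_real_add of_real_mult)
  also have "\<dots> = abs_tfun (\<lambda>t. of_real (Re t)) * abs_tfun (\<lambda>_. of_real (f 1)) + abs_tfun (\<lambda>t. of_real (Im t)) * abs_tfun (\<lambda>_. of_real (f \<i>))"
    by (simp add: abs_tfun_add abs_tfun_mult)
  finally have eq: "abs_tfun (\<lambda>t. of_real (f t)) = abs_tfun (\<lambda>t. of_real (Re t)) * abs_tfun (\<lambda>_. of_real (f 1)) + abs_tfun (\<lambda>t. of_real (Im t)) * abs_tfun (\<lambda>_. of_real (f \<i>))" .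
  have "abs_tfun (\<lambda>_. z) = cscale z 1" for z
    by (rule abs_tfun_eqI) (use rp_cscale[of z 1] rp_one in \<open>auto elim: eventually_elim2\<close>)
  then show ?case unfolding eq using abs_Re_Im_trig by (auto intro!: trig_polys_add trig_polys_cscale)
next
  case (const c)
  have "abs_tfun (\<lambda>_. of_real c) = cscale (of_real c) 1"
    by (rule abs_tfun_eqI) (use rp_cscale[of "of_real c" 1] rp_one in \<open>auto elim: eventually_elim2\<close>)
  then show ?case by (auto intro!: trig_polys_cscale trig_polys_one)
next
  case (add f g)
  have "f \<in> borel_measurable borel" "g \<in> borel_measurable borel"
    using add.hyps by (auto intro!: borel_measurable_continuous_onI continuous_on_polymonial_function simp: real_polynomial_function_eq)
  then show ?case using add.IH by (simp add: abs_tfun_add trig_polys_add)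
next
  case (mult f g)
  have "f \<in> borel_measurable borel" "g \<in> borel_measurable borel"
    using mult.hyps by (auto intro!: borel_measurable_continuous_onI continuous_on_polymonial_function simp: real_polynomial_function_eq)
  then show ?case using mult.IH by (simp add: abs_tfun_mult trig_polys_mult)
qed

lemma fourier_eq_0_trig:
  assumes f: "f \<in> Lp 1" and 0: "\<And>n. fourier f n = 0" and s: "s \<in> trig_polys UNIV"
  shows "fourier (s * f) n = 0"
  using s
proof (induction rule: trig_polys_induct)
  case (step c k g)
  have "tpow k * f \<in> Lp 1" "g * f \<in> Lp 1" using f trig_polys_Linf[OF step(2)] by (auto intro!: Linf_mult_Lp)
  then show ?case using step 0 by (simp add: distrib_right fourier_add Lp_cscale)
qed simp

lemma le_zero_if_le_eps_mult:
  fixes x n :: real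
  assumes "\<And>e. e > 0 \<Longrightarrow> x \<le> e * n"
  shows "x \<le> 0"
proof (rule LIMSEQ_le_const)
  show "(\<lambda>k. 1 / real (Suc k) * n) \<longlonglongrightarrow> 0"
    using tendsto_mult_right[OF LIMSEQ_Suc[OF lim_1_over_n], of n] by simp
  have "x \<le> 1 / real (Suc k) * n" for k by (rule assms) simp
  then show "\<exists>N. \<forall>k\<ge>N. x \<le> 1 / real (Suc k) * n" by blast
qed

lemma fourier_eq_0_continuous:
  fixes \<phi> :: "complex \<Rightarrow> real"
  assumes f: "f \<in> Lp 1" and 0: "\<And>n. fourier f n = 0" and \<phi>: "continuous_on UNIV \<phi>"
  shows "(LINT t|circle_measure. \<phi> t *\<^sub>R rp f t) = 0"
proof -
  have if1: "integrable circle_measure (rp f)" using f by (simp add: Lp_1_iff)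
  have mb: "\<phi> \<in> borel_measurable borel" using \<phi> by (rule borel_measurable_continuous_onI)
  have "cmod (LINT t|circle_measure. \<phi> t *\<^sub>R rp f t) \<le> e * Lp_norm 1 f" if e: "e > 0" for e
  proof -
    obtain g where g: "real_polynomial_function g" "\<And>t. t \<in> sphere 0 1 \<Longrightarrow> \<bar>\<phi> t - g t\<bar> < e"
      using Stone_Weierstrass_real_polynomial_function[OF compact_sphere[of 0 1] continuous_on_subset[OF \<phi>] e] by auto
    have gb: "g \<in> borel_measurable borel"
      using g(1) by (auto intro!: borel_measurable_continuous_onI continuous_on_polymonial_function simp: real_polynomial_function_eq)
    let ?s = "abs_tfun (\<lambda>t. of_real (g t))"
    have s: "AE t in circle_measure. rp ?s t = of_real (g t)" using gb by (intro rp_abs) auto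
    have "(LINT t|circle_measure. g t *\<^sub>R rp f t) = fourier (?s * f) 0"
      unfolding fourier_eq
    proof (rule integral_cong_AE)
      show "AE t in circle_measure. g t *\<^sub>R rp f t = rp (?s * f) t * t powi - 0"
        using s rp_times[of ?s f] by eventually_elim (simp add: scaleR_conv_of_real)
    qed (use gb in auto)
    then have g0: "(LINT t|circle_measure. g t *\<^sub>R rp f t) = 0"
      using fourier_eq_0_trig[OF f 0 real_polynomial_function_trig[OF g(1)]] by simp
    have bd: "AE t in circle_measure. \<bar>\<phi> t - g t\<bar> \<le> e"
      using circle_AE_norm g(2) by (auto elim!: eventually_mono simp: less_imp_le)
    have i1: "integrable circle_measure (\<lambda>t. (\<phi> t - g t) *\<^sub>R rp f t)"
    proof (rule Bochner_Integration.integrable_bound[of _ "\<lambda>t. e *\<^sub>R rp f t"])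
      show "AE t in circle_measure. norm ((\<phi> t - g t) *\<^sub>R rp f t) \<le> norm (e *\<^sub>R rp f t)"
        using bd by eventually_elim (auto intro!: mult_right_mono)
    qed (use if1 mb gb in auto)
    have i2: "integrable circle_measure (\<lambda>t. g t *\<^sub>R rp f t)"
    proof -
      have "?s * f \<in> Lp 1" using f real_polynomial_function_trig[OF g(1)] trig_polys_Linf by (intro Linf_mult_Lp) auto
      then show ?thesis unfolding Lp_1_iff
        by (rule integrable_cong_AE_imp) (use gb s rp_times[of ?s f] in \<open>auto elim!: eventually_elim2 simp: scaleR_conv_of_real\<close>)
    qed
    have "(LINT t|circle_measure. \<phi> t *\<^sub>R rp f t) = (LINT t|circle_measure. (\<phi> t - g t) *\<^sub>R rp f t + g t *\<^sub>R rp f t)"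
      by (simp add: scaleR_left_diff_distrib)
    also have "\<dots> = (LINT t|circle_measure. (\<phi> t - g t) *\<^sub>R rp f t)"
      using i1 i2 g0 by simp
    also have "cmod \<dots> \<le> (LINT t|circle_measure. norm ((\<phi> t - g t) *\<^sub>R rp f t))" by (rule integral_norm_bound)
    also have "\<dots> \<le> (LINT t|circle_measure. e * cmod (rp f t))"
    proof (rule integral_mono_AE)
      show "AE t in circle_measure. norm ((\<phi> t - g t) *\<^sub>R rp f t) \<le> e * cmod (rp f t)"
        using bd by eventually_elim (auto intro!: mult_right_mono)
      show "integrable circle_measure (\<lambda>t. norm ((\<phi> t - g t) *\<^sub>R rp f t))" using i1 by (rule integrable_norm)
    qed (use if1 in auto)
    finally show ?thesis by (simp add: Lp_norm_1)
  qed
  then have "cmod (LINT t|circle_measure. \<phi> t *\<^sub>R rp f t) \<le> 0" by (rule le_zero_if_le_eps_mult)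
  then show ?thesis by (simp only: norm_le_zero_iff)
qed

text \<open>A function without Fourier coefficients integrates to 0 against trigonometric polynomials, hence
  against continuous functions, hence over closed sets (whose indicators are bounded limits of
  continuous functions), hence over all Borel sets.\<close>

theorem fourier_eq_0_imp:
  assumes f: "f \<in> Lp 1" and 0: "\<And>n. fourier f n = 0"
  shows "f = 0"
proof -
  have if1: "integrable circle_measure (rp f)" using f by (simp add: Lp_1_iff)
  have closed: "set_lebesgue_integral circle_measure A (rp f) = 0" if "closed A" for A
  proof (cases "A = {}")
    case False
    define \<phi> where "\<phi> n t = max 0 (1 - real n * infdist t A)" for n t
    have lim: "(\<lambda>n. \<phi> n t) \<longlonglongrightarrow> indicator A t" for t
    proof (cases "t \<in> A")
      case False
      then have "infdist t A > 0" using in_closed_iff_infdist_zero[OF that \<open>A \<noteq> {}\<close>, of t] infdist_nonneg[of t A] by simp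
      then obtain N where N: "1 < real N * infdist t A" using reals_Archimedean3[OF \<open>infdist t A > 0\<close>] by auto
      have "\<forall>\<^sub>F n in sequentially. \<phi> n t = 0"
        using eventually_ge_at_top[of N]
      proof eventually_elim
        case (elim n)
        then have "real N * infdist t A \<le> real n * infdist t A" by (intro mult_right_mono) (auto simp: infdist_nonneg)
        then show ?case using N by (simp add: \<phi>_def)
      qed
      then show ?thesis using False by (simp add: tendsto_eventually)
    qed (simp add: \<phi>_def)
    have cont: "continuous_on UNIV (\<phi> n)" for n unfolding \<phi>_def by (intro continuous_intros)
    have mb: "\<phi> n \<in> borel_measurable borel" for n using cont by (rule borel_measurable_continuous_onI)
    have "(\<lambda>n. LINT t|circle_measure. \<phi> n t *\<^sub>R rp f t) \<longlonglongrightarrow> (LINT t|circle_measure. indicator A t *\<^sub>R rp f t)"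
    proof (rule integral_dominated_convergence[where w = "\<lambda>t. cmod (rp f t)"])
      show "AE t in circle_measure. (\<lambda>n. \<phi> n t *\<^sub>R rp f t) \<longlonglongrightarrow> indicator A t *\<^sub>R rp f t"
        by (intro always_eventually allI tendsto_intros lim)
      have "norm (\<phi> n t *\<^sub>R rp f t) \<le> cmod (rp f t)" for n t
        using mult_right_mono[of "\<bar>\<phi> n t\<bar>" 1 "cmod (rp f t)"] by (simp add: \<phi>_def infdist_nonneg)
      then show "AE t in circle_measure. norm (\<phi> n t *\<^sub>R rp f t) \<le> cmod (rp f t)" for n by simp
    qed (use mb if1 \<open>closed A\<close> in auto)
    moreover have "(LINT t|circle_measure. \<phi> n t *\<^sub>R rp f t) = 0" for n
      using fourier_eq_0_continuous[OF f 0 cont] .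
    ultimately show ?thesis by (simp add: set_lebesgue_integral_def LIMSEQ_const_iff)
  qed (simp add: set_lebesgue_integral_def)
  have sigma_closed: "sigma_sets UNIV (Collect closed) = sets (borel :: complex measure)"
    using sets_measure_of[of "Collect closed" "UNIV :: complex set"] borel_eq_closed[where 'a = complex] by (metis Pow_UNIV subset_UNIV)
  have Int_stable_closed: "Int_stable (Collect closed :: complex set set)" by (auto simp: Int_stable_def)
  have closed_Pow: "Collect closed \<subseteq> Pow (UNIV :: complex set)" by simp
  have all: "set_lebesgue_integral circle_measure A (rp f) = 0" if "A \<in> sigma_sets UNIV (Collect closed)" for A :: "complex set"
    using Int_stable_closed closed_Pow that
  proof (induction rule: sigma_sets_induct_disjoint)
    case (compl A)
    have A: "A \<in> sets borel" using compl.hyps by (simp only: sigma_closed)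
    have "(LINT t|circle_measure. indicator (UNIV - A) t *\<^sub>R rp f t)
        = (LINT t|circle_measure. indicator UNIV t *\<^sub>R rp f t - indicator A t *\<^sub>R rp f t)"
      by (intro Bochner_Integration.integral_cong) (auto simp: indicator_def)
    also have "\<dots> = (LINT t|circle_measure. indicator UNIV t *\<^sub>R rp f t) - (LINT t|circle_measure. indicator A t *\<^sub>R rp f t)"
      using if1 A by (intro Bochner_Integration.integral_diff integrable_mult_indicator) auto
    finally show ?case using compl.IH closed[of UNIV] by (simp add: set_lebesgue_integral_def)
  next
    case (union A)
    have "A i \<in> sets borel" for i using union.hyps(2) unfolding sigma_closed by blast
    then have "set_lebesgue_integral circle_measure (\<Union>i. A i) (rp f) = (\<Sum>i. set_lebesgue_integral circle_measure (A i) (rp f))"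
      using union.hyps(1) if1
      by (intro lebesgue_integral_countable_add) (auto simp: disjoint_family_on_def set_integrable_def intro!: integrable_mult_indicator)
    then show ?case using union.IH by simp
  qed (auto simp: set_lebesgue_integral_def closed[unfolded set_lebesgue_integral_def])
  have "AE t in circle_measure. rp f t = 0"
  proof (rule circle.density_zero[OF if1])
    fix A :: "complex set" assume "A \<in> sets circle_measure"
    then have "A \<in> sigma_sets UNIV (Collect closed)"
      by (simp only: sets_circle_measure sigma_closed)
    then show "set_lebesgue_integral circle_measure A (rp f) = 0" by (rule all)
  qed
  then have "AE t in circle_measure. rp f t = rp 0 t" using rp_zero by eventually_elim simp
  then show ?thesis by (rule tfun_eqI)
qed

corollary fourier_inject:
  assumes "f \<in> Lp 1" "g \<in> Lp 1" "\<And>n. fourier f n = fourier g n"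
  shows "f = g"
  using fourier_eq_0_imp[of "f - g"] assms by (simp add: Lp_diff fourier_diff)

lemma pairing_tpow_left: "pairing (tpow n) k = cnj (fourier k n)"
  by (simp add: pairing_def)

text \<open>Otherwise some nonzero element of \<open>L\<^sup>q\<close> annihilates every power of \<open>t\<close>, so all its Fourier
  coefficients vanish.\<close>

theorem (in conjugate_exponents) trig_polys_dense:
  assumes f: "f \<in> Lp p" and e: "e > 0"
  obtains s where "s \<in> trig_polys UNIV" "Lp_norm p (f - s) < e"
proof (cases "\<forall>e>0. \<exists>s\<in>trig_polys UNIV. Lp_norm p (f - s) < e")
  case False
  obtain k where k: "k \<in> Lp q" "\<And>s. s \<in> trig_polys UNIV \<Longrightarrow> pairing s k = 0" "pairing f k \<noteq> 0"
    by (rule annihilator[OF trig_polys_subspace _ f False]) (use p_gt_1 in \<open>auto intro: trig_polys_Lp\<close>)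
  interpret qp: conjugate_exponents q p by (rule conjugate_exponents_sym)
  have "fourier k n = 0" for n
    using k(2)[of "tpow n"] by (simp add: trig_polys_tpow pairing_tpow_left)
  then have "k = 0" using qp.Lp_subset_L1[OF k(1)] by (intro fourier_eq_0_imp)
  then show thesis using k(3) by (simp add: pairing_def)
qed (use that e in blast)

section \<open>The theorem of M. Riesz\<close>

subsection \<open>The projection on trigonometric polynomials\<close>

text \<open>The Riesz projection where it is a finite sum; the support is finite for trigonometric polynomials.\<close>

definition trig_P :: "tfun \<Rightarrow> tfun" where
  "trig_P s = (\<Sum>k | 0 \<le> k \<and> fourier s k \<noteq> 0. cscale (fourier s k) (tpow k))"

lemma trig_polys_finite_support: "s \<in> trig_polys K \<Longrightarrow> finite {k. fourier s k \<noteq> 0}"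
proof (induction rule: trig_polys_induct)
  case (step c k g)
  have "fourier (cscale c (tpow k) + g) n = c * fourier (tpow k) n + fourier g n" for n
    using trig_polys_Lp[of 1, OF _ step(2)] by (simp add: fourier_add Lp_cscale Linf_subset_Lp)
  then have "{n. fourier (cscale c (tpow k) + g) n \<noteq> 0} \<subseteq> insert k {n. fourier g n \<noteq> 0}"
    by (auto simp: fourier_tpow split: if_splits)
  then show ?case using step.IH by (auto intro: finite_subset)
qed simp

lemma fourier_sum_tpow:
  assumes "finite S"
  shows "fourier (\<Sum>k\<in>S. cscale (c k) (tpow k)) n = (if n \<in> S then c n else 0)"
    and "(\<Sum>k\<in>S. cscale (c k) (tpow k)) \<in> trig_polys S"
proof -
  show *: "(\<Sum>k\<in>S. cscale (c k) (tpow k)) \<in> trig_polys S" for S c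
    unfolding trig_polys_def by (intro cvs.span_sum cvs.span_scale cvs.span_base) auto
  show "fourier (\<Sum>k\<in>S. cscale (c k) (tpow k)) n = (if n \<in> S then c n else 0)"
    using assms
  proof induction
    case (insert k S)
    then show ?case using trig_polys_Lp[of 1, OF _ *[of c S]]
      by (auto simp: fourier_add Lp_cscale Linf_subset_Lp fourier_tpow)
  qed simp
qed

lemma trig_P_mem: "s \<in> trig_polys K \<Longrightarrow> trig_P s \<in> trig_polys {0..}"
  using fourier_sum_tpow(2)[of "{k. 0 \<le> k \<and> fourier s k \<noteq> 0}" "fourier s"]
    trig_polys_mono[of "{k. 0 \<le> k \<and> fourier s k \<noteq> 0}" "{0..}"] trig_polys_finite_support[of s K]
  by (auto simp: trig_P_def)

lemma fourier_trig_P: "s \<in> trig_polys K \<Longrightarrow> fourier (trig_P s) n = (if 0 \<le> n then fourier s n else 0)"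
proof -
  assume "s \<in> trig_polys K"
  then have "finite {k. 0 \<le> k \<and> fourier s k \<noteq> 0}" by (intro finite_subset[OF _ trig_polys_finite_support]) auto
  then show ?thesis unfolding trig_P_def by (subst fourier_sum_tpow(1)) auto
qed

lemma trig_polys_UNIV: "s \<in> trig_polys K \<Longrightarrow> s \<in> trig_polys UNIV"
  using trig_polys_mono[of K UNIV] by auto

lemma trig_polys_L1: "s \<in> trig_polys K \<Longrightarrow> s \<in> Lp 1"
  by (rule trig_polys_Lp) auto

lemma trig_polys_expand: "s \<in> trig_polys K \<Longrightarrow> s = (\<Sum>k | fourier s k \<noteq> 0. cscale (fourier s k) (tpow k))"
  using trig_polys_finite_support[of s K] fourier_sum_tpow(2)[of "{k. fourier s k \<noteq> 0}" "fourier s"]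
  by (intro fourier_inject) (auto simp: fourier_sum_tpow(1) intro: trig_polys_L1)

lemma trig_polys_AE_sum:
  assumes s: "s \<in> trig_polys K"
  shows "AE t in circle_measure. rp s t = (\<Sum>k | fourier s k \<noteq> 0. fourier s k * t powi k)"
proof -
  have "AE t in circle_measure. rp (\<Sum>k\<in>S. cscale (fourier s k) (tpow k)) t = (\<Sum>k\<in>S. fourier s k * t powi k)"
    if "finite S" for S
    using that
  proof induction
    case empty then show ?case using rp_zero by simp
  next
    case (insert k S)
    show ?case
      using insert.IH rp_plus[of "cscale (fourier s k) (tpow k)" "\<Sum>k\<in>S. cscale (fourier s k) (tpow k)"]
        rp_cscale[of "fourier s k" "tpow k"] rp_tpow[of k]
      by eventually_elim (use insert.hyps in simp)
  qed
  from this[OF trig_polys_finite_support[OF s]] show ?thesis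
    using trig_polys_expand[OF s] by simp
qed

lemma trig_P_UNIV: "s \<in> trig_polys UNIV \<Longrightarrow> trig_P s \<in> trig_polys UNIV"
  by (rule trig_polys_UNIV[OF trig_P_mem])

lemma trig_P_add: "s \<in> trig_polys UNIV \<Longrightarrow> r \<in> trig_polys UNIV \<Longrightarrow> trig_P (s + r) = trig_P s + trig_P r"
  by (intro fourier_inject trig_polys_L1[of _ UNIV] trig_polys_add trig_P_UNIV)
    (auto simp: fourier_trig_P[of _ UNIV] fourier_add trig_polys_L1[of _ UNIV] trig_polys_add trig_P_UNIV)

lemma trig_P_cscale: "s \<in> trig_polys UNIV \<Longrightarrow> trig_P (cscale z s) = cscale z (trig_P s)"
  by (intro fourier_inject trig_polys_L1[of _ UNIV] trig_polys_cscale trig_P_UNIV)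
    (auto simp: fourier_trig_P[of _ UNIV] trig_polys_cscale)

lemma trig_P_diff: "s \<in> trig_polys UNIV \<Longrightarrow> r \<in> trig_polys UNIV \<Longrightarrow> trig_P (s - r) = trig_P s - trig_P r"
  using trig_P_add[of s "cscale (-1) r"] trig_P_cscale[of r "-1"] trig_polys_cscale[of r UNIV "-1"]
  by (simp add: cscale_minus_one)

subsection \<open>Positive trigonometric polynomials\<close>

text \<open>Every arc has positive measure.\<close>

lemma circle_AE_continuous_ge:
  fixes \<phi> :: "complex \<Rightarrow> real"
  assumes cont: "continuous_on (sphere 0 1) \<phi>" and ae: "AE t in circle_measure. c \<le> \<phi> t"
    and meas: "\<phi> \<in> borel_measurable borel" and t: "cmod t = 1"
  shows "c \<le> \<phi> t"
proof (rule ccontr)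
  assume "\<not> c \<le> \<phi> t"
  then have lt: "\<phi> t < c" by simp
  define \<theta>0 where "\<theta>0 = Arg t"
  have \<theta>0: "cis \<theta>0 = t" "-pi < \<theta>0" "\<theta>0 \<le> pi"
  proof -
    have "t \<noteq> 0" using t by auto
    then show "cis \<theta>0 = t" using t cis_Arg[of t] by (simp add: \<theta>0_def sgn_eq)
  qed (auto simp: \<theta>0_def mpi_less_Arg Arg_le_pi)
  have "continuous_on UNIV (\<lambda>\<theta>. \<phi> (cis \<theta>))"
    by (rule continuous_on_compose2[OF cont]) (auto intro!: continuous_intros)
  then have "((\<lambda>\<theta>. \<phi> (cis \<theta>)) \<longlongrightarrow> \<phi> (cis \<theta>0)) (at_left \<theta>0)"
    by (auto simp: continuous_on_eq_continuous_at isCont_def intro: filterlim_mono[OF _ order_refl at_le])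
  then have "\<forall>\<^sub>F \<theta> in at_left \<theta>0. \<phi> (cis \<theta>) < c"
    using lt \<theta>0(1) by (intro order_tendstoD) auto
  then obtain b where b: "b < \<theta>0" "\<And>\<theta>. b < \<theta> \<Longrightarrow> \<theta> < \<theta>0 \<Longrightarrow> \<phi> (cis \<theta>) < c"
    by (auto simp: eventually_at_left[of "\<theta>0 - 1"])
  define b' where "b' = max b (-pi)"
  have b': "b' < \<theta>0" using b \<theta>0 by (simp add: b'_def)
  have "AE \<theta> in lborel. \<theta> \<in> {-pi..pi} \<longrightarrow> c \<le> \<phi> (cis \<theta>)"
    using ae meas by (subst AE_circle_measure_iff[symmetric]) auto
  then have "AE \<theta> in lborel. \<theta> \<notin> {b'<..<\<theta>0}"
    by eventually_elim (use b(2) \<theta>0 in \<open>force simp: b'_def\<close>)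
  then have "{b'<..<\<theta>0} \<in> null_sets lborel" by (subst AE_iff_null_sets) auto
  then show False using b' by (auto simp: null_sets_def)
qed

text \<open>For \<open>1 < p \<le> 2\<close> the angle \<open>p\<pi>/2\<close> lies in \<open>(\<pi>/2, \<pi>]\<close>, so \<open>-cos (p\<theta>)\<close> is bounded below by a positive
  constant near \<open>\<theta> = \<pi>/2\<close>; away from there \<open>cos \<theta>\<close> is.\<close>

lemma cos_powr_inequality:
  assumes p: "1 < p" "p \<le> 2"
  obtains A B where "A \<ge> 0" "B \<ge> 0" "\<And>\<theta>. \<bar>\<theta>\<bar> < pi/2 \<Longrightarrow> 1 \<le> A * cos \<theta> powr p - B * cos (p * \<theta>)"
proof -
  \<comment> \<open>\<open>cos (p * \<theta>)\<close> changes sign at \<open>pi / (2 * p)\<close>; the threshold lies strictly between it and \<open>pi / 2\<close>.\<close>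
  define \<theta>0 where "\<theta>0 = (pi / (2 * p) + pi / 2) / 2"
  have "pi / (2 * p) < pi / 2" using p by (simp add: divide_simps)
  then have \<theta>0: "pi / (2 * p) < \<theta>0" "\<theta>0 < pi / 2" by (auto simp: \<theta>0_def)
  have "0 < pi / (2 * p)" using p by simp
  then have \<theta>0_pos: "0 < \<theta>0" using \<theta>0 by linarith
  have p\<theta>0: "pi / 2 < p * \<theta>0" using \<theta>0(1) p by (simp add: field_simps)
  have p\<theta>_le: "p * \<theta> \<le> pi" if "\<theta> < pi/2" "0 \<le> \<theta>" for \<theta>
  proof -
    have "p * \<theta> \<le> 2 * (pi / 2)" using that p by (intro mult_mono) auto
    then show ?thesis by simp
  qed
  have neg: "cos (p * \<theta>0) < 0"
    using p\<theta>0 p\<theta>_le[of \<theta>0] \<theta>0 \<theta>0_pos by (intro cos_lt_zero_pi) auto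
  define B where "B = 1 / (- cos (p * \<theta>0))"
  have B: "B > 0" using neg by (simp add: B_def)
  have c0: "cos \<theta>0 > 0" using \<theta>0 \<theta>0_pos by (intro cos_gt_zero_pi) auto
  define A where "A = (1 + B) / (cos \<theta>0 powr p)"
  have A: "A > 0" using B c0 by (simp add: A_def)
  have nonneg: "1 \<le> A * cos \<theta> powr p - B * cos (p * \<theta>)" if \<theta>: "0 \<le> \<theta>" "\<theta> < pi/2" for \<theta>
  proof (cases "\<theta>0 \<le> \<theta>")
    case True
    have "cos (p * \<theta>) \<le> cos (p * \<theta>0)"
      using True \<theta>0_pos \<theta> p p\<theta>_le by (intro cos_monotone_0_pi_le mult_left_mono) auto
    then have "B * cos (p * \<theta>) \<le> B * cos (p * \<theta>0)" using B by (intro mult_left_mono) auto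
    also have "\<dots> = -1" using neg by (simp add: B_def)
    finally show ?thesis using A by (smt (verit) mult_nonneg_nonneg powr_ge_zero)
  next
    case False
    have "cos \<theta>0 \<le> cos \<theta>" using False \<theta> \<theta>0 by (intro cos_monotone_0_pi_le) auto
    then have "cos \<theta>0 powr p \<le> cos \<theta> powr p" using c0 p by (intro powr_mono2) auto
    then have "A * cos \<theta>0 powr p \<le> A * cos \<theta> powr p" using A by (intro mult_left_mono) auto
    moreover have "A * cos \<theta>0 powr p = 1 + B" using c0 by (simp add: A_def)
    moreover have "B * cos (p * \<theta>) \<le> B * 1" using B by (intro mult_left_mono) auto
    ultimately show ?thesis by linarith
  qed
  have "1 \<le> A * cos \<theta> powr p - B * cos (p * \<theta>)" if "\<bar>\<theta>\<bar> < pi/2" for \<theta>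
    using nonneg[of "\<bar>\<theta>\<bar>"] that by (cases "\<theta> \<ge> 0") auto
  then show thesis using A B that by (meson less_imp_le)
qed

lemma cmod_powr_inequality:
  assumes p: "1 < p" "p \<le> 2"
  obtains A B where "A \<ge> 0" "B \<ge> 0" "\<And>w. 0 < Re w \<Longrightarrow> cmod w powr p \<le> A * Re w powr p - B * Re (w powr of_real p)"
proof -
  obtain A B where AB: "A \<ge> 0" "B \<ge> 0" "\<And>\<theta>. \<bar>\<theta>\<bar> < pi/2 \<Longrightarrow> 1 \<le> A * cos \<theta> powr p - B * cos (p * \<theta>)"
    using cos_powr_inequality[OF p] by blast
  have "cmod w powr p \<le> A * Re w powr p - B * Re (w powr of_real p)" if w: "0 < Re w" for w
  proof -
    have w0: "w \<noteq> 0" using w by auto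
    define \<theta> where "\<theta> = Im (Ln w)"
    have \<theta>: "\<bar>\<theta>\<bar> < pi/2" using w w0 Re_Ln_pos_lt by (simp add: \<theta>_def)
    have Rew: "Re w = cmod w * cos \<theta>"
    proof -
      have "Re w = Re (exp (Ln w))" using w0 by simp
      also have "\<dots> = cmod w * cos \<theta>" unfolding Re_exp using w0 by (simp add: \<theta>_def)
      finally show ?thesis .
    qed
    have Rep: "Re (w powr of_real p) = cmod w powr p * cos (p * \<theta>)"
      using w0 by (simp add: powr_def Re_exp \<theta>_def)
    have "cmod w powr p * 1 \<le> cmod w powr p * (A * cos \<theta> powr p - B * cos (p * \<theta>))"
      using AB(3)[OF \<theta>] by (intro mult_left_mono) auto
    then show ?thesis unfolding Rep by (simp add: Rew powr_mult algebra_simps)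
  qed
  then show thesis using AB that by blast
qed

lemma Lp_norm_le_I:
  assumes p: "0 < p" and g: "g \<in> Lp p" and A: "0 \<le> A"
    and le: "(LINT t|circle_measure. cmod (rp f t) powr p) \<le> A * (LINT t|circle_measure. cmod (rp g t) powr p)"
  shows "Lp_norm p f \<le> A powr (1 / p) * Lp_norm p g"
proof -
  have "Lp_norm p f powr p \<le> (A powr (1 / p) * Lp_norm p g) powr p"
    using p A le by (simp add: powr_mult powr_powr Lp_norm_powr)
  then show ?thesis using p powr_less_mono2[of p "A powr (1 / p) * Lp_norm p g" "Lp_norm p f"] A by fastforce
qed

lemma Lp_norm_mono_AE:
  assumes p: "0 < p" and g: "g \<in> Lp p" and f: "f \<in> Lp p" and le: "AE t in circle_measure. cmod (rp f t) \<le> cmod (rp g t)"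
  shows "Lp_norm p f \<le> Lp_norm p g"
proof -
  have "(LINT t|circle_measure. cmod (rp f t) powr p) \<le> 1 * (LINT t|circle_measure. cmod (rp g t) powr p)"
    unfolding mult_1
  proof (rule integral_mono_AE)
    show "AE t in circle_measure. cmod (rp f t) powr p \<le> cmod (rp g t) powr p"
      using le by eventually_elim (use p in \<open>auto intro: powr_mono2\<close>)
  qed (use f g in \<open>auto simp: in_Lp_iff\<close>)
  from Lp_norm_le_I[OF p g _ this] show ?thesis by simp
qed

text \<open>Let \<open>G = 2Pu - u\<^sub>0\<close> with \<open>u\<^sub>0\<close> the mean of \<open>u\<close>. Then \<open>Re G = u\<close> on the circle, and the maximum principle for \<open>exp (-G)\<close>
  shows that \<open>G\<close> maps the disc into the right half plane. So \<open>G\<^sup>p\<close> is analytic there, its mean is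
  \<open>u\<^sub>0\<^sup>p \<ge> 0\<close>, and the inequality for \<open>|w|\<^sup>p\<close> integrates to \<open>\<integral>|G|\<^sup>p \<le> A\<integral>u\<^sup>p\<close>.\<close>

lemma trig_P_bound_positive:
  assumes p: "1 < p" "p \<le> 2"
  obtains C where "C \<ge> 0" "\<And>u \<epsilon>. u \<in> trig_polys UNIV \<Longrightarrow> conj_fun u = u \<Longrightarrow> \<epsilon> > 0 \<Longrightarrow>
    AE t in circle_measure. \<epsilon> \<le> Re (rp u t) \<Longrightarrow> Lp_norm p (trig_P u) \<le> C * Lp_norm p u"
proof -
  interpret conjugate_exponents p "p / (p - 1)"
    by unfold_locales (use p in \<open>auto simp: field_simps\<close>)
  have p0: "0 < p" "0 \<le> p" "1 \<le> p" using p by auto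
  obtain A B where AB: "A \<ge> 0" "B \<ge> 0" "\<And>w. 0 < Re w \<Longrightarrow> cmod w powr p \<le> A * Re w powr p - B * Re (w powr of_real p)"
    using cmod_powr_inequality[OF p] by blast
  define C where "C = (A powr (1 / p) + 1)"
  have "Lp_norm p (trig_P u) \<le> C * Lp_norm p u"
    if u: "u \<in> trig_polys UNIV" and real: "conj_fun u = u" and \<epsilon>: "\<epsilon> > 0"
      and pos: "AE t in circle_measure. \<epsilon> \<le> Re (rp u t)" for u \<epsilon>
  proof -
    define u0 where "u0 = fourier u 0"
    define G where "G = cscale 2 (trig_P u) - cscale u0 1"
    have G: "G \<in> trig_polys {0..}" unfolding G_def
      by (intro trig_polys_diff trig_polys_cscale trig_P_mem[OF u] trig_polys_one) auto
    have GU: "G \<in> trig_polys UNIV" using G by (rule trig_polys_UNIV)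
    have fu: "fourier u (- n) = cnj (fourier u n)" for n
      using fourier_conj[of u "-n"] real by simp
    have fG: "fourier G n = (if n > 0 then 2 * fourier u n else if n = 0 then u0 else 0)" for n
      unfolding G_def
      by (subst fourier_diff) (auto simp: fourier_trig_P[OF u] fourier_one u0_def
          intro!: Lp_cscale trig_polys_L1[OF trig_P_UNIV[OF u]])
    have sum: "G + conj_fun G = cscale 2 u"
    proof (rule fourier_inject)
      show "fourier (G + conj_fun G) n = fourier (cscale 2 u) n" for n
        using fu[of n] fu[of 0] by (subst fourier_add) (auto simp: fG u0_def trig_polys_L1[OF GU])
    qed (use trig_polys_L1 GU u in \<open>auto intro!: Lp_add Lp_cscale\<close>)
    define S where "S = {k. fourier G k \<noteq> 0}"
    have finS: "finite S" and S0: "\<And>k. k \<in> S \<Longrightarrow> 0 \<le> k"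
      using trig_polys_finite_support[OF G] fG by (auto simp: S_def split: if_splits)
    define F where "F z = (\<Sum>k\<in>S. fourier G k * z ^ nat k)" for z :: complex
    have F_G: "AE t in circle_measure. rp G t = F t"
    proof -
      have "(\<Sum>k\<in>S. fourier G k * t powi k) = F t" for t
        unfolding F_def by (intro sum.cong refl) (use S0 in \<open>auto simp: power_int_def\<close>)
      then show ?thesis using trig_polys_AE_sum[OF G] by (simp add: S_def)
    qed
    have F0: "F 0 = u0"
    proof -
      have "F 0 = (\<Sum>k\<in>S. if k = 0 then u0 else 0)"
        unfolding F_def by (intro sum.cong refl) (use S0 in \<open>auto simp: fG power_0_left\<close>)
      also have "\<dots> = u0" using finS by (auto simp: S_def fG)
      finally show ?thesis .
    qed
    have contF: "continuous_on X F" for X unfolding F_def by (intro continuous_intros)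
    have holF: "F holomorphic_on X" for X unfolding F_def by (intro holomorphic_intros)
    have F_u: "AE t in circle_measure. Re (F t) = Re (rp u t) \<and> Im (rp u t) = 0"
      using F_G rp_plus[of G "conj_fun G", unfolded sum] rp_conj[of G] rp_cscale[of 2 u] rp_conj[of u, unfolded real]
      by eventually_elim (auto simp: complex_eq_iff)
    have "\<epsilon> \<le> Re (F t)" if "cmod t = 1" for t
    proof (rule circle_AE_continuous_ge[OF _ _ _ that])
      show "continuous_on (sphere 0 1) (\<lambda>t. Re (F t))" by (intro continuous_intros contF)
      show "(\<lambda>t. Re (F t)) \<in> borel_measurable borel" by (intro borel_measurable_continuous_onI continuous_intros contF)
      show "AE t in circle_measure. \<epsilon> \<le> Re (F t)" using F_u pos by eventually_elim simp
    qed
    then have sph: "cmod (exp (- F z)) \<le> exp (- \<epsilon>)" if "z \<in> frontier (cball 0 1)" for z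
      using that by (simp add: frontier_cball norm_exp_eq_Re)
    have "cmod (exp (- F z)) \<le> exp (- \<epsilon>)" if "z \<in> cball 0 1" for z
    proof (rule maximum_modulus_frontier[of "\<lambda>z. exp (- F z)" "cball 0 1"])
      show "(\<lambda>z. exp (- F z)) holomorphic_on interior (cball 0 1)" by (intro holomorphic_intros holF)
      show "continuous_on (closure (cball 0 1)) (\<lambda>z. exp (- F z))" by (intro continuous_intros contF)
    qed (use that sph in auto)
    then have ReF: "\<epsilon> \<le> Re (F z)" if "z \<in> cball 0 1" for z
      using that by (simp add: norm_exp_eq_Re)
    then have nonpos: "F z \<notin> \<real>\<^sub>\<le>\<^sub>0" if "z \<in> cball 0 1" for z
      using that \<epsilon> by (force simp: complex_nonpos_Reals_iff)
    have ReF_pos: "0 < Re (F z)" if "z \<in> cball 0 1" for z using ReF[OF that] \<epsilon> by linarith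
    define H where "H = (\<lambda>z. indicator (cball 0 1) z *\<^sub>R (F z powr of_real p))"
    have contp: "continuous_on (cball 0 1) (\<lambda>z. F z powr of_real p)"
      using ReF_pos by (intro continuous_intros contF) force+
    have "(LINT t|circle_measure. H t) = H 0"
    proof (rule circle_mean_value)
      show "continuous_on (cball 0 1) H"
        by (rule continuous_on_eq[OF contp]) (simp add: H_def)
      have "(\<lambda>z. F z powr of_real p) holomorphic_on ball 0 1"
        using nonpos by (intro holomorphic_intros holF) auto
      then show "H holomorphic_on ball 0 1"
        by (rule holomorphic_transform) (simp add: H_def)
      show "H \<in> borel_measurable borel" unfolding H_def
        by (rule borel_measurable_continuous_on_indicator[OF _ contp]) simp
    qed
    also have "H 0 = u0 powr of_real p" using F0 by (simp add: H_def)
    finally have mean: "(LINT t|circle_measure. H t) = u0 powr of_real p" .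
    have u0_real: "Im u0 = 0" using fu[of 0] by (simp add: u0_def complex_eq_iff)
    have "0 \<le> Re (u0 powr of_real p)"
    proof -
      have "u0 = of_real (Re u0)" using u0_real by (simp add: complex_eq_iff)
      moreover have "Re u0 \<ge> 0" using ReF[of 0] \<epsilon> F0 by simp
      ultimately have "u0 powr of_real p = of_real (Re u0 powr p)" using powr_of_real by metis
      then show ?thesis by simp
    qed
    then have meanRe: "0 \<le> Re (LINT t|circle_measure. H t)" using mean by simp
    have H_int: "integrable circle_measure H"
    proof -
      have Hb: "H \<in> borel_measurable borel" unfolding H_def
        by (rule borel_measurable_continuous_on_indicator[OF _ contp]) simp
      have "compact ((\<lambda>z. F z powr of_real p) ` sphere 0 1)"
        by (rule compact_continuous_image[OF continuous_on_subset[OF contp]]) auto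
      then obtain M where M: "\<And>z. z \<in> sphere 0 1 \<Longrightarrow> cmod (F z powr of_real p) \<le> M"
        by (meson bounded_iff compact_imp_bounded imageI)
      show ?thesis by (rule circle_integrable_bounded[OF Hb, of M]) (use M in \<open>auto simp: H_def\<close>)
    qed
    have uL: "u \<in> Lp p" using trig_polys_Lp[OF p0(2) u] .
    have GL: "G \<in> Lp p" using trig_polys_Lp[OF p0(2) GU] .
    have "(LINT t|circle_measure. cmod (rp G t) powr p) \<le> (LINT t|circle_measure. A * cmod (rp u t) powr p - B * Re (H t))"
    proof (rule integral_mono_AE)
      show "AE t in circle_measure. cmod (rp G t) powr p \<le> A * cmod (rp u t) powr p - B * Re (H t)"
        using F_u F_G pos circle_AE_norm
      proof eventually_elim
        case (elim t)
        have "cmod (rp u t) = Re (rp u t)" using elim \<epsilon> by (simp add: cmod_def)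
        moreover have "H t = F t powr of_real p" using elim by (simp add: H_def)
        ultimately show ?case using AB(3)[of "F t"] elim \<epsilon> by simp
      qed
    qed (use uL GL integrable_Re[OF H_int] in \<open>auto simp: in_Lp_iff\<close>)
    also have "\<dots> = A * (LINT t|circle_measure. cmod (rp u t) powr p) - B * Re (LINT t|circle_measure. H t)"
      using uL integrable_Re[OF H_int] integral_Re[OF H_int] by (simp add: in_Lp_iff)
    also have "\<dots> \<le> A * (LINT t|circle_measure. cmod (rp u t) powr p)"
      using AB(2) meanRe by simp
    finally have nG: "Lp_norm p G \<le> A powr (1 / p) * Lp_norm p u"
      using Lp_norm_le_I[OF p0(1) uL AB(1)] by blast
    have nu0: "cmod u0 \<le> Lp_norm p u"
      unfolding u0_def using fourier_bound[OF trig_polys_L1[OF u], of 0] Lp_norm_1_le[OF uL] by linarith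
    have "Lp_norm p (cscale 2 (trig_P u)) = Lp_norm p (G + cscale u0 1)" by (simp add: G_def)
    also have "\<dots> \<le> Lp_norm p G + Lp_norm p (cscale u0 1)"
      by (rule Lp_norm_triangle) (use p0 GL in \<open>auto intro: Lp_cscale\<close>)
    also have "Lp_norm p (cscale u0 1) = cmod u0" using p0 by (simp add: Lp_norm_cscale)
    finally have "2 * Lp_norm p (trig_P u) \<le> C * Lp_norm p u"
      using nG nu0 p0 by (simp add: Lp_norm_cscale C_def distrib_right)
    then show ?thesis using Lp_norm_nonneg[of p "trig_P u"] by linarith
  qed
  moreover have "C \<ge> 0" by (simp add: C_def)
  ultimately show thesis using that by blast
qed

lemma Lp_norm_le_add_const:
  assumes p: "1 \<le> p" and f: "f \<in> Lp p" and g: "g \<in> Lp p" and c: "0 \<le> c"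
    and le: "AE t in circle_measure. cmod (rp f t) \<le> cmod (rp g t) + c"
  shows "Lp_norm p f \<le> Lp_norm p g + c"
proof -
  define h where "h = abs_tfun (\<lambda>t. of_real (cmod (rp g t)))"
  have h: "AE t in circle_measure. rp h t = of_real (cmod (rp g t))"
    unfolding h_def by (rule rp_abs) simp
  have hL: "h \<in> Lp p"
    by (rule Lp_I[OF Lp_integrable[OF g]]) (use h in \<open>auto elim: eventually_mono\<close>)
  have "Lp_norm p f \<le> Lp_norm p (h + cscale (of_real c) 1)"
  proof (rule Lp_norm_mono_AE)
    show "AE t in circle_measure. cmod (rp f t) \<le> cmod (rp (h + cscale (of_real c) 1) t)"
      using le h rp_plus[of h "cscale (of_real c) 1"] rp_cscale[of "of_real c" 1] rp_one
    proof eventually_elim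
      case (elim t)
      then have "rp (h + cscale (of_real c) 1) t = of_real (cmod (rp g t) + c)" by simp
      then show ?case using elim(1) c by (simp only: norm_of_real)
    qed
  qed (use p f hL in \<open>auto intro!: Lp_add Lp_cscale\<close>)
  also have "\<dots> \<le> Lp_norm p h + Lp_norm p (cscale (of_real c) 1)"
    by (rule Lp_norm_triangle) (use p hL in \<open>auto intro: Lp_cscale\<close>)
  also have "Lp_norm p h \<le> Lp_norm p g"
    by (rule Lp_norm_mono_AE) (use p hL g h in \<open>auto elim: eventually_mono\<close>)
  also have "Lp_norm p (cscale (of_real c) 1) = c" using p c by (simp add: Lp_norm_cscale)
  finally show ?thesis by simp
qed

lemma rp_real_AE: "conj_fun u = u \<Longrightarrow> AE t in circle_measure. rp u t = of_real (Re (rp u t))"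
  using rp_conj[of u] by (auto simp: complex_eq_iff elim!: eventually_mono)

text \<open>A real trigonometric polynomial is the difference of two positive ones of comparable norm:
  \<open>h - (h - u)\<close>, where \<open>h\<close> is a polynomial slightly above the positive part of \<open>u\<close>.\<close>

lemma trig_P_bound_real:
  assumes p: "1 < p" "p \<le> 2"
  obtains C where "C \<ge> 0" "\<And>u. u \<in> trig_polys UNIV \<Longrightarrow> conj_fun u = u \<Longrightarrow> Lp_norm p (trig_P u) \<le> C * Lp_norm p u"
proof -
  have p0: "0 < p" "0 \<le> p" "1 \<le> p" using p by auto
  obtain C where C: "C \<ge> 0" "\<And>u \<epsilon>. u \<in> trig_polys UNIV \<Longrightarrow> conj_fun u = u \<Longrightarrow> \<epsilon> > 0 \<Longrightarrow>
    AE t in circle_measure. \<epsilon> \<le> Re (rp u t) \<Longrightarrow> Lp_norm p (trig_P u) \<le> C * Lp_norm p u"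
    using trig_P_bound_positive[OF p] by blast
  have "Lp_norm p (trig_P u) \<le> (2 * C) * Lp_norm p u" if u: "u \<in> trig_polys UNIV" and real: "conj_fun u = u" for u
  proof -
    define U where "U t = (\<Sum>k | fourier u k \<noteq> 0. fourier u k * t powi k)" for t
    have uU: "AE t in circle_measure. rp u t = U t" using trig_polys_AE_sum[OF u] by (simp add: U_def)
    have contU: "continuous_on (sphere 0 1) U" unfolding U_def
      by (intro continuous_intros) auto
    have uL: "u \<in> Lp p" using trig_polys_Lp[OF p0(2) u] .
    have "Lp_norm p (trig_P u) - (2 * C) * Lp_norm p u \<le> \<eta> * (6 * C)" if \<eta>: "\<eta> > 0" for \<eta>
    proof -
      \<comment> \<open>Approximation within \<open>\<eta>\<close> of a function \<open>2\<eta>\<close> above the positive part stays between \<open>\<eta>\<close> and \<open>3\<eta>\<close> above it.\<close>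
      have "continuous_on (sphere 0 1) (\<lambda>t. max (Re (U t)) 0 + 2 * \<eta>)"
        by (intro continuous_intros contU)
      then obtain g where g: "real_polynomial_function g"
          "\<And>t. t \<in> sphere 0 1 \<Longrightarrow> \<bar>(max (Re (U t)) 0 + 2 * \<eta>) - g t\<bar> < \<eta>"
        using Stone_Weierstrass_real_polynomial_function[OF compact_sphere[of 0 1] _ \<eta>] by metis
      have gb: "g \<in> borel_measurable borel"
        using g(1) by (auto intro!: borel_measurable_continuous_onI continuous_on_polymonial_function simp: real_polynomial_function_eq)
      define h where "h = abs_tfun (\<lambda>t. of_real (g t))"
      have h: "h \<in> trig_polys UNIV" unfolding h_def by (rule real_polynomial_function_trig[OF g(1)])
      have hg: "AE t in circle_measure. rp h t = of_real (g t)" unfolding h_def using gb by (intro rp_abs) auto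
      have hL: "h \<in> Lp p" using trig_polys_Lp[OF p0(2) h] .
      have hreal: "conj_fun h = h"
        by (rule tfun_eqI) (use hg rp_conj[of h] in \<open>auto elim: eventually_elim2\<close>)
      have bounds: "AE t in circle_measure. \<eta> \<le> Re (rp h t) \<and> \<eta> \<le> Re (rp (h - u) t)
         \<and> cmod (rp h t) \<le> cmod (rp u t) + 3 * \<eta> \<and> cmod (rp (h - u) t) \<le> cmod (rp u t) + 3 * \<eta>"
        using hg uU rp_real_AE[OF real] rp_minus[of h u] circle_AE_norm
      proof eventually_elim
        case (elim t)
        define y where "y = Re (rp u t)"
        have y: "rp u t = of_real y" "Re (U t) = y" using elim by (auto simp: y_def)
        have gy: "max y 0 + \<eta> < g t" "g t < max y 0 + 3 * \<eta>"
          using g(2)[of t] elim(5) unfolding y(2) by (auto simp: abs_less_iff)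
        have hu: "rp (h - u) t = of_real (g t - y)" unfolding elim(4) elim(1) y(1) by simp
        have "Re (rp h t) = g t" "cmod (rp h t) = \<bar>g t\<bar>" unfolding elim(1) by simp_all
        moreover have "Re (rp (h - u) t) = g t - y" "cmod (rp (h - u) t) = \<bar>g t - y\<bar>" unfolding hu norm_of_real by simp_all
        moreover have "cmod (rp u t) = \<bar>y\<bar>" unfolding y(1) by simp
        ultimately show ?case using gy \<eta> by (simp only:) (auto simp: max_def abs_if split: if_splits)
      qed
      have "Lp_norm p (trig_P u) = Lp_norm p (trig_P h - trig_P (h - u))"
        using u h by (simp add: trig_P_diff trig_polys_diff)
      also have "\<dots> \<le> Lp_norm p (trig_P h) + Lp_norm p (- trig_P (h - u))"
      proof -
        have "trig_P h \<in> Lp p" "trig_P (h - u) \<in> Lp p"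
          using u h by (auto intro!: trig_polys_Lp[OF p0(2)] trig_P_UNIV trig_polys_diff)
        from Lp_norm_triangle[OF p0(3) this(1) Lp_uminus[OF this(2)]] show ?thesis by simp
      qed
      also have "\<dots> \<le> C * Lp_norm p h + C * Lp_norm p (h - u)"
      proof (intro add_mono)
        show "Lp_norm p (trig_P h) \<le> C * Lp_norm p h"
          by (rule C(2)[OF h hreal \<eta>]) (use bounds in \<open>auto elim: eventually_mono\<close>)
        show "Lp_norm p (- trig_P (h - u)) \<le> C * Lp_norm p (h - u)"
          unfolding Lp_norm_uminus
          by (rule C(2)[OF trig_polys_diff[OF h u] _ \<eta>]) (use bounds hreal real in \<open>auto elim: eventually_mono\<close>)
      qed
      also have "\<dots> \<le> C * (Lp_norm p u + 3 * \<eta>) + C * (Lp_norm p u + 3 * \<eta>)"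
        by (intro add_mono mult_left_mono Lp_norm_le_add_const C(1) p0 Lp_diff hL uL)
          (use bounds \<eta> in \<open>auto elim: eventually_mono\<close>)
      finally show ?thesis by (simp add: algebra_simps)
    qed
    from le_zero_if_le_eps_mult[OF this] show ?thesis by simp
  qed
  then show thesis using C(1) that[of "2 * C"] by simp
qed

lemma trig_P_bound_le_2:
  assumes p: "1 < p" "p \<le> 2"
  obtains C where "C \<ge> 0" "\<And>u. u \<in> trig_polys UNIV \<Longrightarrow> Lp_norm p (trig_P u) \<le> C * Lp_norm p u"
proof -
  have p0: "0 < p" "0 \<le> p" "1 \<le> p" using p by auto
  obtain C where C: "C \<ge> 0" "\<And>u. u \<in> trig_polys UNIV \<Longrightarrow> conj_fun u = u \<Longrightarrow> Lp_norm p (trig_P u) \<le> C * Lp_norm p u"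
    using trig_P_bound_real[OF p] by blast
  have "Lp_norm p (trig_P u) \<le> (2 * C) * Lp_norm p u" if u: "u \<in> trig_polys UNIV" for u
  proof -
    define u1 u2 where "u1 = cscale (1/2) (u + conj_fun u)" and "u2 = cscale (-\<i>/2) (u - conj_fun u)"
    have uL: "u \<in> Lp p" using trig_polys_Lp[OF p0(2) u] .
    have mem: "u1 \<in> trig_polys UNIV" "u2 \<in> trig_polys UNIV" unfolding u1_def u2_def
      by (intro trig_polys_cscale trig_polys_add trig_polys_diff trig_polys_conj u)+
    have real: "conj_fun u1 = u1" "conj_fun u2 = u2"
      unfolding u1_def u2_def by (simp_all add: cscale_add cscale_diff add.commute)
    have n1: "Lp_norm p u1 \<le> Lp_norm p u"
      unfolding u1_def using p0 Lp_norm_triangle[OF p0(3), of u "conj_fun u"] uL by (simp add: Lp_norm_cscale)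
    have n2: "Lp_norm p u2 \<le> Lp_norm p u"
      unfolding u2_def using p0 Lp_norm_triangle[OF p0(3), of u "- conj_fun u"] uL
      by (simp add: Lp_norm_cscale Lp_uminus norm_divide)
    have half: "cscale (1/2) f + cscale (1/2) f = f" for f
      using cvs.scale_left_distrib[of "1/2" "1/2" f] by simp
    have "u1 + cscale \<i> u2 = u"
    proof -
      have "cscale \<i> u2 = cscale (1/2) (u - conj_fun u)" by (simp add: u2_def)
      then have "u1 + cscale \<i> u2 = cscale (1/2) u + cscale (1/2) u"
        by (simp add: u1_def cscale_add cscale_diff)
      then show ?thesis by (simp only: half)
    qed
    then have "Lp_norm p (trig_P u) = Lp_norm p (trig_P u1 + cscale \<i> (trig_P u2))"
      using mem by (metis trig_P_add trig_P_cscale trig_polys_cscale)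
    also have "\<dots> \<le> Lp_norm p (trig_P u1) + Lp_norm p (cscale \<i> (trig_P u2))"
      by (rule Lp_norm_triangle[OF p0(3)]) (use mem p0 in \<open>auto intro!: Lp_cscale trig_polys_Lp trig_P_UNIV\<close>)
    also have "Lp_norm p (cscale \<i> (trig_P u2)) = Lp_norm p (trig_P u2)" using p0 by (simp add: Lp_norm_cscale)
    also have "Lp_norm p (trig_P u1) + Lp_norm p (trig_P u2) \<le> C * Lp_norm p u + C * Lp_norm p u"
      using mult_left_mono[OF n1 C(1)] mult_left_mono[OF n2 C(1)] C(2)[OF mem(1) real(1)] C(2)[OF mem(2) real(2)] by linarith
    finally show ?thesis by simp
  qed
  then show thesis using C(1) that[of "2 * C"] by simp
qed

context conjugate_exponents
begin

lemma pairing_trig: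
  assumes x: "x \<in> trig_polys K" and y: "y \<in> Lp 1"
  shows "pairing x y = (\<Sum>k | fourier x k \<noteq> 0. fourier x k * cnj (fourier y k))"
proof -
  have "pairing (\<Sum>k\<in>S. cscale (c k) (tpow k)) y = (\<Sum>k\<in>S. c k * cnj (fourier y k))" if "finite S" for S c
    using that
  proof induction
    case (insert k S)
    have "(\<Sum>k\<in>S. cscale (c k) (tpow k)) \<in> Linf"
      using fourier_sum_tpow(2)[OF insert.hyps(1)] trig_polys_Linf by blast
    then show ?case using insert y
      by (simp add: pairing_def distrib_right fourier_add Linf_mult_Lp Lp_cscale)
  qed (simp add: pairing_def)
  from this[OF trig_polys_finite_support[OF x]] show ?thesis using trig_polys_expand[OF x] by metis
qed

lemma pairing_trig_P:
  assumes s: "s \<in> trig_polys UNIV" and h: "h \<in> trig_polys UNIV"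
  shows "pairing (trig_P s) h = pairing s (trig_P h)"
proof -
  have "pairing (trig_P s) h = (\<Sum>k | fourier (trig_P s) k \<noteq> 0. fourier (trig_P s) k * cnj (fourier h k))"
    by (rule pairing_trig[OF trig_P_UNIV[OF s] trig_polys_L1[OF h]])
  also have "\<dots> = (\<Sum>k | fourier s k \<noteq> 0. fourier s k * cnj (fourier (trig_P h) k))"
    by (rule sum.mono_neutral_cong_left)
      (use trig_polys_finite_support[OF s] fourier_trig_P[OF s] fourier_trig_P[OF h] in \<open>auto split: if_splits\<close>)
  also have "\<dots> = pairing s (trig_P h)"
    by (rule pairing_trig[OF s trig_polys_L1[OF trig_P_UNIV[OF h]], symmetric])
  finally show ?thesis .
qed

text \<open>For \<open>p > 2\<close> the norm of \<open>g = Ps\<close> is tested against its dual element \<open>k \<in> L\<^sup>q\<close>. A polynomial \<open>h\<close>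
  close to \<open>k\<close> lets the projection move to the other side, \<open>\<langle>Ps, h\<rangle> = \<langle>s, Ph\<rangle>\<close>, where \<open>q < 2\<close> applies.\<close>

theorem trig_P_bound:
  obtains C where "C \<ge> 0" "\<And>s. s \<in> trig_polys UNIV \<Longrightarrow> Lp_norm p (trig_P s) \<le> C * Lp_norm p s"
proof (cases "p \<le> 2")
  case True
  then show thesis using trig_P_bound_le_2[OF p_gt_1] that by blast
next
  case False
  interpret qp: conjugate_exponents q p by (rule conjugate_exponents_sym)
  have "q \<le> 2"
  proof -
    have "1 / p < 1 / 2" using False p_gt_1 by (intro divide_strict_left_mono) auto
    then have "1 / 2 < 1 / q" using pq by linarith
    then show ?thesis using q_gt_1 by (simp add: divide_simps split: if_splits)
  qed
  then obtain C where C: "C \<ge> 0" "\<And>s. s \<in> trig_polys UNIV \<Longrightarrow> Lp_norm q (trig_P s) \<le> C * Lp_norm q s"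
    using trig_P_bound_le_2[OF q_gt_1] by blast
  have "Lp_norm p (trig_P s) \<le> C * Lp_norm p s" if s: "s \<in> trig_polys UNIV" for s
  proof (cases "Lp_norm p (trig_P s) = 0")
    case False
    define g where "g = trig_P s"
    define k where "k = dual_elt p g"
    have g: "g \<in> trig_polys UNIV" using trig_P_UNIV[OF s] by (simp add: g_def)
    have gL: "g \<in> Lp p" and sL: "s \<in> Lp p" using trig_polys_Lp g s p_gt_1 by auto
    have kL: "k \<in> Lp q" unfolding k_def by (rule dual_elt_Lq[OF gL])
    have g0: "Lp_norm p g > 0" using False Lp_norm_nonneg[of p g] by (auto simp: g_def less_le)
    have "Lp_norm p g powr p - C * Lp_norm p s * Lp_norm q k \<le> \<eta> * (Lp_norm p g + C * Lp_norm p s)" if \<eta>: "\<eta> > 0" for \<eta>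
    proof -
      obtain h where h: "h \<in> trig_polys UNIV" "Lp_norm q (k - h) < \<eta>" using qp.trig_polys_dense[OF kL \<eta>] by blast
      have hL: "h \<in> Lp q" using trig_polys_Lp h(1) q_gt_1 by auto
      have PhL: "trig_P h \<in> Lp q" using trig_polys_Lp trig_P_UNIV[OF h(1)] q_gt_1 by auto
      have khL: "k - h \<in> Lp q" using kL hL q_gt_1 by (intro Lp_diff) auto
      have nh: "Lp_norm q h \<le> Lp_norm q k + \<eta>"
        using Lp_norm_triangle[of q k "h - k"] Lp_norm_minus_commute[of q h k] Lp_diff[OF _ hL kL] kL h(2) q_gt_1 by simp
      have "pairing g k = pairing g (k - h) + pairing g h"
      proof -
        have "g * conj_fun k = g * conj_fun (k - h) + g * conj_fun h" by (simp add: algebra_simps)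
        then show ?thesis
          using fourier_add[OF Holder(1)[OF gL, of "conj_fun (k - h)"] Holder(1)[OF gL, of "conj_fun h"], of 0] khL hL
          unfolding pairing_def Lp_conj by simp
      qed
      also have "pairing g h = pairing s (trig_P h)" unfolding g_def by (rule pairing_trig_P[OF s h(1)])
      finally have "cmod (pairing g k) \<le> cmod (pairing g (k - h)) + cmod (pairing s (trig_P h))"
        by (simp add: norm_triangle_ineq)
      also have "\<dots> \<le> Lp_norm p g * Lp_norm q (k - h) + Lp_norm p s * Lp_norm q (trig_P h)"
        by (intro add_mono pairing_bound gL khL sL PhL)
      also have "\<dots> \<le> Lp_norm p g * \<eta> + Lp_norm p s * (C * (Lp_norm q k + \<eta>))"
      proof (intro add_mono mult_left_mono Lp_norm_nonneg)
        show "Lp_norm q (trig_P h) \<le> C * (Lp_norm q k + \<eta>)"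
          using C(2)[OF h(1)] mult_left_mono[OF nh C(1)] by linarith
      qed (use h(2) in simp)
      finally show ?thesis by (simp add: k_def pairing_dual_elt algebra_simps)
    qed
    from le_zero_if_le_eps_mult[OF this]
    have le: "Lp_norm p g powr p \<le> C * Lp_norm p s * Lp_norm q k" by simp
    have "Lp_norm q k = (Lp_norm q k powr q) powr (1 / q)" using q_gt_1 by (simp add: powr_powr)
    also have "\<dots> = Lp_norm p g powr (p / q)" unfolding k_def dual_elt_norm by (simp add: powr_powr)
    also have "p / q = p - 1" using p_gt_1 q_gt_1 exponent_eqs by (simp add: field_simps)
    finally have "Lp_norm p g powr (p - 1) * Lp_norm p g \<le> C * Lp_norm p s * Lp_norm p g powr (p - 1)"
      using le powr_mult_base[of "Lp_norm p g" "p - 1"] by (simp add: mult.commute)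
    then show ?thesis using g0 by (simp add: g_def mult_ac)
  qed (use C(1) in simp)
  then show thesis using C(1) that by blast
qed

lemma fourier_tendsto:
  assumes "\<And>n. X n \<in> Lp p" "f \<in> Lp p" "(\<lambda>n. Lp_norm p (X n - f)) \<longlonglongrightarrow> 0"
  shows "(\<lambda>n. fourier (X n) k) \<longlonglongrightarrow> fourier f k"
proof -
  have "cmod (fourier (X n) k - fourier f k) \<le> Lp_norm p (X n - f)" for n
  proof -
    have "X n - f \<in> Lp p" using assms p_gt_1 by (intro Lp_diff) auto
    then show ?thesis
      using fourier_bound[of "X n - f" k] Lp_norm_1_le[of "X n - f"] Lp_subset_L1 assms(1)[of n] assms(2)
      by (simp add: fourier_diff)
  qed
  then have "(\<lambda>n. fourier (X n) k - fourier f k) \<longlonglongrightarrow> 0"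
    by (intro Lim_null_comparison[OF always_eventually assms(3)]) auto
  then show ?thesis by (simp add: LIM_zero_iff)
qed

lemma riesz_extension:
  obtains C where "C \<ge> 0" "\<And>f. f \<in> Lp p \<Longrightarrow>
    \<exists>g\<in>Lp p. (\<forall>n. fourier g n = (if 0 \<le> n then fourier f n else 0)) \<and> Lp_norm p g \<le> C * Lp_norm p f"
proof -
  obtain C where C: "C \<ge> 0" "\<And>s. s \<in> trig_polys UNIV \<Longrightarrow> Lp_norm p (trig_P s) \<le> C * Lp_norm p s"
    using trig_P_bound by blast
  have p0: "0 \<le> p" "1 \<le> p" using p_gt_1 by auto
  have "\<exists>g\<in>Lp p. (\<forall>n. fourier g n = (if 0 \<le> n then fourier f n else 0)) \<and> Lp_norm p g \<le> C * Lp_norm p f" if f: "f \<in> Lp p" for f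
  proof -
    have "\<exists>s. s \<in> trig_polys UNIV \<and> Lp_norm p (f - s) < 1 / real (Suc n)" for n
      using trig_polys_dense[OF f, of "1 / real (Suc n)"] by auto
    then obtain s where s: "\<And>n. s n \<in> trig_polys UNIV" "\<And>n. Lp_norm p (f - s n) < 1 / real (Suc n)" by metis
    have sL: "s n \<in> Lp p" for n using trig_polys_Lp[OF p0(1) s(1)] .
    have PL: "trig_P (s n) \<in> Lp p" for n using trig_polys_Lp[OF p0(1) trig_P_UNIV[OF s(1)]] .
    have lim1: "(\<lambda>n. 1 / real (Suc n)) \<longlonglongrightarrow> 0" by (rule LIMSEQ_Suc[OF lim_1_over_n])
    have sf: "(\<lambda>n. Lp_norm p (s n - f)) \<longlonglongrightarrow> 0"
      using s(2) by (intro Lim_null_comparison[OF always_eventually lim1])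
        (auto simp: Lp_norm_minus_commute[of p _ f] intro: less_imp_le)
    have "\<exists>N. \<forall>i\<ge>N. \<forall>j\<ge>N. Lp_norm p (trig_P (s i) - trig_P (s j)) < e" if e: "e > 0" for e
    proof -
      have "(\<lambda>n. C * (1 / real (Suc n))) \<longlonglongrightarrow> C * 0" by (intro tendsto_intros lim1)
      then have "\<forall>\<^sub>F n in sequentially. C * (1 / real (Suc n)) < e / 2"
        using e by (intro order_tendstoD) auto
      then obtain N where N: "\<And>n. n \<ge> N \<Longrightarrow> C * (1 / real (Suc n)) < e / 2" by (auto simp: eventually_sequentially)
      have "Lp_norm p (trig_P (s i) - trig_P (s j)) < e" if "i \<ge> N" "j \<ge> N" for i j
      proof -
        have "Lp_norm p (trig_P (s i) - trig_P (s j)) \<le> C * Lp_norm p (s i - s j)"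
          using C(2)[OF trig_polys_diff[OF s(1) s(1)]] s(1) by (simp add: trig_P_diff)
        also have "\<dots> \<le> C * (1 / real (Suc i) + 1 / real (Suc j))"
          using Lp_norm_triangle_diff[OF p0(2) sL[of i] f sL[of j]] s(2)[of i] s(2)[of j] Lp_norm_minus_commute[of p "s i" f]
          by (intro mult_left_mono C(1)) simp
        also have "\<dots> < e" using N[OF that(1)] N[OF that(2)] unfolding distrib_left by linarith
        finally show ?thesis .
      qed
      then show ?thesis by blast
    qed
    from Lp_complete[OF p_gt_1 PL this]
    obtain g where g: "g \<in> Lp p" "(\<lambda>n. Lp_norm p (trig_P (s n) - g)) \<longlonglongrightarrow> 0" by blast
    have "fourier g n = (if 0 \<le> n then fourier f n else 0)" for n
    proof (rule LIMSEQ_unique[OF fourier_tendsto[OF PL g, of n]])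
      show "(\<lambda>k. fourier (trig_P (s k)) n) \<longlonglongrightarrow> (if 0 \<le> n then fourier f n else 0)"
        using fourier_tendsto[OF sL f sf, of n] by (simp add: fourier_trig_P[OF s(1)])
    qed
    moreover have "Lp_norm p g \<le> C * Lp_norm p f"
    proof (rule LIMSEQ_le_const)
      show "(\<lambda>n. Lp_norm p (trig_P (s n) - g) + C * (Lp_norm p f + 1 / real (Suc n))) \<longlonglongrightarrow> C * Lp_norm p f"
        using tendsto_add[OF g(2) tendsto_mult[OF tendsto_const tendsto_add[OF tendsto_const lim1]], of C "Lp_norm p f"] by simp
      have "Lp_norm p g \<le> Lp_norm p (trig_P (s n) - g) + C * (Lp_norm p f + 1 / real (Suc n))" for n
      proof -
        have "Lp_norm p g \<le> Lp_norm p (g - trig_P (s n)) + Lp_norm p (trig_P (s n))"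
          using Lp_norm_triangle[OF p0(2) Lp_diff[OF p0(1) g(1) PL[of n]] PL[of n]] by simp
        moreover have "Lp_norm p (s n) \<le> Lp_norm p f + 1 / real (Suc n)"
          using Lp_norm_triangle[OF p0(2) Lp_diff[OF p0(1) sL[of n] f] f] s(2)[of n] Lp_norm_minus_commute[of p "s n" f] by simp
        then have "Lp_norm p (trig_P (s n)) \<le> C * (Lp_norm p f + 1 / real (Suc n))"
          using C(2)[OF s(1), of n] mult_left_mono[OF _ C(1)] order_trans by blast
        ultimately show ?thesis using Lp_norm_minus_commute[of p g] by simp
      qed
      then show "\<exists>N. \<forall>n\<ge>N. Lp_norm p g \<le> Lp_norm p (trig_P (s n) - g) + C * (Lp_norm p f + 1 / real (Suc n))" by blast
    qed
    ultimately show ?thesis using g(1) by blast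
  qed
  then show thesis using C(1) that by blast
qed

end

section \<open>Hardy spaces\<close>

lemma Hp_iff: "f \<in> Hp p \<longleftrightarrow> f \<in> Lp p \<and> (\<forall>n<0. fourier f n = 0)"
  by (simp add: Hp_def)

lemma Hp_Lp: "f \<in> Hp p \<Longrightarrow> f \<in> Lp p" by (simp add: Hp_iff)

lemma conj_Hp_iff: "f \<in> conj_Hp p \<longleftrightarrow> conj_fun f \<in> Hp p"
proof
  assume "f \<in> conj_Hp p"
  then show "conj_fun f \<in> Hp p" by (auto simp: conj_Hp_def Hp_iff)
next
  assume *: "conj_fun f \<in> Hp p"
  have "fourier f n = 0" if "n > 0" for n
  proof -
    have "\<forall>n<0. fourier (conj_fun f) n = 0" using * unfolding Hp_iff by blast
    then have "fourier (conj_fun f) (- n) = 0" using that by (simp del: fourier_conj)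
    then show ?thesis by simp
  qed
  with * show "f \<in> conj_Hp p" by (simp add: conj_Hp_def Hp_iff)
qed

text \<open>The range of the complementary projection \<open>Q\<close>.\<close>

definition Hp_minus :: "real \<Rightarrow> tfun set" where
  "Hp_minus p = {f \<in> Lp p. \<forall>n\<ge>0. fourier f n = 0}"

lemma Hp_minus_Lp: "f \<in> Hp_minus p \<Longrightarrow> f \<in> Lp p" by (simp add: Hp_minus_def)

lemma Lp_norm_tpow: "Lp_norm p (tpow k * f) = Lp_norm p f"
proof -
  have "(LINT t|circle_measure. cmod (rp (tpow k * f) t) powr p) = (LINT t|circle_measure. cmod (rp f t) powr p)"
  proof (rule integral_cong_AE)
    show "AE t in circle_measure. cmod (rp (tpow k * f) t) powr p = cmod (rp f t) powr p"
      using rp_times[of "tpow k" f] rp_tpow[of k] circle_AE_norm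
      by eventually_elim (simp add: norm_mult norm_power_int)
  qed auto
  then show ?thesis by (simp add: Lp_norm_eq)
qed

lemma trig_polys_Hp: "0 \<le> p \<Longrightarrow> s \<in> trig_polys {0..} \<Longrightarrow> s \<in> Hp p"
  by (auto simp: Hp_iff trig_polys_Lp trig_polys_fourier_outside)

lemma flip_J_Hp: "0 \<le> p \<Longrightarrow> flip_J f \<in> Hp_minus p \<longleftrightarrow> f \<in> Hp p"
proof -
  assume p: "0 \<le> p"
  have "(\<forall>n\<ge>0. fourier f (- n - 1) = 0) \<longleftrightarrow> (\<forall>n<0. fourier f n = 0)"
  proof (intro iffI allI impI)
    fix n :: int assume *: "\<forall>n\<ge>0. fourier f (- n - 1) = 0" and n: "n < 0"
    have "fourier f (- (- n - 1) - 1) = 0" by (rule *[rule_format]) (use n in simp)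
    then show "fourier f n = 0" by simp
  next
    fix n :: int assume *: "\<forall>n<0. fourier f n = 0" and n: "0 \<le> n"
    show "fourier f (- n - 1) = 0" by (rule *[rule_format]) (use n in simp)
  qed
  then show ?thesis using p by (simp add: Hp_minus_def Hp_iff Lp_flip_J)
qed

lemma flip_J_Hp_minus: "0 \<le> p \<Longrightarrow> flip_J f \<in> Hp p \<longleftrightarrow> f \<in> Hp_minus p"
  using flip_J_Hp[of p "flip_J f"] by simp

context conjugate_exponents
begin

interpretation qp: conjugate_exponents q p by (rule conjugate_exponents_sym)

lemma p_nonneg: "0 \<le> p" "0 < p" "1 \<le> p" using p_gt_1 by auto

lemma Hp_L1: "f \<in> Hp p \<Longrightarrow> f \<in> Lp 1"
  by (intro Lp_subset_L1 Hp_Lp)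

lemma Hp_zero [simp]: "0 \<in> Hp p" by (simp add: Hp_iff)
lemma Hp_one: "1 \<in> Hp p" by (simp add: Hp_iff fourier_one)
lemma Hp_add: "f \<in> Hp p \<Longrightarrow> g \<in> Hp p \<Longrightarrow> f + g \<in> Hp p"
  using Hp_L1 p_nonneg by (simp add: Hp_iff Lp_add fourier_add Lp_subset_L1)
lemma Hp_diff: "f \<in> Hp p \<Longrightarrow> g \<in> Hp p \<Longrightarrow> f - g \<in> Hp p"
  using Hp_L1 p_nonneg by (simp add: Hp_iff Lp_diff fourier_diff Lp_subset_L1)
lemma Hp_cscale: "f \<in> Hp p \<Longrightarrow> cscale z f \<in> Hp p"
  by (simp add: Hp_iff Lp_cscale)
lemma Hp_tpow_mult: "0 \<le> k \<Longrightarrow> f \<in> Hp p \<Longrightarrow> tpow k * f \<in> Hp p"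
  using p_nonneg by (simp add: Hp_iff Lp_tpow_mult)
lemma Hp_tpow_div: "fourier f 0 = 0 \<Longrightarrow> f \<in> Hp p \<Longrightarrow> tpow (-1) * f \<in> Hp p"
proof -
  assume f: "fourier f 0 = 0" "f \<in> Hp p"
  have "fourier f (n + 1) = 0" if "n < 0" for n
    using f that by (cases "n = -1") (auto simp: Hp_iff)
  then show ?thesis using f p_nonneg by (simp add: Hp_iff Lp_tpow_mult)
qed

lemma Hp_minus_cscale: "f \<in> Hp_minus p \<Longrightarrow> cscale z f \<in> Hp_minus p"
  by (simp add: Hp_minus_def Lp_cscale)

lemma Hp_closed:
  assumes X: "\<And>n. X n \<in> Hp p" and f: "f \<in> Lp p" and lim: "(\<lambda>n. Lp_norm p (X n - f)) \<longlonglongrightarrow> 0"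
  shows "f \<in> Hp p"
proof -
  have "fourier f n = 0" if "n < 0" for n
    using fourier_tendsto[OF Hp_Lp[OF X] f lim, of n] X that by (simp add: Hp_iff LIMSEQ_const_iff)
  then show ?thesis using f by (simp add: Hp_iff)
qed

lemma riesz_P_eqI:
  assumes g: "g \<in> Hp p" and eq: "\<And>n. n \<ge> 0 \<Longrightarrow> fourier g n = fourier f n"
  shows "riesz_P p f = g"
  unfolding riesz_P_def
proof (rule the_equality)
  fix h assume h: "h \<in> Hp p \<and> (\<forall>n\<ge>0. fourier h n = fourier f n)"
  show "h = g"
  proof (rule fourier_inject)
    show "fourier h n = fourier g n" for n using h g eq by (cases "n \<ge> 0") (auto simp: Hp_iff)
  qed (use h g Hp_L1 in auto)
qed (use assms in auto)

lemma
  assumes "f \<in> Lp p"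
  shows riesz_P_Hp: "riesz_P p f \<in> Hp p"
    and fourier_riesz_P: "fourier (riesz_P p f) n = (if 0 \<le> n then fourier f n else 0)"
proof -
  obtain g where g: "g \<in> Lp p" "\<forall>n. fourier g n = (if 0 \<le> n then fourier f n else 0)"
    using riesz_extension assms by metis
  then have "g \<in> Hp p" by (simp add: Hp_iff)
  then have "riesz_P p f = g" by (rule riesz_P_eqI) (use g in simp)
  then show "riesz_P p f \<in> Hp p" "fourier (riesz_P p f) n = (if 0 \<le> n then fourier f n else 0)"
    using g \<open>g \<in> Hp p\<close> by auto
qed

lemma riesz_P_bound:
  obtains C where "C > 0" "\<And>f. f \<in> Lp p \<Longrightarrow> Lp_norm p (riesz_P p f) \<le> C * Lp_norm p f"
proof -
  obtain C where C: "C \<ge> 0" "\<And>f. f \<in> Lp p \<Longrightarrow>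
    \<exists>g\<in>Lp p. (\<forall>n. fourier g n = (if 0 \<le> n then fourier f n else 0)) \<and> Lp_norm p g \<le> C * Lp_norm p f"
    using riesz_extension by blast
  have "Lp_norm p (riesz_P p f) \<le> (C + 1) * Lp_norm p f" if f: "f \<in> Lp p" for f
  proof -
    obtain g where g: "g \<in> Lp p" "\<forall>n. fourier g n = (if 0 \<le> n then fourier f n else 0)" "Lp_norm p g \<le> C * Lp_norm p f"
      using C(2)[OF f] by blast
    then have "riesz_P p f = g" by (intro riesz_P_eqI) (auto simp: Hp_iff)
    moreover have "C * Lp_norm p f \<le> (C + 1) * Lp_norm p f" by (intro mult_right_mono) auto
    ultimately show ?thesis using g by simp
  qed
  then show thesis using C(1) by (intro that[of "C + 1"]) auto
qed

lemma riesz_P_id: "f \<in> Hp p \<Longrightarrow> riesz_P p f = f"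
  by (rule riesz_P_eqI) auto

lemma riesz_P_add: "f \<in> Lp p \<Longrightarrow> g \<in> Lp p \<Longrightarrow> riesz_P p (f + g) = riesz_P p f + riesz_P p g"
  by (rule riesz_P_eqI) (auto simp: riesz_P_Hp Hp_add fourier_add Lp_subset_L1 Hp_L1 fourier_riesz_P)

lemma riesz_P_cscale: "f \<in> Lp p \<Longrightarrow> riesz_P p (cscale z f) = cscale z (riesz_P p f)"
  by (rule riesz_P_eqI) (auto simp: riesz_P_Hp Hp_cscale fourier_riesz_P)

lemma riesz_P_diff: "f \<in> Lp p \<Longrightarrow> g \<in> Lp p \<Longrightarrow> riesz_P p (f - g) = riesz_P p f - riesz_P p g"
  by (rule riesz_P_eqI) (auto simp: riesz_P_Hp Hp_diff fourier_diff Lp_subset_L1 Hp_L1 fourier_riesz_P)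

lemma riesz_P_eq_0_iff: "f \<in> Lp p \<Longrightarrow> riesz_P p f = 0 \<longleftrightarrow> f \<in> Hp_minus p"
proof
  assume f: "f \<in> Lp p" "riesz_P p f = 0"
  then show "f \<in> Hp_minus p" using fourier_riesz_P[OF f(1)] by (auto simp: Hp_minus_def) (metis fourier_zero)
next
  assume "f \<in> Hp_minus p"
  then show "riesz_P p f = 0" by (intro riesz_P_eqI) (auto simp: Hp_minus_def)
qed

lemma riesz_Q_minus: "f \<in> Lp p \<Longrightarrow> riesz_Q p f \<in> Hp_minus p"
  using p_nonneg riesz_P_Hp[of f]
  by (auto simp: riesz_Q_def Hp_minus_def fourier_diff Lp_subset_L1 Hp_L1 fourier_riesz_P Hp_Lp intro!: Lp_diff)

lemma riesz_Q_id: "f \<in> Hp_minus p \<Longrightarrow> riesz_Q p f = f"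
  using riesz_P_eq_0_iff[of f] by (simp add: riesz_Q_def Hp_minus_Lp)

lemma riesz_Q_flip_J: "f \<in> Hp p \<Longrightarrow> riesz_Q p (flip_J f) = flip_J f"
  using p_nonneg by (intro riesz_Q_id) (simp add: flip_J_Hp)

lemma Hp_polys_dense:
  assumes f: "f \<in> Hp p" and e: "e > 0"
  obtains s where "s \<in> trig_polys {0..}" "Lp_norm p (f - s) < e"
proof -
  obtain C where C: "C > 0" "\<And>f. f \<in> Lp p \<Longrightarrow> Lp_norm p (riesz_P p f) \<le> C * Lp_norm p f"
    using riesz_P_bound by blast
  obtain s where s: "s \<in> trig_polys UNIV" "Lp_norm p (f - s) < e / C"
    using trig_polys_dense[OF Hp_Lp[OF f], of "e / C"] C(1) e by auto
  have sL: "s \<in> Lp p" using trig_polys_Lp p_nonneg s by blast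
  have "riesz_P p s = trig_P s"
    using trig_polys_Hp[OF p_nonneg(1) trig_P_mem[OF s(1)]] by (rule riesz_P_eqI) (simp add: fourier_trig_P[OF s(1)])
  then have "f - trig_P s = riesz_P p (f - s)"
    using sL f by (simp add: riesz_P_diff Hp_Lp riesz_P_id)
  then have "Lp_norm p (f - trig_P s) \<le> C * Lp_norm p (f - s)"
    using C(2)[of "f - s"] Lp_diff[OF p_nonneg(1) Hp_Lp[OF f] sL] by simp
  also have "\<dots> < e" using s(2) C(1) by (simp add: field_simps)
  finally show thesis using that trig_P_mem[OF s(1)] by blast
qed

end

context conjugate_exponents
begin

interpretation qp: conjugate_exponents q p by (rule conjugate_exponents_sym)

text \<open>For an analytic polynomial as first factor this is a finite computation; analytic polynomials are
  dense because the Riesz projection is bounded.\<close>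

lemma Hp_mult_fourier:
  assumes f: "f \<in> Hp p" and g: "g \<in> Hp q" and n: "n \<le> 0"
  shows "fourier (f * g) n = (if n = 0 then fourier f 0 * fourier g 0 else 0)"
proof -
  have poly: "fourier (s * g) n = (if n = 0 then fourier s 0 * fourier g 0 else 0)" if "s \<in> trig_polys {0..}" for s
    using that
  proof (induction rule: trig_polys_induct)
    case (step c k s)
    have "tpow k * g \<in> Lp 1" "s * g \<in> Lp 1"
      using qp.Hp_L1[OF g] trig_polys_Linf[OF step(2)] by (simp_all add: Linf_mult_Lp)
    moreover have "cscale c (tpow k) \<in> Lp 1" "s \<in> Lp 1"
      using trig_polys_L1[OF step(2)] Linf_subset_Lp[of 1 "tpow k"] by (simp_all add: Lp_cscale)
    ultimately have L: "fourier ((cscale c (tpow k) + s) * g) n = c * fourier g (n - k) + fourier (s * g) n"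
        "fourier (cscale c (tpow k) + s) 0 = c * (if k = 0 then 1 else 0) + fourier s 0"
      by (simp_all add: distrib_right fourier_add Lp_cscale fourier_tpow)
    have "fourier g (n - k) = (if n = 0 \<and> k = 0 then fourier g 0 else 0)"
      using g n step(1) by (auto simp: Hp_iff)
    then show ?case unfolding L step.IH by (auto simp: algebra_simps)
  qed simp
  have "\<exists>s. s \<in> trig_polys {0..} \<and> Lp_norm p (f - s) < 1 / real (Suc k)" for k
    using Hp_polys_dense[OF f, of "1 / real (Suc k)"] by auto
  then obtain s where s: "\<And>k. s k \<in> trig_polys {0..}" "\<And>k. Lp_norm p (f - s k) < 1 / real (Suc k)" by metis
  have lim1: "(\<lambda>n. 1 / real (Suc n)) \<longlonglongrightarrow> 0" by (rule LIMSEQ_Suc[OF lim_1_over_n])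
  have sL: "s k \<in> Lp p" for k using trig_polys_Lp[OF p_nonneg(1) s(1)] .
  have lim: "(\<lambda>k. Lp_norm p (s k - f)) \<longlonglongrightarrow> 0"
    using s(2) by (intro Lim_null_comparison[OF always_eventually lim1])
      (auto simp: Lp_norm_minus_commute[of p _ f] intro: less_imp_le)
  have fs: "(\<lambda>k. fourier (s k) 0) \<longlonglongrightarrow> fourier f 0" by (rule fourier_tendsto[OF sL Hp_Lp[OF f] lim])
  have lim_g: "(\<lambda>k. Lp_norm p (s k - f) * Lp_norm q g) \<longlonglongrightarrow> 0"
    using tendsto_mult_right[OF lim, of "Lp_norm q g"] by simp
  have le: "cmod (fourier (s k * g) n - fourier (f * g) n) \<le> Lp_norm p (s k - f) * Lp_norm q g" for k
  proof -
    have d: "s k - f \<in> Lp p" using sL Hp_Lp[OF f] p_nonneg by (intro Lp_diff) auto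
    have "fourier (s k * g) n - fourier (f * g) n = fourier ((s k - f) * g) n"
      using Holder(1)[OF sL[of k] Hp_Lp[OF g]] Holder(1)[OF Hp_Lp[OF f] Hp_Lp[OF g]] by (simp add: left_diff_distrib fourier_diff)
    also have "cmod \<dots> \<le> Lp_norm p (s k - f) * Lp_norm q g"
      using fourier_bound[OF Holder(1)[OF d Hp_Lp[OF g]], of n] Holder(2)[OF d Hp_Lp[OF g]] by linarith
    finally show ?thesis .
  qed
  have "(\<lambda>k. fourier (s k * g) n - fourier (f * g) n) \<longlonglongrightarrow> 0"
    by (rule Lim_null_comparison[OF always_eventually lim_g]) (use le in blast)
  then have "(\<lambda>k. fourier (s k * g) n) \<longlonglongrightarrow> fourier (f * g) n" by (simp add: LIM_zero_iff)
  moreover have "(\<lambda>k. fourier (s k * g) n) \<longlonglongrightarrow> (if n = 0 then fourier f 0 * fourier g 0 else 0)"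
    unfolding poly[OF s(1)] using tendsto_mult[OF fs tendsto_const[of "fourier g 0"]] by auto
  ultimately show ?thesis by (rule LIMSEQ_unique)
qed

section \<open>Adjoints\<close>

lemma pairing_commute: "pairing g f = cnj (pairing f g)"
  using fourier_conj[of "f * conj_fun g" 0] by (simp add: pairing_def mult.commute)

lemma pairing_add_left:
  "f \<in> Lp p \<Longrightarrow> f' \<in> Lp p \<Longrightarrow> g \<in> Lp q \<Longrightarrow> pairing (f + f') g = pairing f g + pairing f' g"
  using Holder(1)[of f "conj_fun g"] Holder(1)[of f' "conj_fun g"]
  by (simp add: pairing_def distrib_right fourier_add)

lemma pairing_minus_Hp:
  assumes f: "f \<in> Hp_minus p" and g: "g \<in> Hp q"
  shows "pairing f g = 0"
proof -
  have cf: "conj_fun f \<in> Hp p" "fourier (conj_fun f) 0 = 0" using f by (auto simp: Hp_minus_def Hp_iff)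
  have "pairing f g = cnj (fourier (conj_fun f * g) 0)"
    using fourier_conj[of "conj_fun f * g" 0] by (simp add: pairing_def)
  then show ?thesis using Hp_mult_fourier[OF cf(1) g, of 0] cf(2) by simp
qed

lemma pairing_riesz_P_left:
  assumes f: "f \<in> Lp p" and g: "g \<in> Hp q" shows "pairing (riesz_P p f) g = pairing f g"
proof -
  have "pairing f g = pairing (riesz_P p f + riesz_Q p f) g" by (simp add: riesz_Q_def)
  also have "\<dots> = pairing (riesz_P p f) g"
    using pairing_add_left[OF Hp_Lp[OF riesz_P_Hp[OF f]] Hp_minus_Lp[OF riesz_Q_minus[OF f]] Hp_Lp[OF g]]
      pairing_minus_Hp[OF riesz_Q_minus[OF f] g] by simp
  finally show ?thesis by simp
qed

lemma pairing_inject: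
  assumes h: "h \<in> Hp q" and 0: "\<And>f. f \<in> Hp p \<Longrightarrow> pairing f h = 0"
  shows "h = 0"
proof (rule fourier_eq_0_imp)
  show "fourier h n = 0" for n
  proof (cases "n \<ge> 0")
    case True
    have "tpow n \<in> Hp p" using trig_polys_Hp[OF p_nonneg(1)] trig_polys_tpow[of n "{0..}"] True by simp
    from 0[OF this] show ?thesis by (simp add: pairing_tpow_left)
  qed (use h in \<open>simp add: Hp_iff\<close>)
qed (use qp.Hp_L1[OF h] in simp)

end

lemma (in conjugate_exponents) pairing_riesz_P_right:
  assumes f: "f \<in> Hp p" and g: "g \<in> Lp q" shows "pairing f (riesz_P q g) = pairing f g"
  using conjugate_exponents.pairing_riesz_P_left[OF conjugate_exponents_sym g f] pairing_commute by metis

context conjugate_exponents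
begin

interpretation qp: conjugate_exponents q p by (rule conjugate_exponents_sym)

lemma adjoint_op_eqI:
  assumes h: "h \<in> Hp q" and eq: "\<And>f. f \<in> Hp p \<Longrightarrow> pairing (A f) g = pairing f h"
  shows "adjoint_op p q A g = h"
  unfolding adjoint_op_def
proof (rule the_equality)
  fix h' assume h': "h' \<in> Hp q \<and> (\<forall>f\<in>Hp p. pairing (A f) g = pairing f h')"
  have "h' - h = 0"
  proof (rule pairing_inject)
    show "h' - h \<in> Hp q" using h h' by (intro qp.Hp_diff) auto
    fix f assume f: "f \<in> Hp p"
    have "pairing f (h' - h) = cnj (pairing (h' - h) f)" by (rule pairing_commute)
    also have "pairing (h' - h) f = pairing h' f - pairing h f"
      using h h' f by (intro qp.pairing_diff_left) (auto intro: Hp_Lp)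
    also have "cnj \<dots> = pairing f h' - pairing f h" using pairing_commute[of h' f] pairing_commute[of h f] by simp
    finally show "pairing f (h' - h) = 0" using eq[OF f] h' f by simp
  qed
  then show "h' = h" by simp
qed (use assms in auto)

lemma toeplitz_Hp: "a \<in> Linf \<Longrightarrow> f \<in> Hp p \<Longrightarrow> toeplitz p a f \<in> Hp p"
  unfolding toeplitz_def using p_nonneg by (intro riesz_P_Hp Linf_mult_Lp Hp_Lp)

lemma toeplitz_add: "a \<in> Linf \<Longrightarrow> f \<in> Hp p \<Longrightarrow> g \<in> Hp p \<Longrightarrow> toeplitz p a (f + g) = toeplitz p a f + toeplitz p a g"
  unfolding toeplitz_def using p_nonneg by (simp add: distrib_left riesz_P_add Linf_mult_Lp Hp_Lp)

lemma toeplitz_diff: "a \<in> Linf \<Longrightarrow> f \<in> Hp p \<Longrightarrow> g \<in> Hp p \<Longrightarrow> toeplitz p a (f - g) = toeplitz p a f - toeplitz p a g"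
  unfolding toeplitz_def using p_nonneg by (simp add: right_diff_distrib riesz_P_diff Linf_mult_Lp Hp_Lp)

lemma toeplitz_cscale: "a \<in> Linf \<Longrightarrow> f \<in> Hp p \<Longrightarrow> toeplitz p a (cscale z f) = cscale z (toeplitz p a f)"
  unfolding toeplitz_def using p_nonneg by (simp add: riesz_P_cscale Linf_mult_Lp Hp_Lp)

lemma toeplitz_eq_0_iff: "a \<in> Linf \<Longrightarrow> f \<in> Hp p \<Longrightarrow> toeplitz p a f = 0 \<longleftrightarrow> a * f \<in> Hp_minus p"
  unfolding toeplitz_def using p_nonneg by (intro riesz_P_eq_0_iff Linf_mult_Lp Hp_Lp)

lemma toeplitz_bound:
  assumes "a \<in> Linf"
  obtains C where "C > 0" "\<And>f. f \<in> Hp p \<Longrightarrow> Lp_norm p (toeplitz p a f) \<le> C * Lp_norm p f"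
proof -
  obtain C where C: "C > 0" "\<And>f. f \<in> Lp p \<Longrightarrow> Lp_norm p (riesz_P p f) \<le> C * Lp_norm p f"
    using riesz_P_bound by blast
  obtain D where D: "D \<ge> 0" "\<And>f. f \<in> Lp p \<Longrightarrow> Lp_norm p (a * f) \<le> D * Lp_norm p f"
    using Linf_mult_bound[OF assms] p_nonneg(2) by metis
  have "Lp_norm p (toeplitz p a f) \<le> (C * (D + 1)) * Lp_norm p f" if f: "f \<in> Hp p" for f
  proof -
    have "Lp_norm p (toeplitz p a f) \<le> C * Lp_norm p (a * f)"
      unfolding toeplitz_def by (intro C(2) Linf_mult_Lp p_nonneg assms Hp_Lp f)
    also have "\<dots> \<le> C * ((D + 1) * Lp_norm p f)"
      using C(1) D(2)[OF Hp_Lp[OF f]] Lp_norm_nonneg[of p f]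
      by (intro mult_left_mono) (auto simp: distrib_right add_increasing2)
    finally show ?thesis by (simp only: mult.assoc)
  qed
  then show thesis using C(1) D(1) by (intro that[of "C * (D + 1)"]) auto
qed

lemma hankel_eq: "f \<in> Hp p \<Longrightarrow> hankel p b f = riesz_P p (b * flip_J f)"
  by (simp add: hankel_def riesz_Q_flip_J)

lemma hankel_Hp: "b \<in> Linf \<Longrightarrow> f \<in> Hp p \<Longrightarrow> hankel p b f \<in> Hp p"
  using p_nonneg by (auto simp: hankel_eq Lp_flip_J Hp_Lp intro!: riesz_P_Hp Linf_mult_Lp)

end

context conjugate_exponents
begin

interpretation qp: conjugate_exponents q p by (rule conjugate_exponents_sym)

lemma pairing_toeplitz:
  assumes a: "a \<in> Linf" and f: "f \<in> Hp p" and g: "g \<in> Hp q"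
  shows "pairing (toeplitz p a f) g = pairing f (toeplitz q (conj_fun a) g)"
proof -
  have "pairing (toeplitz p a f) g = pairing (a * f) g"
    unfolding toeplitz_def using p_nonneg by (intro pairing_riesz_P_left Linf_mult_Lp a Hp_Lp f g) auto
  also have "\<dots> = pairing f (conj_fun a * g)" by (simp add: pairing_def mult_ac)
  also have "\<dots> = pairing f (toeplitz q (conj_fun a) g)"
    unfolding toeplitz_def using qp.p_nonneg by (intro pairing_riesz_P_right[symmetric] Linf_mult_Lp Hp_Lp f g Linf_conj a) auto
  finally show ?thesis .
qed

text \<open>The substitution \<open>t \<mapsto> 1/t\<close> moves the flip from \<open>f\<close> to \<open>g\<close>.\<close>

lemma pairing_hankel:
  assumes b: "b \<in> Linf" and f: "f \<in> Hp p" and g: "g \<in> Hp q"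
  shows "pairing (hankel p b f) g = pairing f (hankel q (tilde (conj_fun b)) g)"
proof -
  have "pairing (hankel p b f) g = pairing (b * flip_J f) g"
    unfolding hankel_eq[OF f] using p_nonneg
    by (intro pairing_riesz_P_left g Linf_mult_Lp b) (auto simp: Lp_flip_J Hp_Lp f)
  also have "\<dots> = fourier (tilde (b * flip_J f * conj_fun g)) 0" by (simp only: fourier_tilde pairing_def minus_zero)
  also have "\<dots> = pairing f (tilde (conj_fun b) * flip_J g)"
    by (simp add: pairing_def flip_J_def tilde_conj mult_ac)
  also have "\<dots> = pairing f (hankel q (tilde (conj_fun b)) g)"
    unfolding qp.hankel_eq[OF g] using qp.p_nonneg
    by (intro pairing_riesz_P_right[symmetric] f Linf_mult_Lp Linf_tilde Linf_conj b) (auto simp: Lp_flip_J Hp_Lp g)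
  finally show ?thesis .
qed

lemma adjoint_toeplitz:
  "a \<in> Linf \<Longrightarrow> g \<in> Hp q \<Longrightarrow> adjoint_op p q (toeplitz p a) g = toeplitz q (conj_fun a) g"
  by (intro adjoint_op_eqI qp.toeplitz_Hp pairing_toeplitz) auto

lemma coker_toeplitz: "a \<in> Linf \<Longrightarrow> coker_op p q (toeplitz p a) = ker_op q (toeplitz q (conj_fun a))"
  by (auto simp: coker_op_def ker_op_def adjoint_toeplitz)

lemma coker_toeplitz_hankel:
  assumes a: "a \<in> Linf" and b: "b \<in> Linf" and \<epsilon>: "cnj \<epsilon> = \<epsilon>"
  shows "coker_op p q (\<lambda>f. toeplitz p a f + cscale \<epsilon> (hankel p b f))
    = ker_op q (\<lambda>g. toeplitz q (conj_fun a) g + cscale \<epsilon> (hankel q (tilde (conj_fun b)) g))"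
proof -
  have "adjoint_op p q (\<lambda>f. toeplitz p a f + cscale \<epsilon> (hankel p b f)) g
      = toeplitz q (conj_fun a) g + cscale \<epsilon> (hankel q (tilde (conj_fun b)) g)" if g: "g \<in> Hp q" for g
  proof (rule adjoint_op_eqI)
    have T: "toeplitz q (conj_fun a) g \<in> Hp q" "hankel q (tilde (conj_fun b)) g \<in> Hp q"
      using g a b by (auto intro!: qp.toeplitz_Hp qp.hankel_Hp Linf_tilde)
    then show "toeplitz q (conj_fun a) g + cscale \<epsilon> (hankel q (tilde (conj_fun b)) g) \<in> Hp q"
      by (intro qp.Hp_add qp.Hp_cscale)
    fix f assume f: "f \<in> Hp p"
    have T': "toeplitz p a f \<in> Hp p" "hankel p b f \<in> Hp p" using f a b by (auto intro!: toeplitz_Hp hankel_Hp)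
    have "pairing (toeplitz p a f + cscale \<epsilon> (hankel p b f)) g = pairing (toeplitz p a f) g + \<epsilon> * pairing (hankel p b f) g"
      using T' g by (subst pairing_add_left) (auto simp: Hp_Lp Lp_cscale pairing_cscale_left)
    also have "\<dots> = pairing f (toeplitz q (conj_fun a) g) + \<epsilon> * pairing f (hankel q (tilde (conj_fun b)) g)"
      using pairing_toeplitz[OF a f g] pairing_hankel[OF b f g] by simp
    also have "\<dots> = cnj (pairing (toeplitz q (conj_fun a) g) f + \<epsilon> * pairing (hankel q (tilde (conj_fun b)) g) f)"
      using pairing_commute[of f "toeplitz q (conj_fun a) g"] pairing_commute[of f "hankel q (tilde (conj_fun b)) g"] \<epsilon> by simp
    also have "pairing (toeplitz q (conj_fun a) g) f + \<epsilon> * pairing (hankel q (tilde (conj_fun b)) g) f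
        = pairing (toeplitz q (conj_fun a) g + cscale \<epsilon> (hankel q (tilde (conj_fun b)) g)) f"
      using T f by (subst qp.pairing_add_left) (auto simp: Hp_Lp Lp_cscale pairing_cscale_left)
    finally show "pairing (toeplitz p a f + cscale \<epsilon> (hankel p b f)) g
        = pairing f (toeplitz q (conj_fun a) g + cscale \<epsilon> (hankel q (tilde (conj_fun b)) g))"
      using pairing_commute by metis
  qed
  then show ?thesis by (auto simp: coker_op_def ker_op_def)
qed

end

section \<open>Boundary uniqueness and Coburn's lemma\<close>

lemma conjugate_exponents_2: "conjugate_exponents 2 2"
  by unfold_locales auto

lemma dual_elt_2: "dual_elt 2 e = e"
  unfolding dual_elt_def
proof (rule abs_tfun_eqI)
  have *: "dual_value 2 z = z" for z
    by (simp add: dual_value_def sgn_eq)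
  show "AE t in circle_measure. dual_value 2 (rp e t) = rp e t" unfolding * by simp
  show "(\<lambda>t. dual_value 2 (rp e t)) \<in> borel_measurable borel" unfolding * by simp
qed

text \<open>\<open>g * inverse g\<close> is the indicator function of the set where \<open>g \<noteq> 0\<close>, because the pointwise
  inverse of 0 is 0.\<close>

lemma Linf_support: "g * inverse g \<in> Linf"
  unfolding in_Linf_iff
proof (intro exI)
  show "AE t in circle_measure. cmod (rp (g * inverse g) t) \<le> 1"
    using rp_times[of g "inverse g"] rp_inverse[of g]
  proof eventually_elim
    case (elim t)
    then show ?case by (cases "rp g t = 0") auto
  qed
qed

lemma mult_support: "g * (g * inverse g) = (g :: tfun)"
proof (rule tfun_eqI)
  show "AE t in circle_measure. rp (g * (g * inverse g)) t = rp g t"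
    using rp_times[of g "g * inverse g"] rp_times[of g "inverse g"] rp_inverse[of g]
  proof eventually_elim
    case (elim t)
    then show ?case by (cases "rp g t = 0") auto
  qed
qed

lemma Hp_first_coefficient:
  assumes "conjugate_exponents p q" and f: "f \<in> Hp p" "f \<noteq> 0"
  obtains k where "0 \<le> k" "tpow (- k) * f \<in> Hp p" "fourier (tpow (- k) * f) 0 \<noteq> 0"
proof -
  interpret conjugate_exponents p q by fact
  have "\<exists>n. fourier f n \<noteq> 0" using fourier_eq_0_imp[OF Hp_L1[OF f(1)]] f(2) by blast
  then obtain n where n: "fourier f n \<noteq> 0" by blast
  have n0: "n \<ge> 0" using n f(1) by (auto simp: Hp_iff not_less[symmetric])
  define k where "k = (LEAST k. fourier f (int k) \<noteq> 0)"
  have k: "fourier f (int k) \<noteq> 0" unfolding k_def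
    by (rule LeastI[of _ "nat n"]) (use n n0 in simp)
  have small: "fourier f j = 0" if "j < int k" for j
  proof (cases "j < 0")
    case False
    then have "\<not> fourier f (int (nat j)) \<noteq> 0" using that unfolding k_def by (intro not_less_Least) auto
    then show ?thesis using False by simp
  qed (use f(1) in \<open>simp add: Hp_iff\<close>)
  show thesis
  proof (rule that[of "int k"])
    show "tpow (- int k) * f \<in> Hp p" using Hp_Lp[OF f(1)] p_nonneg by (simp add: Hp_iff Lp_tpow_mult small)
  qed (use k in auto)
qed

text \<open>A nonzero function of the Hardy space does not vanish on a set of positive measure. After division by
  a power of \<open>t\<close> let \<open>f0\<close> have nonzero mean, and let \<open>e\<close> be the component of \<open>f0\<close> orthogonal in \<open>L\<^sup>2\<close> to all \<open>t\<^sup>n f0\<close> with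
  \<open>n \<ge> 1\<close>. Then \<open>e \<noteq> 0\<close> is orthogonal to \<open>t\<^sup>n e\<close>, so \<open>|e|\<^sup>2\<close> is a nonzero constant. The indicator
  of \<open>g \<noteq> 0\<close> annihilates \<open>f0\<close>, hence \<open>e\<close>, hence it is 0.\<close>

lemma Hp_zero_divisor_ge_2:
  assumes pq: "conjugate_exponents p q" and p2: "2 \<le> p" and f: "f \<in> Hp p" "f \<noteq> 0" and fg: "f * g = 0"
  shows "g = 0"
proof -
  interpret two: conjugate_exponents 2 2 by (rule conjugate_exponents_2)
  obtain k where k: "tpow (- k) * f \<in> Hp p" "fourier (tpow (- k) * f) 0 \<noteq> 0"
    using Hp_first_coefficient[OF pq f] by blast
  define f0 where "f0 = tpow (- k) * f"
  have f0: "f0 \<in> Hp 2" using k(1) p2 Lp_mono[of 2 p f0] by (simp add: f0_def Hp_iff)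
  have f0_0: "fourier f0 0 \<noteq> 0" using k(2) by (simp add: f0_def)
  define \<omega> where "\<omega> = g * inverse g"
  have \<omega>: "\<omega> \<in> Linf" unfolding \<omega>_def by (rule Linf_support)
  have \<omega>f0: "\<omega> * f0 = 0"
  proof -
    have "\<omega> * f0 = (tpow (- k) * inverse g) * (f * g)" by (simp add: \<omega>_def f0_def mult_ac)
    then show ?thesis using fg by simp
  qed
  define S where "S = cvs.span {tpow (int n) * f0 | n. n \<ge> 1}"
  have S: "cvs.subspace S" unfolding S_def by (rule cvs.subspace_span)
  have S_props: "s \<in> Lp 2 \<and> fourier s 0 = 0 \<and> \<omega> * s = 0 \<and> tpow (int m) * s \<in> S" if "s \<in> S" for s m
    using that unfolding S_def
  proof (induction rule: cvs.span_induct_alt)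
    case base then show ?case by (simp add: cvs.span_zero)
  next
    case (step c x y)
    then obtain n where n: "n \<ge> 1" "x = tpow (int n) * f0" by blast
    have x: "x \<in> Lp 2" using Hp_Lp[OF f0] n by (simp add: Lp_tpow_mult)
    have "fourier x 0 = 0" using f0 n by (simp add: Hp_iff)
    moreover have "\<omega> * x = 0" using \<omega>f0 n by (metis mult.left_commute mult_zero_right)
    moreover have "tpow (int m) * x \<in> {tpow (int n) * f0 | n. n \<ge> 1}"
    proof -
      have "tpow (int m) * x = tpow (int (m + n)) * f0" unfolding n(2) tpow_mult_left by simp
      then show ?thesis using n(1) by (intro CollectI exI[of _ "m + n"]) auto
    qed
    then have "tpow (int m) * (cscale c x + y) \<in> cvs.span {tpow (int n) * f0 | n. n \<ge> 1}"
      using step.IH unfolding distrib_left cscale_times_right by (intro cvs.span_add cvs.span_scale) (blast intro: cvs.span_base)+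
    ultimately show ?case using step.IH x
      by (simp add: Lp_add Lp_cscale fourier_add two.Lp_subset_L1 distrib_left)
  qed
  obtain e Y where e: "e \<in> Lp 2" "\<And>n. Y n \<in> S" "(\<lambda>n. Lp_norm 2 (f0 - Y n - e)) \<longlonglongrightarrow> 0"
    "\<And>m. m \<in> S \<Longrightarrow> Lp_norm 2 e \<le> Lp_norm 2 (e - m)"
    using Lp_nearest_point[of 2 S f0] S S_props Hp_Lp[OF f0] by (metis one_less_numeral_iff semiring_norm(76) subsetI)
  have f0Y: "f0 - Y n \<in> Lp 2" for n using Hp_Lp[OF f0] S_props e(2) by (intro Lp_diff) auto
  have f0Ye: "f0 - Y n - e \<in> Lp 2" for n using Lp_diff[OF _ f0Y e(1)] by simp
  have orth: "pairing s e = 0" if "s \<in> S" for s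
    using two.nearest_variation[OF e(1), of s] e(4) S_props[OF that] cvs.subspace_scale[OF S that] by (simp add: dual_elt_2)
  have "(\<lambda>n. fourier (f0 - Y n) 0) \<longlonglongrightarrow> fourier e 0" by (rule two.fourier_tendsto[OF f0Y e(1,3)])
  moreover have "fourier (f0 - Y n) 0 = fourier f0 0" for n
    using S_props[OF e(2)] two.Lp_subset_L1 Hp_Lp[OF f0] by (simp add: fourier_diff)
  ultimately have "fourier e 0 = fourier f0 0" by (simp add: LIMSEQ_const_iff)
  then have e0: "e \<noteq> 0" using f0_0 by auto
  have \<omega>e: "\<omega> * e = 0"
  proof -
    obtain C where C: "C \<ge> 0" "\<And>f. f \<in> Lp 2 \<Longrightarrow> Lp_norm 2 (\<omega> * f) \<le> C * Lp_norm 2 f"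
      using Linf_mult_bound[OF \<omega>] by (metis zero_less_numeral)
    have "Lp_norm 2 (\<omega> * e) \<le> C * Lp_norm 2 (f0 - Y n - e)" for n
    proof -
      have "\<omega> * (f0 - Y n - e) = - (\<omega> * e)" using \<omega>f0 S_props[OF e(2)] by (simp add: right_diff_distrib)
      then show ?thesis using C(2)[OF f0Ye[of n]] by simp
    qed
    moreover have "(\<lambda>n. C * Lp_norm 2 (f0 - Y n - e)) \<longlonglongrightarrow> C * 0" by (intro tendsto_intros e(3))
    ultimately have "Lp_norm 2 (\<omega> * e) \<le> C * 0" by (intro LIMSEQ_le_const) auto
    then have "Lp_norm 2 (\<omega> * e) = 0" using Lp_norm_nonneg[of 2 "\<omega> * e"] by simp
    then show ?thesis using Lp_norm_eq_0_iff[of 2 "\<omega> * e"] Linf_mult_Lp[OF _ \<omega> e(1)] by simp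
  qed
  \<comment> \<open>The extremal function is orthogonal to its own shifts, so its modulus is constant.\<close>
  define \<phi> where "\<phi> = e * conj_fun e"
  have \<phi>: "\<phi> \<in> Lp 1" unfolding \<phi>_def by (rule two.Holder(1)) (use e(1) in auto)
  have \<phi>_neg: "fourier \<phi> (- int n) = 0" if n: "n \<ge> 1" for n
  proof -
    have "pairing (tpow (int n) * e) e = 0"
    proof -
      have te: "tpow (int n) * e \<in> Lp 2" using e(1) by (simp add: Lp_tpow_mult)
      have "cmod (pairing (tpow (int n) * e) e) \<le> Lp_norm 2 (f0 - Y j - e) * Lp_norm 2 e" for j
      proof -
        let ?t = "tpow (int n) * (f0 - Y j)"
        have "?t \<in> S"
        proof -
          have "tpow (int n) * f0 \<in> S" unfolding S_def using n by (intro cvs.span_base) auto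
          moreover have "tpow (int n) * Y j \<in> S" using S_props[OF e(2)] by blast
          ultimately show ?thesis using cvs.subspace_diff[OF S] by (simp add: right_diff_distrib)
        qed
        then have p0: "pairing ?t e = 0" by (rule orth)
        have tL: "?t \<in> Lp 2" using f0Y by (simp add: Lp_tpow_mult)
        have "pairing (tpow (int n) * (f0 - Y j - e)) e = pairing ?t e - pairing (tpow (int n) * e) e"
          using two.pairing_diff_left[OF tL te e(1)] by (simp add: right_diff_distrib)
        then have "cmod (pairing (tpow (int n) * e) e) = cmod (pairing (tpow (int n) * (f0 - Y j - e)) e)"
          using p0 by simp
        also have "\<dots> \<le> Lp_norm 2 (tpow (int n) * (f0 - Y j - e)) * Lp_norm 2 e"
          using f0Ye e(1) by (intro two.pairing_bound) (auto simp: Lp_tpow_mult)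
        also have "Lp_norm 2 (tpow (int n) * (f0 - Y j - e)) = Lp_norm 2 (f0 - Y j - e)"
          by (rule Lp_norm_tpow)
        finally show ?thesis .
      qed
      moreover have "(\<lambda>j. Lp_norm 2 (f0 - Y j - e) * Lp_norm 2 e) \<longlonglongrightarrow> 0 * Lp_norm 2 e" by (intro tendsto_intros e(3))
      ultimately have "cmod (pairing (tpow (int n) * e) e) \<le> 0 * Lp_norm 2 e" by (intro LIMSEQ_le_const) auto
      then show ?thesis by simp
    qed
    then show ?thesis by (simp add: pairing_def \<phi>_def mult.assoc)
  qed
  have \<phi>_real: "conj_fun \<phi> = \<phi>" by (simp add: \<phi>_def mult.commute)
  have \<phi>_const: "\<phi> = cscale (fourier \<phi> 0) 1"
  proof (rule fourier_inject[OF \<phi>])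
    fix n :: int
    consider "n = 0" | "n < 0" | "n > 0" by linarith
    then show "fourier \<phi> n = fourier (cscale (fourier \<phi> 0) 1) n"
    proof cases
      case 2
      then show ?thesis using \<phi>_neg[of "nat (- n)"] by (simp add: fourier_one)
    next
      case 3
      have "fourier \<phi> n = cnj (fourier \<phi> (- n))" using fourier_conj[of \<phi> n] \<phi>_real by simp
      then show ?thesis using 3 \<phi>_neg[of "nat n"] by (simp add: fourier_one)
    qed (simp add: fourier_one)
  qed (simp add: Lp_cscale)
  have \<phi>_0: "fourier \<phi> 0 \<noteq> 0"
  proof -
    have "fourier \<phi> 0 = of_real (Lp_norm 2 e powr 2)"
      using two.pairing_dual_elt[of e] by (simp add: pairing_def \<phi>_def dual_elt_2)
    then show ?thesis using e0 e(1) Lp_norm_eq_0_iff[of 2 e] by simp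
  qed
  have "\<omega> * \<phi> = 0" using \<omega>e by (simp add: \<phi>_def flip: mult.assoc)
  moreover have "\<omega> * \<phi> = \<omega> * cscale (fourier \<phi> 0) 1" using \<phi>_const by (rule arg_cong)
  ultimately have "cscale (fourier \<phi> 0) \<omega> = 0" by simp
  with \<phi>_0 have "\<omega> = 0" by simp
  then show "g = 0" using mult_support[of g] by (simp add: \<omega>_def)
qed

lemma conj_Hp_minus:
  assumes "u \<in> Hp_minus r" shows "conj_fun u \<in> Hp r" "fourier (conj_fun u) 0 = 0"
  using assms by (auto simp: Hp_minus_def Hp_iff)

context conjugate_exponents
begin

interpretation qp: conjugate_exponents q p by (rule conjugate_exponents_sym)

text \<open>One of the two conjugate exponents admits the \<open>L\<^sup>2\<close> argument, and one is enough for products.\<close>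

lemma p_or_q_ge_2: "2 \<le> p \<or> 2 \<le> q"
proof (rule ccontr)
  assume "\<not> ?thesis"
  then have "1 / 2 < 1 / p" "1 / 2 < 1 / q" using p_gt_1 q_gt_1 by (auto intro!: divide_strict_left_mono)
  then show False using pq by linarith
qed

lemma Hp_zero_divisor:
  assumes "f \<in> Hp p" "g \<in> Hp q" "f * g = 0" shows "f = 0 \<or> g = 0"
  using p_or_q_ge_2 Hp_zero_divisor_ge_2[OF conjugate_exponents_axioms, of f g]
    Hp_zero_divisor_ge_2[OF conjugate_exponents_sym, of g f] assms by (auto simp: mult.commute)

lemma Hp_conj_zero_divisor:
  assumes "f \<in> Hp p" "g \<in> Hp q" "f * conj_fun g = 0" shows "f = 0 \<or> g = 0"
proof -
  have "g * conj_fun f = 0"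
    using arg_cong[OF assms(3), of conj_fun] by (simp add: mult.commute)
  moreover have "h = 0" if "conj_fun h = 0" for h using arg_cong[OF that, of conj_fun] by simp
  ultimately show ?thesis
    using p_or_q_ge_2 Hp_zero_divisor_ge_2[OF conjugate_exponents_axioms, of f "conj_fun g"]
      Hp_zero_divisor_ge_2[OF conjugate_exponents_sym, of g "conj_fun f"] assms by blast
qed

text \<open>The function \<open>g f conj h\<close> has only negative frequencies by the first equation and only positive
  ones by the second, so it vanishes.\<close>

lemma toeplitz_coburn:
  assumes g: "g \<in> Linf" "g * inverse g = 1"
    and f: "f \<in> Hp p" "toeplitz p g f = 0" and h: "h \<in> Hp q" "toeplitz q (conj_fun g) h = 0"
  shows "f = 0 \<or> h = 0"
proof -
  have gf: "g * f \<in> Hp_minus p" using f toeplitz_eq_0_iff[OF g(1)] by simp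
  have gh: "conj_fun g * h \<in> Hp_minus q" using h qp.toeplitz_eq_0_iff[OF Linf_conj[OF g(1)]] by simp
  define u where "u = (g * f) * conj_fun h"
  have uL: "u \<in> Lp 1" unfolding u_def by (rule Holder(1)) (use gf h in \<open>auto simp: Hp_minus_Lp Hp_Lp\<close>)
  note c1 = conj_Hp_minus[OF gf] and c2 = conj_Hp_minus[OF gh]
  have "u = 0"
  proof (rule fourier_eq_0_imp[OF uL])
    fix n :: int
    show "fourier u n = 0"
    proof (cases "n \<le> 0")
      case True
      have "u = f * conj_fun (conj_fun g * h)" by (simp add: u_def mult_ac)
      then show ?thesis using Hp_mult_fourier[OF f(1) c2(1) True] c2(2) by simp
    next
      case False
      have "conj_fun u = conj_fun (g * f) * h" by (simp add: u_def)
      then have "fourier (conj_fun u) (- n) = 0" using Hp_mult_fourier[OF c1(1) h(1), of "- n"] c1(2) False by simp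
      then show ?thesis by simp
    qed
  qed
  then have "inverse g * ((g * f) * conj_fun h) = 0" by (simp add: u_def)
  moreover have "inverse g * ((g * f) * conj_fun h) = (g * inverse g) * (f * conj_fun h)" by (simp add: mult_ac)
  ultimately have "f * conj_fun h = 0" by (simp add: g(2))
  then show ?thesis by (rule Hp_conj_zero_divisor[OF f(1) h(1)])
qed

section \<open>Ranges of Toeplitz operators\<close>

text \<open>The analytic part of an annihilator of the range lies in the kernel of the adjoint.\<close>

lemma toeplitz_range_dense:
  assumes g: "g \<in> Linf" and inj: "\<And>h. h \<in> Hp q \<Longrightarrow> toeplitz q (conj_fun g) h = 0 \<Longrightarrow> h = 0"
    and w: "w \<in> Hp p" and e: "e > 0"
  obtains f where "f \<in> Hp p" "Lp_norm p (w - toeplitz p g f) < e"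
proof (cases "\<forall>e>0. \<exists>s\<in>toeplitz p g ` Hp p. Lp_norm p (w - s) < e")
  case False
  have sub: "cvs.subspace (toeplitz p g ` Hp p)"
    unfolding cvs.subspace_def
  proof (intro conjI ballI allI)
    show "0 \<in> toeplitz p g ` Hp p" using toeplitz_cscale[OF g, of 0 0] by (intro image_eqI[of _ _ 0]) auto
    fix x assume "x \<in> toeplitz p g ` Hp p"
    then obtain f where f: "f \<in> Hp p" "x = toeplitz p g f" by blast
    show "cscale c x \<in> toeplitz p g ` Hp p" for c
      using f toeplitz_cscale[OF g f(1)] by (intro image_eqI[of _ _ "cscale c f"]) (auto intro: Hp_cscale)
    fix y assume "y \<in> toeplitz p g ` Hp p"
    then obtain f' where f': "f' \<in> Hp p" "y = toeplitz p g f'" by blast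
    show "x + y \<in> toeplitz p g ` Hp p"
      using f f' toeplitz_add[OF g f(1) f'(1)] by (intro image_eqI[of _ _ "f + f'"]) (auto intro: Hp_add)
  qed
  have subLp: "toeplitz p g ` Hp p \<subseteq> Lp p" using toeplitz_Hp[OF g] Hp_Lp by blast
  obtain k where k: "k \<in> Lp q" "\<And>s. s \<in> toeplitz p g ` Hp p \<Longrightarrow> pairing s k = 0" "pairing w k \<noteq> 0"
    using annihilator[OF sub subLp Hp_Lp[OF w] False] by blast
  define k' where "k' = riesz_P q k"
  have k': "k' \<in> Hp q" unfolding k'_def by (rule qp.riesz_P_Hp[OF k(1)])
  have pk: "pairing s k' = pairing s k" if "s \<in> Hp p" for s unfolding k'_def by (rule pairing_riesz_P_right[OF that k(1)])
  have "toeplitz q (conj_fun g) k' = 0"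
  proof (rule pairing_inject)
    show "toeplitz q (conj_fun g) k' \<in> Hp q" by (intro qp.toeplitz_Hp Linf_conj g k')
    fix f assume f: "f \<in> Hp p"
    show "pairing f (toeplitz q (conj_fun g) k') = 0"
      using pairing_toeplitz[OF g f k'] pk[OF toeplitz_Hp[OF g f]] k(2) f by simp
  qed
  then have "k' = 0" using inj k' by blast
  then show thesis using pk[OF w] k(3) by (simp add: pairing_def)
qed (use e that in blast)

text \<open>Elements of the Hardy space norm their dual up to a constant: take the analytic part of the dual
  element of \<open>w\<close>.\<close>

lemma Hp_norming:
  obtains c where "c > 0" "\<And>w. w \<in> Hp q \<Longrightarrow> \<exists>x\<in>Hp p. Lp_norm p x \<le> 1 \<and> c * Lp_norm q w \<le> cmod (pairing x w)"
proof -
  obtain C where C: "C > 0" "\<And>f. f \<in> Lp p \<Longrightarrow> Lp_norm p (riesz_P p f) \<le> C * Lp_norm p f"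
    using riesz_P_bound by blast
  have "\<exists>x\<in>Hp p. Lp_norm p x \<le> 1 \<and> (1 / C) * Lp_norm q w \<le> cmod (pairing x w)" if w: "w \<in> Hp q" for w
  proof (cases "Lp_norm q w = 0")
    case True
    then show ?thesis by (intro bexI[of _ 0]) auto
  next
    case False
    define n where "n = Lp_norm q w"
    have n: "n > 0" using False Lp_norm_nonneg[of q w] by (auto simp: n_def less_le)
    define k where "k = dual_elt q w"
    have k: "k \<in> Lp p" unfolding k_def by (rule qp.dual_elt_Lq[OF Hp_Lp[OF w]])
    have nk: "Lp_norm p k = n powr (q - 1)"
    proof -
      have "Lp_norm p k = (Lp_norm p k powr p) powr (1 / p)" using p_gt_1 by (simp add: powr_powr)
      also have "\<dots> = n powr (q / p)" unfolding k_def qp.dual_elt_norm by (simp add: powr_powr n_def)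
      also have "q / p = q - 1" using p_gt_1 q_gt_1 exponent_eqs by (simp add: field_simps)
      finally show ?thesis .
    qed
    define x where "x = cscale (of_real (1 / (C * n powr (q - 1)))) (riesz_P p k)"
    have x: "x \<in> Hp p" unfolding x_def by (intro Hp_cscale riesz_P_Hp k)
    have npos: "n powr (q - 1) > 0" using n by simp
    have "Lp_norm p x = 1 / (C * n powr (q - 1)) * Lp_norm p (riesz_P p k)"
      unfolding x_def using C(1) npos by (simp add: Lp_norm_cscale p_nonneg norm_divide norm_mult del: of_real_divide of_real_mult)
    also have "\<dots> \<le> 1 / (C * n powr (q - 1)) * (C * n powr (q - 1))"
      using C(2)[OF k] C(1) npos unfolding nk by (intro mult_left_mono) auto
    also have "\<dots> = 1" using C(1) npos by simp
    finally have x1: "Lp_norm p x \<le> 1" .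
    have "pairing k w = of_real (n powr q)"
      using pairing_commute[of k w] qp.pairing_dual_elt[of w] by (simp add: k_def n_def)
    then have "cmod (pairing x w) = 1 / (C * n powr (q - 1)) * n powr q"
      unfolding x_def pairing_cscale_left using pairing_riesz_P_left[OF k w] C(1) npos
      by (simp add: norm_mult norm_divide del: of_real_divide of_real_mult)
    also have "n powr q = n powr (q - 1) * n" using powr_mult_base[of n "q - 1"] n by (simp add: mult.commute)
    also have "1 / (C * n powr (q - 1)) * (n powr (q - 1) * n) = (1 / C) * n" using C(1) npos by simp
    finally show ?thesis using x x1 by (auto simp: n_def)
  qed
  then show thesis using C(1) that[of "1 / C"] by simp
qed

text \<open>A gliding hump, as in Sokal's proof of the uniform boundedness principle. If the adjoint were not
  bounded below, there would be \<open>v n\<close> with \<open>T(conj g)(v n)\<close> much shorter than \<open>r\<^sup>n v n\<close>. Moving by \<open>\<plusminus>r\<^sup>n y n\<close>,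
  with \<open>y n\<close> norming \<open>v n\<close> and the sign chosen well, produces \<open>x = T(g)u\<close> whose pairing with \<open>v n\<close> is at least
  \<open>(c/2) r\<^sup>n\<close> times the norm of \<open>v n\<close>; but that pairing equals the pairing of \<open>u\<close> with \<open>T(conj g)(v n)\<close>.\<close>

lemma toeplitz_adjoint_bounded_below:
  assumes g: "g \<in> Linf" and surj: "\<And>w. w \<in> Hp p \<Longrightarrow> \<exists>u\<in>Hp p. toeplitz p g u = w"
  obtains c where "c > 0" "\<And>v. v \<in> Hp q \<Longrightarrow> c * Lp_norm q v \<le> Lp_norm q (toeplitz q (conj_fun g) v)"
proof (rule ccontr)
  note witness = that
  assume neg: "\<not> thesis"
  let ?A = "toeplitz q (conj_fun g)"
  have small: "\<exists>v\<in>Hp q. Lp_norm q (?A v) < c * Lp_norm q v" if c: "c > 0" for c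
  proof (rule ccontr)
    assume "\<not> ?thesis"
    then have "c * Lp_norm q v \<le> Lp_norm q (?A v)" if "v \<in> Hp q" for v using that by (auto simp: not_less)
    from witness[OF c this] neg show False by blast
  qed
  obtain c where c: "c > 0" "\<And>w. w \<in> Hp q \<Longrightarrow> \<exists>x\<in>Hp p. Lp_norm p x \<le> 1 \<and> c * Lp_norm q w \<le> cmod (pairing x w)"
    using Hp_norming by blast
  \<comment> \<open>With this ratio the tail \<open>r ^ (n+1) + r ^ (n+2) + \<dots>\<close> equals \<open>(c / 2) * r ^ n\<close>, half of the n-th hump.\<close>
  define r where "r = c / (2 + c)"
  have r: "0 < r" "r < 1" "r = (c / 2) * (1 - r)" using c(1) by (auto simp: r_def field_simps)
  have "\<exists>v\<in>Hp q. Lp_norm q (?A v) < (r ^ n / real (Suc n)) * Lp_norm q v" for n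
    by (rule small) (use r in simp)
  then obtain v where v: "\<And>n. v n \<in> Hp q" "\<And>n. Lp_norm q (?A (v n)) < (r ^ n / real (Suc n)) * Lp_norm q (v n)" by metis
  have vpos: "Lp_norm q (v n) > 0" for n
  proof -
    have "0 < (r ^ n / real (Suc n)) * Lp_norm q (v n)" using v(2)[of n] Lp_norm_nonneg[of q "?A (v n)"] by linarith
    then show ?thesis using r by (simp add: zero_less_mult_iff zero_less_divide_iff)
  qed
  have "\<forall>n. \<exists>x. x \<in> Hp p \<and> Lp_norm p x \<le> 1 \<and> c * Lp_norm q (v n) \<le> cmod (pairing x (v n))"
    using c(2)[OF v(1)] by blast
  then obtain y where y: "\<And>n. y n \<in> Hp p" "\<And>n. Lp_norm p (y n) \<le> 1" "\<And>n. c * Lp_norm q (v n) \<le> cmod (pairing (y n) (v n))"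
    unfolding choice_iff by blast
  define X where "X = rec_nat (0 :: tfun) (\<lambda>n x. let z = cscale (of_real (r ^ Suc n)) (y (Suc n))
     in if cmod (pairing (x - z) (v (Suc n))) \<le> cmod (pairing (x + z) (v (Suc n))) then x + z else x - z)"
  have X0: "X 0 = 0" by (simp add: X_def)
  have XS: "\<exists>z. (z = cscale (of_real (r ^ Suc n)) (y (Suc n)) \<or> z = - cscale (of_real (r ^ Suc n)) (y (Suc n))) \<and>
      X (Suc n) = X n + z \<and> cmod (pairing (X n - z) (v (Suc n))) \<le> cmod (pairing (X n + z) (v (Suc n)))" for n
    unfolding X_def by (auto simp: Let_def intro: less_imp_le)
  obtain z where z: "\<And>n. z n = cscale (of_real (r ^ Suc n)) (y (Suc n)) \<or> z n = - cscale (of_real (r ^ Suc n)) (y (Suc n))"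
      "\<And>n. X (Suc n) = X n + z n" "\<And>n. cmod (pairing (X n - z n) (v (Suc n))) \<le> cmod (pairing (X n + z n) (v (Suc n)))"
    using XS by metis
  have zH: "z n \<in> Hp p" for n
  proof -
    have "cscale (of_real (r ^ Suc n)) (y (Suc n)) \<in> Hp p" by (rule Hp_cscale[OF y(1)])
    then show ?thesis using z(1)[of n] Hp_cscale[of "cscale (of_real (r ^ Suc n)) (y (Suc n))" "-1"] by (auto simp: cscale_minus_one)
  qed
  have zn: "Lp_norm p (z n) \<le> r ^ Suc n" for n
  proof -
    have "Lp_norm p (z n) = r ^ Suc n * Lp_norm p (y (Suc n))"
      using z(1)[of n] r p_nonneg by (auto simp: Lp_norm_cscale norm_power norm_mult)
    also have "\<dots> \<le> r ^ Suc n * 1" using y(2)[of "Suc n"] r by (intro mult_left_mono) auto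
    finally show ?thesis by simp
  qed
  have zp: "c * (r ^ Suc n * Lp_norm q (v (Suc n))) \<le> cmod (pairing (z n) (v (Suc n)))" for n
  proof -
    have "cmod (pairing (z n) (v (Suc n))) = r ^ Suc n * cmod (pairing (y (Suc n)) (v (Suc n)))"
    proof -
      have "pairing (- f) w = - pairing f w" for f w using pairing_cscale_left[of "-1" f w] by (simp add: cscale_minus_one)
      then show ?thesis using z(1)[of n] r by (auto simp: pairing_cscale_left norm_mult norm_power simp del: of_real_power power_Suc)
    qed
    moreover have "r ^ Suc n * (c * Lp_norm q (v (Suc n))) \<le> r ^ Suc n * cmod (pairing (y (Suc n)) (v (Suc n)))"
      using y(3)[of "Suc n"] r by (intro mult_left_mono) auto
    ultimately show ?thesis by (simp only: mult.left_commute)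
  qed
  have XH: "X n \<in> Hp p" for n by (induction n) (auto simp: X0 z(2) zH intro: Hp_add)
  have Xdist: "Lp_norm p (X (n + k) - X n) \<le> (c / 2) * (r ^ n - r ^ (n + k))" for n k
  proof (induction k)
    case (Suc k)
    have "Lp_norm p (X (n + Suc k) - X n) \<le> Lp_norm p (X (n + k) - X n) + Lp_norm p (z (n + k))"
      using Lp_norm_triangle[OF p_nonneg(3) Hp_Lp[OF Hp_diff[OF XH[of "n + k"] XH[of n]]] Hp_Lp[OF zH[of "n + k"]]]
      by (simp add: z(2) algebra_simps)
    also have "\<dots> \<le> (c / 2) * (r ^ n - r ^ (n + k)) + r * r ^ (n + k)"
      using Suc zn[of "n + k"] by simp
    also have "r * r ^ (n + k) = (c / 2) * (1 - r) * r ^ (n + k)" using r(3) by simp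
    also have "(c / 2) * (r ^ n - r ^ (n + k)) + (c / 2) * (1 - r) * r ^ (n + k) = (c / 2) * (r ^ n - r ^ (n + Suc k))"
    proof -
      have "h * (A - B) + h * (1 - r) * B = h * (A - r * B)" for h A B by (simp add: algebra_simps)
      then show ?thesis by (simp only: add_Suc_right power_Suc)
    qed
    finally show ?case .
  qed simp
  have Xle: "Lp_norm p (X m - X n) \<le> (c / 2) * r ^ n" if "n \<le> m" for m n
  proof -
    have "(c / 2) * (r ^ n - r ^ (n + (m - n))) \<le> (c / 2) * r ^ n" using c(1) r by (intro mult_left_mono) auto
    from order_trans[OF Xdist this] show ?thesis by (simp only: le_add_diff_inverse[OF that])
  qed
  have rlim: "(\<lambda>n. (c / 2) * r ^ n) \<longlonglongrightarrow> 0"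
    using tendsto_mult_left[OF LIMSEQ_realpow_zero[of r], of "c / 2"] r(1,2) by simp
  have Cauchy: "\<exists>N. \<forall>i\<ge>N. \<forall>j\<ge>N. Lp_norm p (X i - X j) < e" if e: "e > 0" for e
  proof -
    have "\<forall>\<^sub>F n in sequentially. (c / 2) * r ^ n < e" by (rule order_tendstoD(2)[OF rlim e])
    then obtain N where N: "\<And>n. n \<ge> N \<Longrightarrow> (c / 2) * r ^ n < e" by (auto simp: eventually_sequentially)
    have "Lp_norm p (X i - X j) < e" if "i \<ge> N" "j \<ge> N" for i j
    proof (cases "j \<le> i")
      case True
      then show ?thesis using Xle[OF True] N[OF that(2)] by linarith
    next
      case False
      then show ?thesis using Xle[of i j] N[OF that(1)] Lp_norm_minus_commute[of p "X i" "X j"] by simp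
    qed
    then show ?thesis by blast
  qed
  obtain x where x: "x \<in> Lp p" "(\<lambda>n. Lp_norm p (X n - x)) \<longlonglongrightarrow> 0"
    using Lp_complete[OF p_gt_1 Hp_Lp[OF XH] Cauchy] by blast
  have xH: "x \<in> Hp p" by (rule Hp_closed[OF XH x])
  have xX: "Lp_norm p (x - X n) \<le> (c / 2) * r ^ n" for n
  proof (rule LIMSEQ_le_const)
    show "(\<lambda>m. Lp_norm p (X m - x) + (c / 2) * r ^ n) \<longlonglongrightarrow> (c / 2) * r ^ n"
      using tendsto_add[OF x(2) tendsto_const] by simp
    have "Lp_norm p (x - X n) \<le> Lp_norm p (X m - x) + (c / 2) * r ^ n" if "m \<ge> n" for m
      using Lp_norm_triangle_diff[OF p_nonneg(3) x(1) Hp_Lp[OF XH[of m]] Hp_Lp[OF XH[of n]]] Xle[OF that] Lp_norm_minus_commute[of p x "X m"]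
      by linarith
    then show "\<exists>N. \<forall>m\<ge>N. Lp_norm p (x - X n) \<le> Lp_norm p (X m - x) + (c / 2) * r ^ n" by blast
  qed
  obtain u where u: "u \<in> Hp p" "toeplitz p g u = x" using surj[OF xH] by blast
  have le: "(c / 2) * real (Suc (Suc n)) \<le> Lp_norm p u" for n
  proof -
    let ?v = "v (Suc n)" and ?R = "r ^ Suc n"
    have vL: "?v \<in> Lp q" by (rule Hp_Lp[OF v(1)])
    \<comment> \<open>One of the two candidates X n + z n, X n - z n pairs with v as strongly as z n does.\<close>
    have "pairing (X n + z n) ?v - pairing (X n - z n) ?v = 2 * pairing (z n) ?v"
      using pairing_add_left[OF Hp_Lp[OF XH[of n]] Hp_Lp[OF zH[of n]] vL] pairing_diff_left[OF Hp_Lp[OF XH[of n]] Hp_Lp[OF zH[of n]] vL] by simp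
    then have "2 * cmod (pairing (z n) ?v) \<le> cmod (pairing (X n + z n) ?v) + cmod (pairing (X n - z n) ?v)"
      by (metis norm_mult norm_numeral norm_triangle_ineq4)
    then have big: "c * (?R * Lp_norm q ?v) \<le> cmod (pairing (X (Suc n)) ?v)"
      using z(3)[of n] zp[of n] unfolding z(2) by linarith
    have "cmod (pairing (x - X (Suc n)) ?v) \<le> Lp_norm p (x - X (Suc n)) * Lp_norm q ?v"
      by (rule pairing_bound[OF Hp_Lp[OF Hp_diff[OF xH XH]] vL])
    also have "\<dots> \<le> (c / 2) * ?R * Lp_norm q ?v"
      using xX[of "Suc n"] by (intro mult_right_mono) auto
    finally have sm: "cmod (pairing (x - X (Suc n)) ?v) \<le> (c / 2) * ?R * Lp_norm q ?v" .
    have "cmod (pairing (X (Suc n)) ?v) \<le> cmod (pairing x ?v) + cmod (pairing (x - X (Suc n)) ?v)"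
      using pairing_diff_left[OF x(1) Hp_Lp[OF XH[of "Suc n"]] vL] norm_triangle_ineq4[of "pairing x ?v" "pairing (x - X (Suc n)) ?v"] by simp
    then have low: "(c / 2) * ?R * Lp_norm q ?v \<le> cmod (pairing x ?v)"
      using big sm by (simp only: mult.assoc)
    have "cmod (pairing x ?v) = cmod (pairing u (?A ?v))" using pairing_toeplitz[OF g u(1) v(1)] u(2) by simp
    also have "\<dots> \<le> Lp_norm p u * Lp_norm q (?A ?v)"
      by (intro pairing_bound Hp_Lp u qp.toeplitz_Hp Linf_conj g v)
    also have "\<dots> \<le> Lp_norm p u * ((?R / real (Suc (Suc n))) * Lp_norm q ?v)"
      using v(2)[of "Suc n"] by (intro mult_left_mono) auto
    finally have "(c / 2) * ?R * Lp_norm q ?v \<le> Lp_norm p u * ((?R / real (Suc (Suc n))) * Lp_norm q ?v)"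
      using low by linarith
    then have "(c / 2) * (?R * Lp_norm q ?v) \<le> (Lp_norm p u / real (Suc (Suc n))) * (?R * Lp_norm q ?v)"
      by (simp only: mult_ac times_divide_eq_left times_divide_eq_right)
    then have "c / 2 \<le> Lp_norm p u / real (Suc (Suc n))"
      by (rule mult_right_le_imp_le) (use r vpos in simp)
    then show ?thesis by (simp add: pos_le_divide_eq del: of_nat_Suc)
  qed
  obtain N where "Lp_norm p u / (c / 2) < real N" using reals_Archimedean2 by blast
  then have "Lp_norm p u < (c / 2) * real N" using c(1) by (simp add: field_simps)
  also have "\<dots> \<le> (c / 2) * real (Suc (Suc N))" using c(1) by (intro mult_left_mono) auto
  finally show False using le[of N] by simp
qed

end

lemma module_hom_tpow: "module_hom cscale cscale ((*) (tpow k))"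
  unfolding module_hom_iff using cvs.module_axioms by (auto simp: distrib_left)

lemma inj_tpow_mult: "inj ((*) (tpow k))"
  by (rule inj_on_inverseI[of _ "(*) (tpow (- k))"]) (simp flip: mult.assoc)

lemma finite_dim_basis:
  assumes "finite_dim S"
  obtains B where "finite B" "B \<subseteq> S" "cvs.independent B" "S \<subseteq> cvs.span B" "card B = cvs.dim S"
proof -
  obtain A where A: "finite A" "S \<subseteq> cvs.span A" using assms by (auto simp: finite_dim_def)
  obtain B where B: "B \<subseteq> S" "cvs.independent B" "S \<subseteq> cvs.span B" "card B = cvs.dim S" by (rule cvs.basis_exists)
  have "finite B" using cvs.independent_span_bound[OF A(1) B(2)] A(2) B(1) by blast
  then show thesis using that B by blast
qed

lemma finite_dim_0: "finite_dim S \<Longrightarrow> cvs.dim S = 0 \<Longrightarrow> S \<subseteq> {0}"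
  by (erule finite_dim_basis) auto

context conjugate_exponents
begin

interpretation qp: conjugate_exponents q p by (rule conjugate_exponents_sym)

lemma toeplitz_tpow_right: "0 \<le> k \<Longrightarrow> f \<in> Hp p \<Longrightarrow> toeplitz p (g * tpow k) f = toeplitz p g (tpow k * f)"
  by (simp add: toeplitz_def mult.assoc)

lemma ker_toeplitz_subspace: "g \<in> Linf \<Longrightarrow> cvs.subspace (ker_op p (toeplitz p g))"
  unfolding cvs.subspace_def ker_op_def
  by (auto simp: Hp_add Hp_cscale toeplitz_add toeplitz_cscale toeplitz_eq_0_iff Hp_minus_def)

lemma toeplitz_surj_of_bounded_below:
  assumes g: "g \<in> Linf" and inj: "\<And>h. h \<in> Hp q \<Longrightarrow> toeplitz q (conj_fun g) h = 0 \<Longrightarrow> h = 0"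
    and c: "c > 0" "\<And>v. v \<in> Hp p \<Longrightarrow> c * Lp_norm p v \<le> Lp_norm p (toeplitz p g v)"
    and w: "w \<in> Hp p"
  shows "\<exists>f\<in>Hp p. toeplitz p g f = w"
proof -
  let ?T = "toeplitz p g"
  have "\<exists>f. f \<in> Hp p \<and> Lp_norm p (w - ?T f) < 1 / real (Suc n)" for n
    using toeplitz_range_dense[OF g inj w, of "1 / real (Suc n)"] by auto
  then obtain f where f: "\<And>n. f n \<in> Hp p" "\<And>n. Lp_norm p (w - ?T (f n)) < 1 / real (Suc n)" by metis
  have TL: "?T (f n) \<in> Lp p" for n by (intro Hp_Lp toeplitz_Hp g f)
  have lim1: "(\<lambda>n. 1 / real (Suc n)) \<longlonglongrightarrow> 0" by (rule LIMSEQ_Suc[OF lim_1_over_n])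
  have "\<exists>N. \<forall>i\<ge>N. \<forall>j\<ge>N. Lp_norm p (f i - f j) < e" if e: "e > 0" for e
  proof -
    have "\<forall>\<^sub>F n in sequentially. 1 / real (Suc n) < c * e / 2"
      by (rule order_tendstoD(2)[OF lim1]) (use c(1) e in simp)
    then obtain N where N: "\<And>n. n \<ge> N \<Longrightarrow> 1 / real (Suc n) < c * e / 2" by (auto simp: eventually_sequentially)
    have "Lp_norm p (f i - f j) < e" if ij: "i \<ge> N" "j \<ge> N" for i j
    proof -
      have "c * Lp_norm p (f i - f j) \<le> Lp_norm p (?T (f i) - ?T (f j))"
        using c(2)[OF Hp_diff[OF f(1)[of i] f(1)[of j]]] toeplitz_diff[OF g f(1)[of i] f(1)[of j]] by simp
      also have "\<dots> \<le> Lp_norm p (?T (f i) - w) + Lp_norm p (w - ?T (f j))"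
        by (rule Lp_norm_triangle_diff[OF p_nonneg(3) TL Hp_Lp[OF w] TL])
      also have "\<dots> < c * e"
        using f(2)[of i] f(2)[of j] N[OF ij(1)] N[OF ij(2)] Lp_norm_minus_commute[of p "?T (f i)" w] by linarith
      finally show ?thesis using c(1) by simp
    qed
    then show ?thesis by blast
  qed
  from Lp_complete[OF p_gt_1 Hp_Lp[OF f(1)] this]
  obtain x where x: "x \<in> Lp p" "(\<lambda>n. Lp_norm p (f n - x)) \<longlonglongrightarrow> 0" by blast
  have xH: "x \<in> Hp p" by (rule Hp_closed[OF f(1) x])
  obtain C where C: "C > 0" "\<And>f. f \<in> Hp p \<Longrightarrow> Lp_norm p (?T f) \<le> C * Lp_norm p f"
    using toeplitz_bound[OF g] by blast
  have "Lp_norm p (w - ?T x) \<le> 0"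
  proof (rule LIMSEQ_le_const)
    show "(\<lambda>n. 1 / real (Suc n) + C * Lp_norm p (f n - x)) \<longlonglongrightarrow> 0"
      using tendsto_add[OF lim1 tendsto_mult_left[OF x(2), of C]] by simp
    have "Lp_norm p (w - ?T x) \<le> 1 / real (Suc n) + C * Lp_norm p (f n - x)" for n
      using Lp_norm_triangle_diff[OF p_nonneg(3) Hp_Lp[OF w] TL[of n] Hp_Lp[OF toeplitz_Hp[OF g xH]]] f(2)[of n]
        C(2)[OF Hp_diff[OF f(1)[of n] xH]] toeplitz_diff[OF g f(1)[of n] xH] by simp
    then show "\<exists>N. \<forall>n\<ge>N. Lp_norm p (w - ?T x) \<le> 1 / real (Suc n) + C * Lp_norm p (f n - x)" by blast
  qed
  then have "Lp_norm p (w - ?T x) = 0" using Lp_norm_nonneg[of p "w - ?T x"] by linarith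
  then have "w - ?T x = 0"
    using Lp_norm_eq_0_iff[OF p_nonneg(2) Hp_Lp[OF Hp_diff[OF w toeplitz_Hp[OF g xH]]]] by simp
  then show ?thesis using xH by (intro bexI[of _ x]) simp
qed

section \<open>Index shift\<close>

text \<open>Multiplication by \<open>t\<close> identifies the kernel for \<open>gt\<close> with the elements of the kernel for \<open>g\<close> that
  vanish at 0, a subspace of codimension one. An element \<open>h\<close> with \<open>h(0) \<noteq> 0\<close> also corrects preimages so
  that they become divisible by \<open>t\<close>.\<close>

lemma toeplitz_surj_shift:
  assumes g: "g \<in> Linf" and surj: "\<And>w. w \<in> Hp p \<Longrightarrow> \<exists>f\<in>Hp p. toeplitz p g f = w"
    and fin: "finite_dim (ker_op p (toeplitz p g))" and dim: "cvs.dim (ker_op p (toeplitz p g)) = Suc n"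
  shows "\<And>w. w \<in> Hp p \<Longrightarrow> \<exists>f\<in>Hp p. toeplitz p (g * tpow 1) f = w"
    and "finite_dim (ker_op p (toeplitz p (g * tpow 1)))"
    and "cvs.dim (ker_op p (toeplitz p (g * tpow 1))) = n"
proof -
  let ?M = "(*) (tpow 1)"
  interpret M: module_hom cscale cscale ?M by (rule module_hom_tpow)
  define K0 K1 where "K0 = ker_op p (toeplitz p g)" and "K1 = ker_op p (toeplitz p (g * tpow 1))"
  have g1: "g * tpow 1 \<in> Linf" using g by (intro Linf_mult) auto
  have sub: "cvs.subspace K0" "cvs.subspace K1" unfolding K0_def K1_def by (intro ker_toeplitz_subspace g g1)+
  have K1_iff: "f \<in> K1 \<longleftrightarrow> f \<in> Hp p \<and> ?M f \<in> K0" for f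
    unfolding K0_def K1_def ker_op_def by (auto simp: toeplitz_tpow_right Hp_tpow_mult)
  have "K0 \<noteq> {0}"
  proof
    assume "K0 = {0}"
    then have "cvs.dim K0 \<le> card ({} :: tfun set)" by (intro cvs.dim_le_card) auto
    then show False using dim unfolding K0_def[symmetric] by simp
  qed
  moreover have "0 \<in> K0" using sub(1) by (rule cvs.subspace_0)
  ultimately obtain h0 where h0: "h0 \<in> K0" "h0 \<noteq> 0" by blast
  \<comment> \<open>Dividing a kernel element by a power of t does not leave the kernel, so some element does not vanish at 0.\<close>
  obtain h where h: "h \<in> K0" "fourier h 0 \<noteq> 0"
  proof -
    have h0H: "h0 \<in> Hp p" using h0 by (simp add: K0_def ker_op_def)
    obtain k where k: "0 \<le> k" "tpow (- k) * h0 \<in> Hp p" "fourier (tpow (- k) * h0) 0 \<noteq> 0"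
      using Hp_first_coefficient[OF conjugate_exponents_axioms h0H h0(2)] by blast
    have "g * h0 \<in> Hp_minus p" using h0 toeplitz_eq_0_iff[OF g h0H] by (simp add: K0_def ker_op_def)
    then have "tpow (- k) * (g * h0) \<in> Hp_minus p"
      using k(1) p_nonneg by (simp add: Hp_minus_def Lp_tpow_mult)
    then have "tpow (- k) * h0 \<in> K0"
      using k(2) toeplitz_eq_0_iff[OF g k(2)] by (simp add: K0_def ker_op_def mult.left_commute)
    then show thesis using that k(3) by blast
  qed
  have hH: "h \<in> Hp p" and Th: "toeplitz p g h = 0" using h by (auto simp: K0_def ker_op_def)
  have split: "tpow (-1) * (x - cscale (fourier x 0 / fourier h 0) h) \<in> Hp p" if x: "x \<in> Hp p" for x
    using x hH h(2) by (intro Hp_tpow_div Hp_diff Hp_cscale) (auto simp: fourier_diff Hp_L1 Lp_cscale)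
  have shift_back: "?M (tpow (-1) * x) = x" for x by (simp flip: mult.assoc)
  show "\<exists>f\<in>Hp p. toeplitz p (g * tpow 1) f = w" if w: "w \<in> Hp p" for w
  proof -
    obtain x where x: "x \<in> Hp p" "toeplitz p g x = w" using surj[OF w] by blast
    let ?y = "tpow (-1) * (x - cscale (fourier x 0 / fourier h 0) h)"
    have "toeplitz p (g * tpow 1) ?y = toeplitz p g (x - cscale (fourier x 0 / fourier h 0) h)"
      using toeplitz_tpow_right[of 1 ?y g] split[OF x(1)] shift_back by simp
    also have "\<dots> = w" using x hH Th by (simp add: toeplitz_diff[OF g] toeplitz_cscale[OF g] Hp_cscale)
    finally show ?thesis using split[OF x(1)] by blast
  qed
  obtain A where A: "finite A" "K0 \<subseteq> cvs.span A" using fin by (auto simp: finite_dim_def K0_def)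
  obtain B where B: "B \<subseteq> K1" "cvs.independent B" "K1 \<subseteq> cvs.span B" "card B = cvs.dim K1" by (rule cvs.basis_exists)
  have MB: "cvs.independent (?M ` B)"
    by (rule M.independent_injective_image[OF B(2)]) (use inj_tpow_mult in \<open>auto intro: inj_on_subset\<close>)
  have MBK: "?M ` B \<subseteq> K0" using B(1) K1_iff by blast
  have finMB: "finite (?M ` B)" using cvs.independent_span_bound[OF A(1) MB] A(2) MBK by blast
  have cardMB: "card (?M ` B) = card B" by (rule card_image) (rule inj_on_subset[OF inj_tpow_mult subset_UNIV])
  have finB: "finite B" by (rule finite_imageD[OF finMB inj_on_subset[OF inj_tpow_mult subset_UNIV]])
  show "finite_dim (ker_op p (toeplitz p (g * tpow 1)))" using finB B(3) by (auto simp: finite_dim_def K1_def)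
  have spanMB: "fourier x 0 = 0" if "x \<in> cvs.span (?M ` B)" for x
  proof -
    have "x \<in> ?M ` cvs.span B" using that by (simp add: M.span_image)
    moreover have "cvs.span B \<subseteq> K1" by (rule cvs.span_minimal[OF B(1) sub(2)])
    ultimately obtain y where "y \<in> K1" "x = ?M y" by blast
    then show ?thesis using K1_iff by (auto simp: Hp_iff)
  qed
  then have hn: "h \<notin> cvs.span (?M ` B)" using h(2) by blast
  then have hn': "h \<notin> ?M ` B" using cvs.span_base by blast
  have "cvs.dim K0 = Suc (card B)"
  proof (rule cvs.dim_unique)
    show "insert h (?M ` B) \<subseteq> K0" using h(1) MBK by blast
    show "cvs.independent (insert h (?M ` B))" by (rule cvs.independent_insertI[OF hn MB])
    show "card (insert h (?M ` B)) = Suc (card B)" using finMB hn' cardMB by simp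
    show "K0 \<subseteq> cvs.span (insert h (?M ` B))"
    proof
      fix x assume x: "x \<in> K0"
      then have xH: "x \<in> Hp p" by (simp add: K0_def ker_op_def)
      let ?z = "x - cscale (fourier x 0 / fourier h 0) h"
      have "?z \<in> K0" using x h(1) sub(1) by (intro cvs.subspace_diff cvs.subspace_scale)
      then have "tpow (-1) * ?z \<in> K1" using K1_iff split[OF xH] shift_back by simp
      then have "?M (tpow (-1) * ?z) \<in> ?M ` cvs.span B" using B(3) by blast
      then have "?z \<in> cvs.span (?M ` B)" unfolding M.span_image shift_back .
      then have "?z \<in> cvs.span (insert h (?M ` B))" using cvs.span_mono[of "?M ` B" "insert h (?M ` B)"] by blast
      moreover have "cscale (fourier x 0 / fourier h 0) h \<in> cvs.span (insert h (?M ` B))"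
        by (intro cvs.span_scale cvs.span_base) simp
      ultimately have "?z + cscale (fourier x 0 / fourier h 0) h \<in> cvs.span (insert h (?M ` B))" by (rule cvs.span_add)
      then show "x \<in> cvs.span (insert h (?M ` B))" by simp
    qed
  qed
  then show "cvs.dim (ker_op p (toeplitz p (g * tpow 1))) = n" using dim B(4) by (simp add: K0_def K1_def)
qed

lemma toeplitz_bijective_shift:
  assumes "g \<in> Linf" "\<And>w. w \<in> Hp p \<Longrightarrow> \<exists>f\<in>Hp p. toeplitz p g f = w"
    and "finite_dim (ker_op p (toeplitz p g))" "cvs.dim (ker_op p (toeplitz p g)) = n"
  shows "(\<forall>w\<in>Hp p. \<exists>f\<in>Hp p. toeplitz p (g * tpow (int n)) f = w) \<and>
    (\<forall>f\<in>Hp p. toeplitz p (g * tpow (int n)) f = 0 \<longrightarrow> f = 0)"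
  using assms
proof (induction n arbitrary: g)
  case 0
  then have "ker_op p (toeplitz p g) \<subseteq> {0}" by (intro finite_dim_0)
  then show ?case using 0(2) by (auto simp: ker_op_def)
next
  case (Suc n)
  have g1: "g * tpow 1 \<in> Linf" using Suc.prems(1) by (intro Linf_mult) auto
  have "g * tpow 1 * tpow (int n) = g * tpow (int (Suc n))" by (simp add: mult.assoc flip: tpow_add)
  then show ?case
    using Suc.IH[OF g1] toeplitz_surj_shift[OF Suc.prems] by simp
qed

text \<open>By Coburn's lemma one of kernel and cokernel is trivial, and nonnegative index leaves the cokernel;
  a closed dense range is everything. Shifting by the index then empties the kernel.\<close>

lemma fredholm_toeplitz_bijective:
  assumes g: "g \<in> Linf" "g * inverse g = 1" and F: "fredholm_op p q (toeplitz p g)"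
    and ind: "index_op p q (toeplitz p g) = int k"
  shows "\<And>w. w \<in> Hp p \<Longrightarrow> \<exists>f\<in>Hp p. toeplitz p (g * tpow (int k)) f = w"
    and "\<And>f. f \<in> Hp p \<Longrightarrow> toeplitz p (g * tpow (int k)) f = 0 \<Longrightarrow> f = 0"
proof -
  let ?N = "ker_op p (toeplitz p g)" and ?K = "ker_op q (toeplitz q (conj_fun g))"
  have cok: "coker_op p q (toeplitz p g) = ?K" by (rule coker_toeplitz[OF g(1)])
  have fin: "finite_dim ?N" "finite_dim ?K" "Lp_closed p (im_op p (toeplitz p g))"
    using F cok by (auto simp: fredholm_op_def)
  have K0: "?K \<subseteq> {0}"
  proof (rule ccontr)
    assume *: "\<not> ?K \<subseteq> {0}"
    then have "?N \<subseteq> {0}" using toeplitz_coburn[OF g] by (fastforce simp: ker_op_def)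
    then have "cvs.dim ?N \<le> 0" using cvs.dim_le_card[of ?N "{}"] by simp
    then have "cvs.dim ?K = 0" using ind cok by (simp add: index_op_def)
    then show False using finite_dim_0[OF fin(2)] * by blast
  qed
  then have "cvs.dim ?K \<le> 0" using cvs.dim_le_card[of ?K "{}"] by simp
  then have dimN: "cvs.dim ?N = k" using ind cok by (simp add: index_op_def)
  have inj: "h = 0" if "h \<in> Hp q" "toeplitz q (conj_fun g) h = 0" for h
    using K0 that by (auto simp: ker_op_def)
  have surj: "\<exists>f\<in>Hp p. toeplitz p g f = w" if w: "w \<in> Hp p" for w
  proof -
    have "\<exists>f. f \<in> Hp p \<and> Lp_norm p (w - toeplitz p g f) < 1 / real (Suc n)" for n
      using toeplitz_range_dense[OF g(1) inj w, of "1 / real (Suc n)"] by auto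
    then obtain f where f: "\<And>n. f n \<in> Hp p" "\<And>n. Lp_norm p (w - toeplitz p g (f n)) < 1 / real (Suc n)" by metis
    have "(\<lambda>n. Lp_norm p (toeplitz p g (f n) - w)) \<longlonglongrightarrow> 0"
    proof (rule Lim_null_comparison[OF always_eventually LIMSEQ_Suc[OF lim_1_over_n]], rule allI)
      show "norm (Lp_norm p (toeplitz p g (f n) - w)) \<le> 1 / real (Suc n)" for n
        using f(2)[of n] Lp_norm_minus_commute[of p w] by simp
    qed
    moreover have "\<forall>n. toeplitz p g (f n) \<in> im_op p (toeplitz p g)" using f(1) by (auto simp: im_op_def)
    ultimately have "w \<in> im_op p (toeplitz p g)"
      using fin(3)[unfolded Lp_closed_def, rule_format, of w "\<lambda>n. toeplitz p g (f n)"] Hp_Lp[OF w] by blast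
    then show ?thesis by (auto simp: im_op_def)
  qed
  note bij = toeplitz_bijective_shift[OF g(1) surj fin(1) dimN]
  show "\<And>w. w \<in> Hp p \<Longrightarrow> \<exists>f\<in>Hp p. toeplitz p (g * tpow (int k)) f = w" using bij by blast
  show "\<And>f. f \<in> Hp p \<Longrightarrow> toeplitz p (g * tpow (int k)) f = 0 \<Longrightarrow> f = 0" using bij by blast
qed

definition toeplitz_bij :: "tfun \<Rightarrow> bool" where
  "toeplitz_bij g \<longleftrightarrow> g \<in> Linf \<and> (\<forall>w\<in>Hp p. \<exists>f\<in>Hp p. toeplitz p g f = w) \<and>
     (\<forall>f\<in>Hp p. toeplitz p g f = 0 \<longrightarrow> f = 0)"

lemma toeplitz_bij_inj: "toeplitz_bij g \<Longrightarrow> f \<in> Hp p \<Longrightarrow> f' \<in> Hp p \<Longrightarrow> toeplitz p g f = toeplitz p g f' \<Longrightarrow> f = f'"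
  using toeplitz_diff[of g f f'] Hp_diff[of f f'] by (auto simp: toeplitz_bij_def)

end

text \<open>Surjectivity of \<open>T(g)\<close> makes the adjoint bounded below, so the range of the adjoint is closed;
  injectivity of \<open>T(g)\<close> makes it dense.\<close>

lemma (in conjugate_exponents) toeplitz_bij_conj:
  assumes g: "toeplitz_bij g" shows "conjugate_exponents.toeplitz_bij q (conj_fun g)"
proof -
  interpret qp: conjugate_exponents q p by (rule conjugate_exponents_sym)
  have gL: "g \<in> Linf" and surj: "\<And>w. w \<in> Hp p \<Longrightarrow> \<exists>f\<in>Hp p. toeplitz p g f = w"
    and inj: "\<And>f. f \<in> Hp p \<Longrightarrow> toeplitz p g f = 0 \<Longrightarrow> f = 0"
    using g by (auto simp: toeplitz_bij_def)
  obtain c where c: "c > 0" "\<And>v. v \<in> Hp q \<Longrightarrow> c * Lp_norm q v \<le> Lp_norm q (toeplitz q (conj_fun g) v)"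
    using toeplitz_adjoint_bounded_below[OF gL surj] by blast
  have "\<exists>f\<in>Hp q. toeplitz q (conj_fun g) f = w" if "w \<in> Hp q" for w
    by (rule qp.toeplitz_surj_of_bounded_below[OF Linf_conj[OF gL] _ c that]) (simp add: inj)
  moreover have "v = 0" if v: "v \<in> Hp q" "toeplitz q (conj_fun g) v = 0" for v
  proof -
    have "c * Lp_norm q v \<le> 0" using c(2)[OF v(1)] v(2) by simp
    then have "Lp_norm q v = 0" using c(1) Lp_norm_nonneg[of q v] by (simp add: mult_le_0_iff)
    then show ?thesis using Lp_norm_eq_0_iff[OF qp.p_nonneg(2) Hp_Lp[OF v(1)]] by simp
  qed
  ultimately show ?thesis using gL by (auto simp: qp.toeplitz_bij_def)
qed

text \<open>The adjoint of the adjoint: this takes the place of the open mapping theorem.\<close>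

lemma (in conjugate_exponents) toeplitz_bij_bounded_below:
  assumes g: "toeplitz_bij g"
  obtains c where "c > 0" "\<And>v. v \<in> Hp p \<Longrightarrow> c * Lp_norm p v \<le> Lp_norm p (toeplitz p g v)"
proof -
  interpret qp: conjugate_exponents q p by (rule conjugate_exponents_sym)
  have "qp.toeplitz_bij (conj_fun g)" by (rule toeplitz_bij_conj[OF g])
  then show thesis
    using qp.toeplitz_adjoint_bounded_below[of "conj_fun g" thesis] that by (auto simp: qp.toeplitz_bij_def)
qed

section \<open>Wiener--Hopf factorization\<close>

context conjugate_exponents
begin

interpretation qp: conjugate_exponents q p by (rule conjugate_exponents_sym)

lemma toeplitz_remainder: "g \<in> Linf \<Longrightarrow> f \<in> Hp p \<Longrightarrow> g * f - toeplitz p g f \<in> Hp_minus p"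
  using riesz_Q_minus[of "g * f"] p_nonneg by (simp add: riesz_Q_def toeplitz_def Linf_mult_Lp Hp_Lp)

lemma toeplitz_eqI: "w \<in> Hp p \<Longrightarrow> g * f - w \<in> Hp_minus p \<Longrightarrow> toeplitz p g f = w"
  unfolding toeplitz_def
proof (rule riesz_P_eqI)
  fix n :: int assume w: "w \<in> Hp p" and m: "g * f - w \<in> Hp_minus p" and n: "0 \<le> n"
  have "fourier ((g * f - w) + w) n = fourier (g * f - w) n + fourier w n"
    using m w by (intro fourier_add Hp_L1 Lp_subset_L1 Hp_minus_Lp)
  then show "fourier w n = fourier (g * f) n" using m n by (simp add: Hp_minus_def)
qed

lemma Hp_mult_poly: "s \<in> trig_polys {0..} \<Longrightarrow> f \<in> Hp p \<Longrightarrow> s * f \<in> Hp p"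
proof (induction rule: trig_polys_induct)
  case (step c k s)
  then show ?case by (simp add: distrib_right Hp_add Hp_cscale Hp_tpow_mult)
qed simp

lemma conj_Hp_mult_minus:
  assumes "x \<in> conj_Hp p" "y \<in> Hp_minus q" "0 \<le> n" shows "fourier (x * y) n = 0"
proof -
  have "fourier (conj_fun x * conj_fun y) (- n) = 0"
    using Hp_mult_fourier[of "conj_fun x" "conj_fun y" "- n"] assms conj_Hp_minus[OF assms(2)] by (simp add: conj_Hp_iff)
  then have "fourier (conj_fun (x * y)) (- n) = 0" by simp
  then show ?thesis unfolding fourier_conj by simp
qed

lemma Hp_mult_conj_fourier:
  assumes "x \<in> conj_Hp p" "y \<in> conj_Hp q" "0 \<le> n"
  shows "fourier (x * y) n = (if n = 0 then fourier x 0 * fourier y 0 else 0)"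
proof -
  have "fourier (conj_fun (x * y)) (- n) = (if n = 0 then cnj (fourier x 0 * fourier y 0) else 0)"
    using Hp_mult_fourier[of "conj_fun x" "conj_fun y" "- n"] assms by (simp add: conj_Hp_iff)
  then show ?thesis unfolding fourier_conj by (auto split: if_splits simp flip: complex_cnj_mult)
qed

lemma analytic_coanalytic_const:
  assumes "x \<in> Hp p" "y \<in> Hp q" "x' \<in> conj_Hp p" "y' \<in> conj_Hp q" and eq: "x * y = x' * y'"
  shows "x * y = cscale (fourier x 0 * fourier y 0) 1"
proof (rule fourier_inject)
  show "x * y \<in> Lp 1" using assms by (intro Holder Hp_Lp)
  show "fourier (x * y) n = fourier (cscale (fourier x 0 * fourier y 0) 1) n" for n
  proof (cases "n \<le> 0")
    case True
    then show ?thesis using Hp_mult_fourier[OF assms(1,2) True] by (simp add: fourier_one)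
  next
    case False
    then show ?thesis using Hp_mult_conj_fourier[OF assms(3,4), of n] eq by (simp add: fourier_one)
  qed
qed (simp add: Lp_cscale)

end

context conjugate_exponents
begin

interpretation qp: conjugate_exponents q p by (rule conjugate_exponents_sym)

text \<open>With \<open>w = g conj v\<close> one has \<open>u w = (g u) conj v\<close>, where the left side is analytic and the right side
  coanalytic. So both are the constant \<open>u(0)\<close>, which is nonzero because a Hardy space has no zero
  divisors, and this single identity inverts \<open>u\<close> and \<open>g u\<close>.\<close>

lemma
  assumes bij: "toeplitz_bij g"
    and u: "u \<in> Hp p" "toeplitz p g u = 1" and v: "v \<in> Hp q" "toeplitz q (conj_fun g) v = 1"
  shows bijective_u0: "fourier u 0 \<noteq> 0"
    and bijective_plus: "u * inverse u = 1" "inverse u \<in> Hp q"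
    and bijective_minus: "(g * u) * inverse (g * u) = 1" "inverse (g * u) = cscale (inverse (fourier u 0)) (conj_fun v)"
      "g * u \<in> conj_Hp p" "inverse (g * u) \<in> conj_Hp q" "fourier (g * u) 0 = 1"
proof -
  have g: "g \<in> Linf" using bij by (simp add: toeplitz_bij_def)
  have r1: "g * u - 1 \<in> Hp_minus p" using toeplitz_remainder[OF g u(1)] u(2) by simp
  have r2: "conj_fun g * v - 1 \<in> Hp_minus q" using qp.toeplitz_remainder[OF Linf_conj[OF g] v(1)] v(2) by simp
  have gu: "conj_fun (g * u) \<in> Hp p" "fourier (g * u) 0 = 1"
  proof -
    have "conj_fun (g * u) = conj_fun (g * u - 1) + 1" by simp
    then show "conj_fun (g * u) \<in> Hp p" using Hp_add[OF conj_Hp_minus(1)[OF r1] Hp_one] by simp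
    have "fourier ((g * u - 1) + 1) 0 = fourier (g * u - 1) 0 + fourier 1 0"
      by (rule fourier_add[OF Lp_subset_L1[OF Hp_minus_Lp[OF r1]] Lp_1_in])
    then show "fourier (g * u) 0 = 1" using r1 by (simp add: Hp_minus_def fourier_one)
  qed
  define w where "w = g * conj_fun v"
  have w: "w \<in> Hp q" "fourier w 0 = 1"
  proof -
    have "w = conj_fun (conj_fun g * v - 1) + 1" by (simp add: w_def)
    moreover have "fourier (conj_fun (conj_fun g * v - 1) + 1) 0 = fourier (conj_fun (conj_fun g * v - 1)) 0 + fourier 1 0"
      by (rule fourier_add[OF qp.Hp_L1[OF conj_Hp_minus(1)[OF r2]] Lp_1_in])
    ultimately show "w \<in> Hp q" "fourier w 0 = 1"
      using qp.Hp_add[OF conj_Hp_minus(1)[OF r2] qp.Hp_one] conj_Hp_minus(2)[OF r2] by (simp_all only:) (simp add: fourier_one)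
  qed
  have eq: "u * w = (g * u) * conj_fun v" by (simp add: w_def mult_ac)
  have const: "u * w = cscale (fourier u 0) 1"
    using analytic_coanalytic_const[OF u(1) w(1) _ _ eq] gu v by (simp add: conj_Hp_iff w(2))
  show u0: "fourier u 0 \<noteq> 0"
  proof
    assume "fourier u 0 = 0"
    then have "u * w = 0" using const by simp
    then have "u = 0 \<or> w = 0" using Hp_zero_divisor u w by blast
    moreover have "toeplitz p g 0 = 0" using toeplitz_cscale[OF g, of 0 0] by simp
    ultimately show False using u(2) w(2) by auto
  qed
  have iu: "u * cscale (inverse (fourier u 0)) w = 1" using const u0 by simp
  have inv_u: "inverse u = cscale (inverse (fourier u 0)) w" by (rule inverse_tfun_unique[OF iu])
  show "u * inverse u = 1" using iu inv_u by simp
  show "inverse u \<in> Hp q" unfolding inv_u by (rule qp.Hp_cscale[OF w(1)])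
  have igu: "(g * u) * cscale (inverse (fourier u 0)) (conj_fun v) = 1"
    unfolding cscale_times_right eq[symmetric] const using u0 by simp
  show inv_gu: "inverse (g * u) = cscale (inverse (fourier u 0)) (conj_fun v)" by (rule inverse_tfun_unique[OF igu])
  show "(g * u) * inverse (g * u) = 1" using igu inv_gu by simp
  show "g * u \<in> conj_Hp p" unfolding conj_Hp_iff by (rule gu(1))
  show "inverse (g * u) \<in> conj_Hp q" unfolding conj_Hp_iff inv_gu by (simp add: qp.Hp_cscale v(1))
  show "fourier (g * u) 0 = 1" by (rule gu(2))
qed

text \<open>The bounded operator required by the factorization is the inverse of \<open>T(g)\<close>. On \<open>t\<^sup>k\<close> it has the
  prescribed form because \<open>1/(gu)\<close> is coanalytic, so that the projection of \<open>t\<^sup>k/(gu)\<close> is a polynomial \<open>y\<close>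
  and \<open>g(uy) - t\<^sup>k\<close> has only negative frequencies.\<close>

lemma wiener_hopf_of_bijective:
  assumes bij: "toeplitz_bij g"
    and u: "u \<in> Hp p" "toeplitz p g u = 1" and v: "v \<in> Hp q" "toeplitz q (conj_fun g) v = 1"
  shows "wiener_hopf p q (g * tpow \<nu>) (g * u) \<nu> (inverse u)"
proof -
  note F = bijective_plus[OF assms] bijective_minus[OF assms]
  have g: "g \<in> Linf" and surj: "\<And>w. w \<in> Hp p \<Longrightarrow> \<exists>f\<in>Hp p. toeplitz p g f = w"
    using bij by (auto simp: toeplitz_bij_def)
  define B where "B = inv_into (Hp p) (toeplitz p g)"
  have B: "B w \<in> Hp p" "toeplitz p g (B w) = w" if "w \<in> Hp p" for w
    using surj[OF that] unfolding B_def by (auto intro: inv_into_into f_inv_into_f simp: image_iff)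
  have B_eqI: "B w = f" if "f \<in> Hp p" "toeplitz p g f = w" for f w
  proof -
    have "w \<in> Hp p" using that toeplitz_Hp[OF g] by blast
    then show ?thesis using toeplitz_bij_inj[OF bij B(1) that(1)] B(2) that(2) by simp
  qed
  have B_add: "B (f + f') = B f + B f'" if "f \<in> Hp p" "f' \<in> Hp p" for f f'
    by (rule B_eqI) (use B that in \<open>auto simp: Hp_add toeplitz_add[OF g]\<close>)
  have B_cscale: "B (cscale z f) = cscale z (B f)" if "f \<in> Hp p" for z f
    by (rule B_eqI) (use B that in \<open>auto simp: Hp_cscale toeplitz_cscale[OF g]\<close>)
  have bounded: "bounded_op_Hp p B"
  proof -
    obtain c where c: "c > 0" "\<And>v. v \<in> Hp p \<Longrightarrow> c * Lp_norm p v \<le> Lp_norm p (toeplitz p g v)"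
      using toeplitz_bij_bounded_below[OF bij] by blast
    have "Lp_norm p (B f) \<le> (1 / c) * Lp_norm p f" if "f \<in> Hp p" for f
      using c(2)[OF B(1)[OF that]] B(2)[OF that] c(1) by (simp add: field_simps)
    then show ?thesis unfolding bounded_op_Hp_def using B(1) B_add B_cscale by blast
  qed
  let ?R = "\<lambda>f. u * riesz_P q (inverse (g * u) * f)"
  have igL: "inverse (g * u) \<in> Lp q" using F(6) by (simp add: conj_Hp_def del: inverse_mult_tfun)
  have B_tpow: "B (tpow k) = ?R (tpow k)" if k: "0 \<le> k" for k
  proof (rule B_eqI)
    define z where "z = inverse (g * u) * tpow k"
    have zL: "z \<in> Lp q" unfolding z_def using qp.p_nonneg igL by (simp add: Lp_tpow_mult mult.commute[of _ "tpow k"] del: inverse_mult_tfun)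
    have zf: "fourier z n = 0" if "n > k" for n
      using F(6) that by (simp add: z_def conj_Hp_def mult.commute[of _ "tpow k"] del: inverse_mult_tfun)
    define y where "y = riesz_P q z"
    have yf: "fourier y n = (if 0 \<le> n then fourier z n else 0)" for n unfolding y_def by (rule qp.fourier_riesz_P[OF zL])
    have y_eq: "y = (\<Sum>n\<in>{0..k}. cscale (fourier y n) (tpow n))"
    proof (rule fourier_inject)
      show "y \<in> Lp 1" unfolding y_def by (intro qp.Hp_L1 qp.riesz_P_Hp zL)
      show "(\<Sum>n\<in>{0..k}. cscale (fourier y n) (tpow n)) \<in> Lp 1" by (rule trig_polys_L1[OF fourier_sum_tpow(2)]) simp
      show "fourier y n = fourier (\<Sum>n\<in>{0..k}. cscale (fourier y n) (tpow n)) n" for n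
        by (subst fourier_sum_tpow(1)) (auto simp: yf zf)
    qed
    have y: "y \<in> trig_polys {0..}"
      using fourier_sum_tpow(2)[of "{0..k}" "fourier y"] trig_polys_mono[of "{0..k}" "{0..}"] y_eq by auto
    have x: "u * y \<in> Hp p" using Hp_mult_poly[OF y u(1)] by (simp add: mult.commute)
    show "u * riesz_P q (inverse (g * u) * tpow k) \<in> Hp p" using x by (simp add: y_def z_def)
    have "g * (u * y) - tpow k = - ((g * u) * (z - y))"
    proof -
      have "(g * u) * z = ((g * u) * inverse (g * u)) * tpow k" by (simp only: z_def mult.assoc)
      then have "(g * u) * z = tpow k" by (simp only: F(3) mult_1)
      then show ?thesis by (simp add: right_diff_distrib mult.assoc)
    qed
    moreover have "fourier ((g * u) * (z - y)) n = 0" if "0 \<le> n" for n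
      using conj_Hp_mult_minus[OF F(5) _ that, of "z - y"] qp.riesz_Q_minus[OF zL] by (simp add: riesz_Q_def y_def)
    moreover have "g * (u * y) - tpow k \<in> Lp p"
      by (rule Lp_diff[OF p_nonneg(1) Linf_mult_Lp[OF p_nonneg(1) g Hp_Lp[OF x]] Linf_subset_Lp[OF p_nonneg(1) Linf_tpow]])
    ultimately have "g * (u * y) - tpow k \<in> Hp_minus p" by (simp add: Hp_minus_def)
    then have "toeplitz p g (u * y) = tpow k"
      by (intro toeplitz_eqI trig_polys_Hp p_nonneg trig_polys_tpow) (use k in auto)
    then show "toeplitz p g (u * riesz_P q (inverse (g * u) * tpow k)) = tpow k" by (simp add: y_def z_def)
  qed
  have B_poly: "B f = ?R f" if "f \<in> trig_polys {0..}" for f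
    using that
  proof (induction rule: trig_polys_induct)
    case zero
    have "riesz_P q 0 = 0" by (rule qp.riesz_P_id) simp
    moreover have "B 0 = 0" by (rule B_eqI) (use toeplitz_cscale[OF g, of 0 0] in auto)
    ultimately show ?case by simp
  next
    case (step c k f)
    have tH: "tpow k \<in> Hp p" "f \<in> Hp p"
      using trig_polys_Hp[OF p_nonneg(1)] step trig_polys_tpow by auto
    have L: "inverse (g * u) * tpow k \<in> Lp q" "inverse (g * u) * f \<in> Lp q"
      using qp.p_nonneg igL trig_polys_Linf[OF step(2)] Linf_mult_Lp[of q f "inverse (g * u)"]
      by (simp_all add: Lp_tpow_mult mult.commute[of "inverse (g * u)"] del: inverse_mult_tfun)
    have "B (cscale c (tpow k) + f) = cscale c (?R (tpow k)) + ?R f"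
      using B_add[OF Hp_cscale[OF tH(1)] tH(2)] B_cscale[OF tH(1)] B_tpow[of k] step by simp
    also have "\<dots> = ?R (cscale c (tpow k) + f)"
      using qp.riesz_P_add[OF Lp_cscale[OF L(1), of c] L(2)] qp.riesz_P_cscale[OF L(1), of c]
      by (simp add: distrib_left del: inverse_mult_tfun)
    finally show ?case .
  qed
  have fact: "g * tpow \<nu> = (g * u) * tpow \<nu> * inverse u"
  proof -
    have "(g * u) * tpow \<nu> * inverse u = (g * tpow \<nu>) * (u * inverse u)" by (simp only: mult_ac)
    then show ?thesis by (simp only: F(1) mult_1_right)
  qed
  show ?thesis
    unfolding wiener_hopf_def inverse_inverse_tfun
    using fact F u(1) bounded B_poly[unfolded trig_polys_def]
    by (auto simp: mult.commute[of "inverse u"] simp del: inverse_mult_tfun)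
qed

text \<open>Dividing the two factorizations gives \<open>t\<^sup>\<nu>\<^sup>-\<^sup>\<nu>\<^sup>'\<close> times a coanalytic function equal to an analytic function that is
  invertible; this forces \<open>\<nu> = \<nu>'\<close> and a constant quotient, which the normalisation at infinity makes 1.\<close>

lemma wiener_hopf_unique_le:
  assumes 1: "wiener_hopf p q g gm \<nu> gp" and 2: "wiener_hopf p q g gm' \<nu>' gp'" and le: "\<nu> \<le> \<nu>'"
  shows "gm = gm' \<and> gp = gp'"
proof -
  note W = 1[unfolded wiener_hopf_def] and W' = 2[unfolded wiener_hopf_def]
  define L where "L = gm * inverse gm'"
  define R where "R = inverse gp * gp'"
  have LR: "tpow (\<nu> - \<nu>') * L = R"
  proof -
    have "gm * tpow \<nu> * gp = gm' * tpow \<nu>' * gp'" using W W' by metis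
    then have "tpow (- \<nu>') * inverse gm' * inverse gp * (gm * tpow \<nu> * gp) = tpow (- \<nu>') * inverse gm' * inverse gp * (gm' * tpow \<nu>' * gp')" by simp
    moreover have "tpow (- \<nu>') * inverse gm' * inverse gp * (gm * tpow \<nu> * gp) = (gp * inverse gp) * (tpow (- \<nu>') * tpow \<nu> * L)"
      by (simp only: L_def mult_ac)
    moreover have "tpow (- \<nu>') * inverse gm' * inverse gp * (gm' * tpow \<nu>' * gp') = (gm' * inverse gm') * (tpow (- \<nu>') * tpow \<nu>') * R"
      by (simp only: R_def mult_ac)
    ultimately show ?thesis using W W' by (simp add: mult.commute[of "tpow (- \<nu>')"] flip: tpow_add)
  qed
  have R: "fourier R n = (if n = 0 then fourier (inverse gp) 0 * fourier gp' 0 else 0)" if "n \<le> 0" for n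
    unfolding R_def using Hp_mult_fourier[of "inverse gp" gp' n] W W' that by simp
  have L: "fourier L n = (if n = 0 then fourier gm 0 * fourier (inverse gm') 0 else 0)" if "n \<ge> 0" for n
    unfolding L_def using Hp_mult_conj_fourier[of gm "inverse gm'" n] W W' that by simp
  have RL1: "R \<in> Lp 1" unfolding R_def using W W' by (intro Holder Hp_Lp) auto
  have R0: "R \<noteq> 0"
  proof
    assume "R = 0"
    then have "gp * (inverse gp' * R) = 0" by simp
    moreover have "gp * (inverse gp' * R) = (gp * inverse gp) * (gp' * inverse gp')" by (simp only: R_def mult_ac)
    ultimately show False using W W' by simp
  qed
  have fR: "fourier R n = fourier L (n - (\<nu> - \<nu>'))" for n using arg_cong[OF LR, of "\<lambda>f. fourier f n"] by simp
  have "\<nu> = \<nu>'"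
  proof (rule ccontr)
    assume "\<nu> \<noteq> \<nu>'"
    then have lt: "\<nu> < \<nu>'" using le by simp
    have "fourier R n = 0" for n
    proof (cases "n < 0")
      case True then show ?thesis using R[of n] by simp
    next
      case False then show ?thesis using fR[of n] L[of "n - (\<nu> - \<nu>')"] lt by simp
    qed
    then show False using fourier_eq_0_imp[OF RL1] R0 by blast
  qed
  then have LR': "L = R" using LR by simp
  define c where "c = fourier R 0"
  have Rc: "R = cscale c 1"
  proof (rule fourier_inject[OF RL1])
    show "fourier R n = fourier (cscale c 1) n" for n
      using R[of n] L[of n] LR' by (cases "n \<le> 0") (auto simp: c_def fourier_one)
  qed (simp add: Lp_cscale)
  have "gp' = gp * R" using W W' by (metis R_def mult.assoc mult_1)
  then have gp: "gp' = cscale c gp" using Rc by simp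
  have "gm = gm' * L" using W W' by (metis L_def mult.commute mult.left_commute mult_1)
  then have gm: "gm = cscale c gm'" using Rc LR' by simp
  then have "c = 1" using W W' arg_cong[OF gm, of "\<lambda>f. fourier f 0"] by simp
  then show ?thesis using gp gm by simp
qed

lemma wiener_hopf_unique:
  assumes "wiener_hopf p q g gm \<nu> gp" "wiener_hopf p q g gm' \<nu>' gp'"
  shows "gm = gm'" "gp = gp'"
proof -
  have "gm = gm' \<and> gp = gp'"
  proof (cases "\<nu> \<le> \<nu>'")
    case True
    then show ?thesis by (rule wiener_hopf_unique_le[OF assms])
  next
    case False
    then have "\<nu>' \<le> \<nu>" by simp
    from wiener_hopf_unique_le[OF assms(2,1) this] show ?thesis by blast
  qed
  then show "gm = gm'" "gp = gp'" by blast+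
qed

lemma wh_minus_eq: "wiener_hopf p q g gm \<nu> gp \<Longrightarrow> wh_minus p q g = gm"
  unfolding wh_minus_def by (rule the_equality) (blast, blast dest: wiener_hopf_unique(1))

lemma wh_plus_eq: "wiener_hopf p q g gm \<nu> gp \<Longrightarrow> wh_plus p q g = gp"
  unfolding wh_plus_def by (rule the_equality) (blast, blast dest: wiener_hopf_unique(2))

end

section \<open>Kernels of Toeplitz plus Hankel operators\<close>

lemma flip_J_inj: "flip_J x = flip_J y \<longleftrightarrow> x = y"
  by (metis flip_J_flip_J)

lemma sgn_square: "\<epsilon> = 1 \<or> \<epsilon> = (-1 :: complex) \<Longrightarrow> \<epsilon> * \<epsilon> = 1"
  by auto

context conjugate_exponents
begin

text \<open>The image of a projection is its fixed space, and \<open>s\<close> is fixed iff \<open>J(\<delta>s) = \<epsilon>s\<close>.\<close>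

lemma im_bold_P_iff:
  assumes \<epsilon>: "\<epsilon> = 1 \<or> \<epsilon> = -1" and \<delta>: "\<delta> \<in> Linf" "\<delta> * tilde \<delta> = 1"
  shows "s \<in> im_bold_P \<epsilon> p \<delta> \<longleftrightarrow> s \<in> Hp p \<and> \<delta> * s = cscale \<epsilon> (flip_J s)"
proof
  assume "s \<in> im_bold_P \<epsilon> p \<delta>"
  then obtain f where f: "f \<in> Hp p" "toeplitz p \<delta> f = 0" "s = bold_P_sgn \<epsilon> p \<delta> f"
    by (auto simp: im_bold_P_def ker_op_def)
  have m: "\<delta> * f \<in> Hp_minus p" using f toeplitz_eq_0_iff[OF \<delta>(1)] by simp
  have s: "s = cscale (1/2) (f + cscale \<epsilon> (flip_J (\<delta> * f)))"
    using f(3) riesz_P_id[OF f(1)] riesz_Q_id[OF m] by (simp add: bold_P_sgn_def bold_P_def)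
  have "flip_J (\<delta> * f) \<in> Hp p" using m p_nonneg by (simp add: flip_J_Hp_minus)
  then have sH: "s \<in> Hp p" unfolding s by (intro Hp_cscale Hp_add f(1))
  have "\<delta> * flip_J (\<delta> * f) = flip_J f"
    using \<delta>(2) by (simp add: flip_J_mult flip: mult.assoc)
  then have "\<delta> * s = cscale (1/2) (\<delta> * f + cscale \<epsilon> (flip_J f))" unfolding s by (simp add: distrib_left)
  also have "\<dots> = cscale \<epsilon> (flip_J s)"
    unfolding s using sgn_square[OF \<epsilon>] by (simp add: cscale_add add.commute mult.left_commute mult.commute)
  finally show "s \<in> Hp p \<and> \<delta> * s = cscale \<epsilon> (flip_J s)" using sH by blast
next
  assume s: "s \<in> Hp p \<and> \<delta> * s = cscale \<epsilon> (flip_J s)"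
  have m: "\<delta> * s \<in> Hp_minus p" using s p_nonneg by (simp add: flip_J_Hp Hp_minus_cscale)
  then have ker: "s \<in> ker_op p (toeplitz p \<delta>)" using s toeplitz_eq_0_iff[OF \<delta>(1)] by (simp add: ker_op_def)
  have "bold_P_sgn \<epsilon> p \<delta> s = cscale (1/2) (s + cscale \<epsilon> (flip_J (\<delta> * s)))"
    using s riesz_P_id[of s] riesz_Q_id[OF m] by (simp add: bold_P_sgn_def bold_P_def)
  also have "\<dots> = cscale (1/2) (s + s)" using s sgn_square[OF \<epsilon>] by simp
  also have "\<dots> = s" using cvs.scale_left_distrib[of "1/2" "1/2" s] by (simp add: cscale_add)
  finally show "s \<in> im_bold_P \<epsilon> p \<delta>" using ker by (metis im_bold_P_def image_eqI)
qed

text \<open>A function \<open>f\<close> of the Hardy space is in the kernel iff \<open>\<alpha>f + \<epsilon>\<beta>Jf\<close> is a flip \<open>Js\<close> of a Hardy function.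
  The matching condition makes the equation obtained by flipping proportional to the original one,
  which yields \<open>\<delta>s = \<epsilon>Js\<close>. With \<open>h = s / tilde \<alpha>\<close> the equation becomes \<open>\<gamma>f + \<epsilon>Jf = \<epsilon>h\<close>, and the terms of
  \<open>\<phi>(s)\<close> are arranged so that \<open>\<gamma>\<phi>(s) + \<epsilon>J\<phi>(s) = 2h\<close>. The set \<open>U\<close> collects the solutions of the homogeneous
  equation.\<close>

lemma ker_toeplitz_hankel:
  assumes \<alpha>: "\<alpha> \<in> Linf" "\<alpha> * inverse \<alpha> = 1" "inverse \<alpha> \<in> Linf"
    and \<beta>: "\<beta> \<in> Linf" "\<beta> * inverse \<beta> = 1" and match: "\<alpha> * tilde \<alpha> = \<beta> * tilde \<beta>"
    and \<epsilon>: "\<epsilon> = 1 \<or> \<epsilon> = -1"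
    and \<gamma>: "\<gamma> = \<alpha> * inverse \<beta>" "\<gamma> \<in> Linf" and \<delta>: "\<delta> = \<beta> * inverse (tilde \<alpha>)" "\<delta> \<in> Linf"
    and R: "\<And>f. f \<in> Hp p \<Longrightarrow> toeplitz_rinv p q \<gamma> f \<in> Hp p"
      "\<And>f. f \<in> Hp p \<Longrightarrow> toeplitz p \<gamma> (toeplitz_rinv p q \<gamma> f) = f" "toeplitz_rinv p q \<gamma> 0 = 0"
  defines "U \<equiv> {f \<in> Hp p. \<gamma> * f = cscale (- \<epsilon>) (flip_J f)}"
    and "V \<equiv> phi \<epsilon> p q \<alpha> \<beta> ` im_bold_P \<epsilon> p \<delta>"
  shows "ker_op p (\<lambda>f. toeplitz p \<alpha> f + cscale \<epsilon> (hankel p \<beta> f)) = {u + v | u v. u \<in> U \<and> v \<in> V}"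
    and "U \<inter> V = {0}"
proof -
  note ee = sgn_square[OF \<epsilon>]
  have ti: "tilde x * inverse (tilde x) = 1" if "x * inverse x = 1" for x
    using arg_cong[OF that, of tilde] by simp
  note cancel = \<alpha>(2) \<beta>(2) ti[OF \<alpha>(2)] ti[OF \<beta>(2)]
  define \<alpha>' where "\<alpha>' = inverse (tilde \<alpha>)"
  have \<alpha>'L: "\<alpha>' \<in> Linf" using Linf_tilde[OF \<alpha>(3)] by (simp add: \<alpha>'_def)
  have \<gamma>\<gamma>: "\<gamma> * tilde \<gamma> = 1"
  proof -
    have "\<gamma> * tilde \<gamma> = (\<alpha> * tilde \<alpha>) * (inverse \<beta> * inverse (tilde \<beta>))" by (simp add: \<gamma>(1) mult_ac)
    also have "\<dots> = (\<beta> * inverse \<beta>) * (tilde \<beta> * inverse (tilde \<beta>))" unfolding match by (simp only: mult_ac)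
    finally show ?thesis using cancel by simp
  qed
  have \<delta>\<delta>: "\<delta> * tilde \<delta> = 1"
  proof -
    have "\<delta> * tilde \<delta> = (\<beta> * tilde \<beta>) * (inverse \<alpha> * inverse (tilde \<alpha>))" by (simp add: \<delta>(1) mult_ac)
    also have "\<dots> = (\<alpha> * inverse \<alpha>) * (tilde \<alpha> * inverse (tilde \<alpha>))" unfolding match[symmetric] by (simp only: mult_ac)
    finally show ?thesis using cancel by simp
  qed
  have \<beta>\<gamma>: "\<beta> * \<gamma> = \<alpha>"
  proof -
    have "\<beta> * \<gamma> = \<alpha> * (\<beta> * inverse \<beta>)" by (simp only: \<gamma>(1) mult_ac)
    then show ?thesis using cancel by simp
  qed
  have \<beta>\<alpha>': "\<beta> * \<alpha>' = \<delta>" by (simp add: \<alpha>'_def \<delta>(1))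
  have \<gamma>'_eq: "tilde \<beta> * tilde \<gamma> = tilde \<alpha>" using arg_cong[OF \<beta>\<gamma>, of tilde] by simp
  note imP = im_bold_P_iff[OF \<epsilon> \<delta>(2) \<delta>\<delta>]
  have J_h: "flip_J (\<alpha>' * s) = cscale \<epsilon> (tilde \<gamma> * (\<alpha>' * s))" if s: "\<delta> * s = cscale \<epsilon> (flip_J s)" for s
  proof -
    have J: "flip_J s = cscale \<epsilon> (\<delta> * s)" using s ee by simp
    have "flip_J (\<alpha>' * s) = inverse \<alpha> * flip_J s" by (simp add: flip_J_mult \<alpha>'_def)
    also have "\<dots> = cscale \<epsilon> (inverse \<alpha> * \<beta> * (\<alpha>' * s))" unfolding J \<beta>\<alpha>'[symmetric] by (simp add: mult_ac)
    also have "inverse \<alpha> * \<beta> = tilde \<gamma>"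
    proof -
      have "inverse \<alpha> * \<beta> * (\<gamma> * tilde \<gamma>) = (\<alpha> * inverse \<alpha>) * tilde \<gamma>" unfolding \<beta>\<gamma>[symmetric] by (simp only: mult_ac)
      then show ?thesis using \<gamma>\<gamma> cancel by simp
    qed
    finally show ?thesis .
  qed
  have phi_props: "phi \<epsilon> p q \<alpha> \<beta> s \<in> Hp p \<and> \<gamma> * phi \<epsilon> p q \<alpha> \<beta> s + cscale \<epsilon> (flip_J (phi \<epsilon> p q \<alpha> \<beta> s)) = cscale 2 (\<alpha>' * s)"
    if s: "s \<in> Hp p" "\<delta> * s = cscale \<epsilon> (flip_J s)" for s
  proof -
    define h where "h = \<alpha>' * s"
    have hL: "h \<in> Lp p" unfolding h_def using p_nonneg \<alpha>'L s(1) by (intro Linf_mult_Lp Hp_Lp) auto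
    define r where "r = toeplitz_rinv p q \<gamma> (riesz_P p h)"
    have r: "r \<in> Hp p" "toeplitz p \<gamma> r = riesz_P p h" unfolding r_def using R riesz_P_Hp[OF hL] by auto
    have \<gamma>rL: "\<gamma> * r \<in> Lp p" using p_nonneg \<gamma>(2) r(1) by (intro Linf_mult_Lp Hp_Lp) auto
    define A where "A = riesz_Q p (\<gamma> * r)"
    define B where "B = riesz_Q p h"
    have \<phi>: "phi \<epsilon> p q \<alpha> \<beta> s = r - cscale \<epsilon> (flip_J A) + cscale \<epsilon> (flip_J B)"
      by (simp add: phi_def subordinated_pair_def Let_def toeplitz_def A_def B_def r_def h_def \<alpha>'_def
          riesz_P_id[OF r(1)[unfolded r_def h_def \<alpha>'_def]] flip: \<gamma>(1))
    have AB: "A \<in> Hp_minus p" "B \<in> Hp_minus p" unfolding A_def B_def by (intro riesz_Q_minus \<gamma>rL hL)+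
    have \<phi>H: "phi \<epsilon> p q \<alpha> \<beta> s \<in> Hp p" unfolding \<phi>
      using AB r(1) p_nonneg by (intro Hp_add Hp_diff Hp_cscale) (auto simp: flip_J_Hp_minus)
    have \<gamma>r: "\<gamma> * r = riesz_P p h + A" using r(2) by (simp add: A_def riesz_Q_def toeplitz_def)
    have h: "h = riesz_P p h + B" by (simp add: B_def riesz_Q_def)
    have AB': "\<gamma> * r - A + B = h" using \<gamma>r h by (metis add_diff_cancel_right')
    have Jr: "flip_J r = \<gamma> * flip_J (\<gamma> * r)" using \<gamma>\<gamma> by (simp add: flip_J_mult flip: mult.assoc)
    have Jh: "\<gamma> * flip_J h = cscale \<epsilon> h"
    proof -
      have "\<gamma> * flip_J h = cscale \<epsilon> (\<gamma> * (tilde \<gamma> * h))" unfolding h_def J_h[OF s(2)] by simp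
      also have "\<gamma> * (tilde \<gamma> * h) = (\<gamma> * tilde \<gamma>) * h" by (simp only: mult.assoc)
      finally show ?thesis using \<gamma>\<gamma> by simp
    qed
    have "\<gamma> * phi \<epsilon> p q \<alpha> \<beta> s + cscale \<epsilon> (flip_J (phi \<epsilon> p q \<alpha> \<beta> s))
        = \<gamma> * r - cscale \<epsilon> (\<gamma> * flip_J A) + cscale \<epsilon> (\<gamma> * flip_J B) + (cscale \<epsilon> (flip_J r) - A + B)"
      unfolding \<phi> using ee by (simp add: distrib_left right_diff_distrib cscale_add cscale_diff)
    also have "\<dots> = (\<gamma> * r - A + B) + cscale \<epsilon> (\<gamma> * flip_J (\<gamma> * r - A + B))"
      unfolding Jr by (simp add: distrib_left right_diff_distrib cscale_add cscale_diff)
    also have "\<dots> = h + cscale \<epsilon> (cscale \<epsilon> h)" unfolding AB' Jh ..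
    also have "\<dots> = cscale 2 h" using ee cvs.scale_left_distrib[of 1 1 h] by simp
    finally show ?thesis using \<phi>H by (simp add: h_def)
  qed
  \<comment> \<open>Membership in the kernel, after multiplication by the inverse of \<open>\<beta>\<close>.\<close>
  have ker_iff: "f \<in> ker_op p (\<lambda>f. toeplitz p \<alpha> f + cscale \<epsilon> (hankel p \<beta> f)) \<longleftrightarrow>
      f \<in> Hp p \<and> \<alpha> * f + cscale \<epsilon> (\<beta> * flip_J f) \<in> Hp_minus p" for f
  proof (cases "f \<in> Hp p")
    case True
    have L: "\<alpha> * f \<in> Lp p" "\<beta> * flip_J f \<in> Lp p"
      using True p_nonneg \<alpha> \<beta> by (auto intro!: Linf_mult_Lp simp: Lp_flip_J Hp_Lp)
    have "toeplitz p \<alpha> f + cscale \<epsilon> (hankel p \<beta> f) = riesz_P p (\<alpha> * f + cscale \<epsilon> (\<beta> * flip_J f))"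
      using L by (simp add: toeplitz_def hankel_eq[OF True] riesz_P_add Lp_cscale riesz_P_cscale)
    then show ?thesis
      using True riesz_P_eq_0_iff[OF Lp_add[OF p_nonneg(1) L(1) Lp_cscale[OF L(2), of \<epsilon>]]] by (simp add: ker_op_def)
  qed (simp add: ker_op_def)
  have \<beta>mult: "\<beta> * (\<gamma> * f + cscale \<epsilon> (flip_J f)) = \<alpha> * f + cscale \<epsilon> (\<beta> * flip_J f)" for f
    using \<beta>\<gamma> by (simp add: distrib_left flip: mult.assoc)
  have \<beta>cancel: "x = y" if "\<beta> * x = \<beta> * y" for x y
  proof -
    have "inverse \<beta> * (\<beta> * x) = inverse \<beta> * (\<beta> * y)" using that by simp
    then have "(\<beta> * inverse \<beta>) * x = (\<beta> * inverse \<beta>) * y" by (simp only: mult_ac)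
    then show ?thesis using cancel by simp
  qed
  have U_iff: "f \<in> U \<longleftrightarrow> f \<in> Hp p \<and> \<gamma> * f + cscale \<epsilon> (flip_J f) = 0" for f
    unfolding U_def using cvs.scale_minus_left[of \<epsilon> "flip_J f"] by (auto simp: eq_neg_iff_add_eq_0)
  have phi_ker: "phi \<epsilon> p q \<alpha> \<beta> s \<in> ker_op p (\<lambda>f. toeplitz p \<alpha> f + cscale \<epsilon> (hankel p \<beta> f))"
    if s: "s \<in> Hp p" "\<delta> * s = cscale \<epsilon> (flip_J s)" for s
  proof -
    have "\<alpha> * phi \<epsilon> p q \<alpha> \<beta> s + cscale \<epsilon> (\<beta> * flip_J (phi \<epsilon> p q \<alpha> \<beta> s)) = \<beta> * cscale 2 (\<alpha>' * s)"
      using \<beta>mult phi_props[OF s] by metis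
    also have "\<dots> = cscale 2 (\<delta> * s)" unfolding \<beta>\<alpha>'[symmetric] by (simp add: mult_ac)
    also have "\<dots> = cscale (2 * \<epsilon>) (flip_J s)" using s(2) by simp
    finally show ?thesis unfolding ker_iff using phi_props[OF s] s(1) p_nonneg by (simp add: flip_J_Hp Hp_minus_cscale)
  qed
  show "ker_op p (\<lambda>f. toeplitz p \<alpha> f + cscale \<epsilon> (hankel p \<beta> f)) = {u + v | u v. u \<in> U \<and> v \<in> V}"
  proof (intro equalityI subsetI)
    fix f assume "f \<in> ker_op p (\<lambda>f. toeplitz p \<alpha> f + cscale \<epsilon> (hankel p \<beta> f))"
    then have f: "f \<in> Hp p" "\<alpha> * f + cscale \<epsilon> (\<beta> * flip_J f) \<in> Hp_minus p" using ker_iff by auto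
    \<comment> \<open>Scaled so that \<open>\<phi>(s)\<close> solves the same inhomogeneous equation as f.\<close>
    define s where "s = cscale (\<epsilon> / 2) (flip_J (\<alpha> * f + cscale \<epsilon> (\<beta> * flip_J f)))"
    have sH: "s \<in> Hp p" unfolding s_def using f(2) flip_J_Hp_minus[OF p_nonneg(1)] by (intro Hp_cscale) blast
    have Js: "flip_J s = cscale (\<epsilon> / 2) (\<alpha> * f + cscale \<epsilon> (\<beta> * flip_J f))" by (simp add: s_def)
    have s_eq: "s = cscale (\<epsilon> / 2) (tilde \<alpha> * flip_J f + cscale \<epsilon> (tilde \<beta> * f))"
      by (simp add: s_def flip_J_mult)
    have \<delta>\<alpha>: "\<delta> * tilde \<alpha> = \<beta>"
    proof -
      have "\<delta> * tilde \<alpha> = \<beta> * (tilde \<alpha> * inverse (tilde \<alpha>))" by (simp only: \<delta>(1) mult_ac)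
      then show ?thesis using cancel by simp
    qed
    have \<delta>\<beta>: "\<delta> * tilde \<beta> = \<alpha>"
    proof -
      have "\<delta> * tilde \<beta> = (\<beta> * tilde \<beta>) * inverse (tilde \<alpha>)" by (simp only: \<delta>(1) mult_ac)
      also have "\<dots> = \<alpha> * (tilde \<alpha> * inverse (tilde \<alpha>))" unfolding match[symmetric] by (simp only: mult_ac)
      finally show ?thesis using cancel by simp
    qed
    have "\<delta> * s = cscale (\<epsilon> / 2) (\<delta> * tilde \<alpha> * flip_J f + cscale \<epsilon> (\<delta> * tilde \<beta> * f))"
      unfolding s_eq by (simp add: distrib_left mult.assoc)
    also have "\<dots> = cscale \<epsilon> (flip_J s)" unfolding Js \<delta>\<alpha> \<delta>\<beta> using ee by (auto simp: cscale_add add.commute mult_ac)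
    finally have s: "s \<in> Hp p" "\<delta> * s = cscale \<epsilon> (flip_J s)" using sH by auto
    define v where "v = phi \<epsilon> p q \<alpha> \<beta> s"
    have v: "v \<in> V" "v \<in> Hp p" "\<gamma> * v + cscale \<epsilon> (flip_J v) = cscale 2 (\<alpha>' * s)"
      using s phi_props[OF s] imP by (auto simp: v_def V_def)
    have "\<beta> * cscale 2 (\<alpha>' * s) = cscale 2 (\<delta> * s)" unfolding \<beta>\<alpha>'[symmetric] by (simp add: mult_ac)
    also have "\<dots> = cscale (2 * \<epsilon>) (flip_J s)" using s(2) by simp
    also have "\<dots> = cscale (\<epsilon> * \<epsilon>) (\<alpha> * f + cscale \<epsilon> (\<beta> * flip_J f))" unfolding Js by simp
    also have "\<dots> = \<beta> * (\<gamma> * f + cscale \<epsilon> (flip_J f))" unfolding \<beta>mult ee by simp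
    finally have "cscale 2 (\<alpha>' * s) = \<gamma> * f + cscale \<epsilon> (flip_J f)" by (rule \<beta>cancel)
    then have "\<gamma> * (f - v) + cscale \<epsilon> (flip_J (f - v)) = 0"
      using v(3) by (simp add: right_diff_distrib cscale_diff algebra_simps)
    then have "f - v \<in> U" unfolding U_iff using f(1) v(2) by (simp add: Hp_diff)
    then show "f \<in> {u + v | u v. u \<in> U \<and> v \<in> V}" using v(1) by (intro CollectI exI[of _ "f - v"] exI[of _ v]) simp
  next
    fix f assume "f \<in> {u + v | u v. u \<in> U \<and> v \<in> V}"
    then obtain u v where uv: "f = u + v" "u \<in> U" "v \<in> V" by blast
    obtain s where s: "s \<in> Hp p" "\<delta> * s = cscale \<epsilon> (flip_J s)" "v = phi \<epsilon> p q \<alpha> \<beta> s"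
      using uv(3) imP by (auto simp: V_def)
    have u: "u \<in> Hp p" "\<alpha> * u + cscale \<epsilon> (\<beta> * flip_J u) = 0" using uv(2) \<beta>mult[of u] by (auto simp: U_iff)
    have v: "v \<in> Hp p" "\<alpha> * v + cscale \<epsilon> (\<beta> * flip_J v) \<in> Hp_minus p" using phi_ker[OF s(1,2)] s(3) by (auto simp: ker_iff)
    have "\<alpha> * f + cscale \<epsilon> (\<beta> * flip_J f) = (\<alpha> * u + cscale \<epsilon> (\<beta> * flip_J u)) + (\<alpha> * v + cscale \<epsilon> (\<beta> * flip_J v))"
      by (simp add: uv(1) distrib_left cscale_add)
    then show "f \<in> ker_op p (\<lambda>f. toeplitz p \<alpha> f + cscale \<epsilon> (hankel p \<beta> f))"
      unfolding ker_iff using u v by (simp add: uv(1) Hp_add)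
  qed
  have tz: "toeplitz p x 0 = 0" for x by (simp add: toeplitz_def riesz_P_id)
  have phi0: "phi \<epsilon> p q \<alpha> \<beta> 0 = 0"
    using R(3) by (simp add: phi_def subordinated_pair_def Let_def tz riesz_Q_def riesz_P_id flip: \<gamma>(1))
  have "0 \<in> V" unfolding V_def using imP[of 0] phi0 by (intro image_eqI[of _ _ 0]) auto
  moreover have "0 \<in> U" by (simp add: U_iff)
  moreover have "x = 0" if xU: "x \<in> U" and xV: "x \<in> V" for x
  proof -
    obtain s where s: "s \<in> Hp p" "\<delta> * s = cscale \<epsilon> (flip_J s)" "x = phi \<epsilon> p q \<alpha> \<beta> s"
      using xV imP by (auto simp: V_def)
    have "cscale 2 (\<alpha>' * s) = 0" using phi_props[OF s(1,2)] xU s(3) by (simp add: U_iff)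
    then have "tilde \<alpha> * (\<alpha>' * s) = 0" by simp
    moreover have "tilde \<alpha> * (\<alpha>' * s) = (tilde \<alpha> * inverse (tilde \<alpha>)) * s" by (simp only: \<alpha>'_def mult.assoc)
    ultimately have "s = 0" using cancel by simp
    then show ?thesis using s(3) phi0 by simp
  qed
  ultimately show "U \<inter> V = {0}" by blast
qed

lemma ker_toeplitz_hankel_shift:
  assumes a: "a \<in> Linf" and b: "b \<in> Linf"
  shows "ker_op p (\<lambda>f. toeplitz p a f + cscale \<epsilon> (hankel p b f)) =
    toeplitz p (tpow (- int m)) ` (ker_op p (\<lambda>f. toeplitz p (a * tpow (- int m)) f + cscale \<epsilon> (hankel p (b * tpow (int m)) f))
      \<inter> im_op p (toeplitz p (tpow (int m))))"
proof -
  let ?t = "tpow (int m)" and ?t' = "tpow (- int m)"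
  have tf: "toeplitz p ?t f = ?t * f" if "f \<in> Hp p" for f
    using that by (simp add: toeplitz_def riesz_P_id Hp_tpow_mult)
  have t't: "toeplitz p ?t' (?t * f) = f" if "f \<in> Hp p" for f
    using that by (simp add: toeplitz_def riesz_P_id flip: mult.assoc)
  have eq: "toeplitz p (a * ?t') (?t * f) + cscale \<epsilon> (hankel p (b * ?t) (?t * f)) = toeplitz p a f + cscale \<epsilon> (hankel p b f)"
    if f: "f \<in> Hp p" for f
  proof -
    have "(a * ?t') * (?t * f) = a * f" by (simp add: mult.assoc) (simp flip: mult.assoc)
    moreover have "(b * ?t) * flip_J (?t * f) = b * flip_J f"
    proof -
      have "(b * ?t) * flip_J (?t * f) = b * (?t * ?t') * flip_J f" by (simp only: flip_J_mult tilde_tpow mult.assoc)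
      then show ?thesis by simp
    qed
    ultimately show ?thesis using hankel_eq[OF f] hankel_eq[OF Hp_tpow_mult[OF _ f, of "int m"]] by (simp add: toeplitz_def)
  qed
  show ?thesis
  proof (intro equalityI subsetI)
    fix f assume f: "f \<in> ker_op p (\<lambda>f. toeplitz p a f + cscale \<epsilon> (hankel p b f))"
    then have fH: "f \<in> Hp p" by (simp add: ker_op_def)
    show "f \<in> toeplitz p ?t' ` (ker_op p (\<lambda>f. toeplitz p (a * ?t') f + cscale \<epsilon> (hankel p (b * ?t) f)) \<inter> im_op p (toeplitz p ?t))"
      using f eq[OF fH] tf[OF fH] t't[OF fH] fH Hp_tpow_mult[OF _ fH, of "int m"]
      by (intro image_eqI[of _ _ "?t * f"]) (auto simp: ker_op_def im_op_def intro: image_eqI[of _ _ f])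
  next
    fix f assume "f \<in> toeplitz p ?t' ` (ker_op p (\<lambda>f. toeplitz p (a * ?t') f + cscale \<epsilon> (hankel p (b * ?t) f)) \<inter> im_op p (toeplitz p ?t))"
    then obtain g where g: "g \<in> Hp p" "f = toeplitz p ?t' (?t * g)"
        "toeplitz p (a * ?t') (?t * g) + cscale \<epsilon> (hankel p (b * ?t) (?t * g)) = 0"
      using tf by (auto simp: ker_op_def im_op_def)
    then show "f \<in> ker_op p (\<lambda>f. toeplitz p a f + cscale \<epsilon> (hankel p b f))"
      using eq[OF g(1)] t't[OF g(1)] by (simp add: ker_op_def)
  qed
qed

end

section \<open>Index one and the factorization signature\<close>

context conjugate_exponents
begin

interpretation qp: conjugate_exponents q p by (rule conjugate_exponents_sym)

lemma ker_toeplitz_bij: "toeplitz_bij G \<Longrightarrow> ker_op p (toeplitz p G) = {0}"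
  using toeplitz_cscale[of G 0 0] by (auto simp: toeplitz_bij_def ker_op_def)

lemma ker_toeplitz_index_one:
  assumes G: "toeplitz_bij G" and v: "v \<in> Hp p" "toeplitz p G v = 1"
  shows "ker_op p (toeplitz p (G * tpow (-1))) = range (\<lambda>z. cscale z v)"
proof -
  have GL: "G \<in> Linf" using G by (simp add: toeplitz_bij_def)
  have G1: "G * tpow (-1) \<in> Linf" using GL by (intro Linf_mult) auto
  have iff: "f \<in> ker_op p (toeplitz p (G * tpow (-1))) \<longleftrightarrow> f \<in> Hp p \<and> (\<forall>n\<ge>0. fourier (G * f) (n + 1) = 0)" for f
  proof (cases "f \<in> Hp p")
    case True
    have e1: "(G * tpow (-1)) * f = tpow (-1) * (G * f)" by (simp only: mult_ac)
    have "G * f \<in> Lp p" using Linf_mult_Lp[OF p_nonneg(1) GL Hp_Lp[OF True]] .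
    then show ?thesis
      using True toeplitz_eq_0_iff[OF G1 True, unfolded e1] p_nonneg by (simp add: ker_op_def Hp_minus_def Lp_tpow_mult)
  qed (simp add: ker_op_def)
  have mem: "G * f - cscale (fourier (G * f) 0) 1 \<in> Hp_minus p \<longleftrightarrow> (\<forall>n\<ge>0. fourier (G * f) (n + 1) = 0)" if f: "f \<in> Hp p" for f
  proof -
    have L: "G * f \<in> Lp p" using Linf_mult_Lp[OF p_nonneg(1) GL Hp_Lp[OF f]] .
    have F: "fourier (G * f - cscale (fourier (G * f) 0) 1) n = (if n = 0 then 0 else fourier (G * f) n)" for n
      using Lp_subset_L1[OF L] by (simp add: fourier_diff Lp_cscale fourier_one)
    have "G * f - cscale (fourier (G * f) 0) 1 \<in> Lp p" using L p_nonneg by (intro Lp_diff Lp_cscale) auto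
    then have "G * f - cscale (fourier (G * f) 0) 1 \<in> Hp_minus p \<longleftrightarrow> (\<forall>n\<ge>0. n \<noteq> 0 \<longrightarrow> fourier (G * f) n = 0)"
      by (auto simp: Hp_minus_def F)
    also have "\<dots> \<longleftrightarrow> (\<forall>n\<ge>0. fourier (G * f) (n + 1) = 0)"
    proof (intro iffI allI impI)
      fix n :: int assume *: "\<forall>n\<ge>0. fourier (G * f) (n + 1) = 0" and n: "0 \<le> n" "n \<noteq> 0"
      show "fourier (G * f) n = 0" using *[rule_format, of "n - 1"] n by simp
    qed auto
    finally show ?thesis .
  qed
  show ?thesis
  proof (intro equalityI subsetI)
    fix f assume "f \<in> ker_op p (toeplitz p (G * tpow (-1)))"
    then have f: "f \<in> Hp p" "G * f - cscale (fourier (G * f) 0) 1 \<in> Hp_minus p" using iff mem by auto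
    have "toeplitz p G f = cscale (fourier (G * f) 0) 1" by (rule toeplitz_eqI[OF Hp_cscale[OF Hp_one] f(2)])
    also have "\<dots> = toeplitz p G (cscale (fourier (G * f) 0) v)" using toeplitz_cscale[OF GL v(1)] v(2) by simp
    finally have "f = cscale (fourier (G * f) 0) v" by (rule toeplitz_bij_inj[OF G f(1) Hp_cscale[OF v(1)]])
    then show "f \<in> range (\<lambda>z. cscale z v)" by blast
  next
    fix f assume "f \<in> range (\<lambda>z. cscale z v)"
    then obtain z where z: "f = cscale z v" by blast
    have "G * v - 1 \<in> Hp_minus p" using toeplitz_remainder[OF GL v(1)] v(2) by simp
    moreover have "fourier (G * v) 0 = fourier (G * v - 1) 0 + 1"
      using Lp_subset_L1[OF Linf_mult_Lp[OF p_nonneg(1) GL Hp_Lp[OF v(1)]]] by (simp add: fourier_diff fourier_one)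
    ultimately have "G * v - cscale (fourier (G * v) 0) 1 \<in> Hp_minus p" by (simp add: Hp_minus_def)
    then have "\<forall>n\<ge>0. fourier (G * v) (n + 1) = 0" using mem[OF v(1)] by blast
    then show "f \<in> ker_op p (toeplitz p (G * tpow (-1)))" unfolding iff z using Hp_cscale[OF v(1)] by simp
  qed
qed

lemma dim_zero_set: "cvs.dim {0} = 0"
  using cvs.dim_le_card[of "{0}" "{}"] by simp

lemma index_toeplitz_bij:
  assumes G: "toeplitz_bij G" and k: "\<kappa> = 0 \<or> \<kappa> = 1"
  shows "index_op p q (toeplitz p (G * tpow (- \<kappa>))) = \<kappa>"
proof -
  have GL: "G \<in> Linf" using G by (simp add: toeplitz_bij_def)
  have Gq: "qp.toeplitz_bij (conj_fun G)" by (rule toeplitz_bij_conj[OF G])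
  have L: "G * tpow (- \<kappa>) \<in> Linf" using GL by (intro Linf_mult) auto
  have \<kappa>: "0 \<le> \<kappa>" using k by auto
  have "coker_op p q (toeplitz p (G * tpow (- \<kappa>))) = ker_op q (toeplitz q (conj_fun G * tpow \<kappa>))"
    using coker_toeplitz[OF L] by simp
  also have "\<dots> = {0}"
  proof (intro equalityI subsetI)
    fix f assume "f \<in> ker_op q (toeplitz q (conj_fun G * tpow \<kappa>))"
    then have f: "f \<in> Hp q" "toeplitz q (conj_fun G) (tpow \<kappa> * f) = 0"
      using qp.toeplitz_tpow_right[OF \<kappa>] by (auto simp: ker_op_def)
    have "tpow \<kappa> * f = 0" using Gq f(2) qp.Hp_tpow_mult[OF \<kappa> f(1)] by (simp add: qp.toeplitz_bij_def)
    then have "tpow (- \<kappa>) * (tpow \<kappa> * f) = 0" by simp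
    then show "f \<in> {0}" by (simp flip: mult.assoc)
  next
    fix f :: tfun assume "f \<in> {0}"
    moreover have "toeplitz q (conj_fun G * tpow \<kappa>) 0 = 0" by (simp add: toeplitz_def qp.riesz_P_id)
    ultimately show "f \<in> ker_op q (toeplitz q (conj_fun G * tpow \<kappa>))" by (simp add: ker_op_def)
  qed
  finally have cok: "cvs.dim (coker_op p q (toeplitz p (G * tpow (- \<kappa>)))) = 0" by (simp add: dim_zero_set)
  show ?thesis
  proof (cases "\<kappa> = 0")
    case True
    then show ?thesis using cok ker_toeplitz_bij[OF G] by (simp add: index_op_def dim_zero_set)
  next
    case False
    then have k1: "\<kappa> = 1" using k by simp
    obtain v where v: "v \<in> Hp p" "toeplitz p G v = 1" using G Hp_one by (auto simp: toeplitz_bij_def)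
    have "v \<noteq> 0" using v(2) by (auto simp: toeplitz_def riesz_P_id)
    have "cvs.dim (ker_op p (toeplitz p (G * tpow (- \<kappa>)))) = 1"
      unfolding k1 ker_toeplitz_index_one[OF G v]
    proof (rule cvs.dim_unique)
      show "{v} \<subseteq> range (\<lambda>z. cscale z v)" by (auto intro: range_eqI[of _ _ 1])
      show "range (\<lambda>z. cscale z v) \<subseteq> cvs.span {v}" by (auto intro: cvs.span_scale cvs.span_base)
      show "cvs.independent {v}" using \<open>v \<noteq> 0\<close> by (simp add: cvs.independent_insert)
    qed simp
    then show ?thesis using cok k1 by (simp add: index_op_def)
  qed
qed

lemma toeplitz_rinv_bij:
  assumes G: "toeplitz_bij G" and k: "\<kappa> = 0 \<or> \<kappa> = 1" and \<gamma>: "\<gamma> = G * tpow (- \<kappa>)"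
  shows "\<And>f. f \<in> Hp p \<Longrightarrow> toeplitz_rinv p q \<gamma> f \<in> Hp p"
    and "\<And>f. f \<in> Hp p \<Longrightarrow> toeplitz p \<gamma> (toeplitz_rinv p q \<gamma> f) = f"
    and "toeplitz_rinv p q \<gamma> 0 = 0"
proof -
  have GL: "G \<in> Linf" using G by (simp add: toeplitz_bij_def)
  have \<kappa>: "0 \<le> \<kappa>" using k by auto
  have \<gamma>t: "\<gamma> * tpow \<kappa> = G" by (simp add: \<gamma> mult.assoc)
  have rinv: "toeplitz_rinv p q \<gamma> f = inv_into (Hp p) (toeplitz p G) (toeplitz p (tpow \<kappa>) f)" for f
    by (simp add: toeplitz_rinv_def index_toeplitz_bij[OF G k, folded \<gamma>] \<gamma>t)
  have t: "toeplitz p (tpow \<kappa>) f = tpow \<kappa> * f" if "f \<in> Hp p" for f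
    unfolding toeplitz_def by (rule riesz_P_id[OF Hp_tpow_mult[OF \<kappa> that]])
  have r: "toeplitz_rinv p q \<gamma> f \<in> Hp p \<and> toeplitz p G (toeplitz_rinv p q \<gamma> f) = tpow \<kappa> * f" if f: "f \<in> Hp p" for f
  proof -
    have "tpow \<kappa> * f \<in> toeplitz p G ` Hp p" using G Hp_tpow_mult[OF \<kappa> f] by (force simp: toeplitz_bij_def)
    then show ?thesis unfolding rinv t[OF f] by (simp add: inv_into_into f_inv_into_f)
  qed
  show "toeplitz_rinv p q \<gamma> f \<in> Hp p" if "f \<in> Hp p" for f using r[OF that] by blast
  show "toeplitz p \<gamma> (toeplitz_rinv p q \<gamma> f) = f" if f: "f \<in> Hp p" for f
  proof (rule toeplitz_eqI[OF f])
    let ?r = "toeplitz_rinv p q \<gamma> f"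
    have "G * ?r - tpow \<kappa> * f \<in> Hp_minus p" using toeplitz_remainder[OF GL, of ?r] r[OF f] by simp
    then have "tpow (- \<kappa>) * (G * ?r - tpow \<kappa> * f) \<in> Hp_minus p"
      using \<kappa> p_nonneg by (simp add: Hp_minus_def Lp_tpow_mult)
    moreover have "tpow (- \<kappa>) * (G * ?r - tpow \<kappa> * f) = \<gamma> * ?r - f"
      by (simp add: \<gamma> right_diff_distrib mult_ac)
    ultimately show "\<gamma> * ?r - f \<in> Hp_minus p" by simp
  qed
  show "toeplitz_rinv p q \<gamma> 0 = 0"
    using r[of 0] toeplitz_bij_inj[OF G, of "toeplitz_rinv p q \<gamma> 0" 0] by (simp add: toeplitz_def riesz_P_id)
qed

text \<open>For the minus factor \<open>e = Gv\<close> the relation \<open>G tilde G = 1\<close> makes \<open>tilde e / v\<close> both analytic and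
  coanalytic, hence constant; its value at 0 is the value at 0 of the plus factor \<open>1/v\<close>, the signature.\<close>

lemma signature_generator:
  assumes G: "toeplitz_bij G" "G * tilde G = 1" and v: "v \<in> Hp p" "toeplitz p G v = 1"
    and w: "w \<in> Hp q" "toeplitz q (conj_fun G) w = 1"
  defines "\<sigma> \<equiv> fourier (inverse v) 0"
  shows "\<sigma> * \<sigma> = 1" and "G * tpow (-1) * v = cscale \<sigma> (flip_J v)"
proof -
  note F = bijective_plus[OF G(1) v w] bijective_minus[OF G(1) v w]
  define e where "e = G * v"
  have tv: "tilde v * inverse (tilde v) = 1" using arg_cong[OF F(1), of tilde] by simp
  have te: "tilde f \<in> Hp r \<longleftrightarrow> f \<in> conj_Hp r" for f r
  proof -
    have "(\<forall>n<0. fourier f (- n) = 0) \<longleftrightarrow> (\<forall>n>0. fourier f n = 0)" by (metis neg_0_less_iff_less neg_less_0_iff_less minus_minus)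
    then show ?thesis by (simp add: Hp_iff conj_Hp_def)
  qed
  have G_e: "G = e * inverse v"
  proof -
    have "e * inverse v = G * (v * inverse v)" by (simp only: e_def mult.assoc)
    then show ?thesis using F(1) by simp
  qed
  have one: "(e * inverse v) * (tilde e * inverse (tilde v)) = 1" using G(2) G_e by (metis tilde_simps(3,4))
  have eq: "tilde e * inverse v = tilde v * inverse e"
  proof -
    have "tilde e * inverse v = (e * inverse e) * (tilde v * inverse (tilde v)) * (tilde e * inverse v)"
      using F(3) tv by (simp add: e_def)
    also have "\<dots> = ((e * inverse v) * (tilde e * inverse (tilde v))) * (tilde v * inverse e)" by (simp only: mult_ac)
    finally show ?thesis using one by simp
  qed
  have const: "tilde e * inverse v = cscale \<sigma> 1"
  proof -
    have "tilde e * inverse v = cscale (fourier (tilde e) 0 * fourier (inverse v) 0) 1"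
    proof (rule analytic_coanalytic_const[OF _ F(2) _ _ eq])
      show "tilde e \<in> Hp p" unfolding te e_def by (rule F(5))
      show "tilde v \<in> conj_Hp p" using te[of "tilde v" p] v(1) by simp
      show "inverse e \<in> conj_Hp q" unfolding e_def by (rule F(6))
    qed
    then show ?thesis using F(7) by (simp add: \<sigma>_def e_def del: tilde_simps)
  qed
  have "tilde e = (tilde e * inverse v) * v" using F(1) by (simp add: mult.assoc mult.commute[of "inverse v"])
  then have te_v: "tilde e = cscale \<sigma> v" using const by simp
  then have e_v: "e = cscale \<sigma> (tilde v)" by (metis tilde_simps(5,8))
  have "G * tpow (-1) * v = tpow (-1) * e" by (simp only: e_def mult_ac)
  then show "G * tpow (-1) * v = cscale \<sigma> (flip_J v)" by (simp add: e_v flip_J_def)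
  have "e * inverse (tilde v) = cscale \<sigma> 1" using arg_cong[OF const, of tilde] by simp
  then have "(tilde e * inverse v) * (e * inverse (tilde v)) = cscale (\<sigma> * \<sigma>) 1" using const by simp
  moreover have "(tilde e * inverse v) * (e * inverse (tilde v)) = 1" using one by (simp only: mult_ac)
  ultimately have "cscale (\<sigma> * \<sigma>) 1 = (1 :: tfun)" by simp
  from arg_cong[OF this, of "\<lambda>f. fourier f 0"] show "\<sigma> * \<sigma> = 1" by (simp add: fourier_one)
qed

end

section \<open>The cokernel of a Toeplitz plus Hankel operator\<close>

theorem theorem6p3:
  fixes p q :: real and a b c d :: tfun and \<kappa>1 \<kappa>2 :: int and m :: nat and \<epsilon> :: complex
  assumes "1 < p" and "1 / p + 1 / q = 1"
    and "fredholm_matching_pair p q a b"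
    and "(c, d) = subordinated_pair a b"
    and "\<kappa>1 = index_op p q (toeplitz p c)"
    and "\<kappa>2 = index_op p q (toeplitz p d)"
    and "\<kappa>1 < 0" and "\<kappa>2 \<ge> 0"
    and "m \<ge> 1" and "1 \<ge> 2 * int m - \<kappa>2" and "2 * int m - \<kappa>2 \<ge> 0"
    and "\<epsilon> = 1 \<or> \<epsilon> = -1"
  shows
    "let \<phi> = phi \<epsilon> q p (conj_fun a * tpow (- int m)) (tilde (conj_fun b) * tpow (int m));
         U = {cscale ((1 - \<epsilon> * signature q p (conj_fun d)) / 2 * z)
                (conj_fun (inverse (wh_minus p q d))) | z. True};
         V = \<phi> ` im_bold_P \<epsilon> q (conj_fun c);
         C = coker_op p q (\<lambda>f. toeplitz p a f + cscale \<epsilon> (hankel p b f))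
     in (odd \<kappa>2 \<longrightarrow> U \<inter> V = {0} \<and>
           C = toeplitz q (tpow (- int m)) `
                 ({u + v | u v. u \<in> U \<and> v \<in> V} \<inter> im_op q (toeplitz q (tpow (int m))))) \<and>
        (even \<kappa>2 \<longrightarrow>
           C = toeplitz q (tpow (- int m)) ` (V \<inter> im_op q (toeplitz q (tpow (int m)))))"
proof -
  interpret conjugate_exponents p q using assms(1,2) by unfold_locales
  interpret qp: conjugate_exponents q p by (rule conjugate_exponents_sym)
  note \<epsilon> = assms(12)
  have cd: "c = a * inverse b" "d = b * inverse (tilde a)" using assms(4) by (auto simp: subordinated_pair_def)
  have F: "fredholm_op p q (toeplitz p d)" and M: "matching_pair a b"
    using assms(3,4) by (auto simp: fredholm_matching_pair_def split: prod.splits)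
  obtain a' where a': "a' \<in> Linf" "a * a' = 1" using M by (auto simp: matching_pair_def)
  have aL: "a \<in> Linf" and bL: "b \<in> Linf" and match: "a * tilde a = b * tilde b" using M by (auto simp: matching_pair_def)
  have ia: "inverse a = a'" by (rule inverse_tfun_unique[OF a'(2)])
  have a1: "a * inverse a = 1" "inverse a \<in> Linf" using a' ia by auto
  have ta1: "tilde a * inverse (tilde a) = 1" using arg_cong[OF a1(1), of tilde] by simp
  have b_inv: "b * (tilde b * (a' * tilde a')) = 1"
  proof -
    have "b * (tilde b * (a' * tilde a')) = (a * tilde a) * (a' * tilde a')" unfolding match by (simp only: mult_ac)
    also have "\<dots> = (a * a') * tilde (a * a')" unfolding tilde_simps by (simp only: mult_ac)
    finally show ?thesis using a'(2) by simp
  qed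
  have ib: "inverse b = tilde b * (a' * tilde a')" by (rule inverse_tfun_unique[OF b_inv])
  have b1: "b * inverse b = 1" "inverse b \<in> Linf" using b_inv ib a'(1) bL by (auto intro!: Linf_mult Linf_tilde)
  have tb1: "tilde b * inverse (tilde b) = 1" using arg_cong[OF b1(1), of tilde] by simp
  have iaL: "inverse (tilde a) \<in> Linf" using Linf_tilde[OF a1(2)] by simp
  have ibL: "inverse (tilde b) \<in> Linf" using Linf_tilde[OF b1(2)] by simp
  have dL: "d \<in> Linf" unfolding cd by (intro Linf_mult bL iaL)
  have d1: "d * inverse d = 1"
  proof -
    have "d * inverse d = (b * inverse b) * (tilde a * inverse (tilde a))" by (simp add: cd mult_ac)
    then show ?thesis using b1 ta1 by simp
  qed
  have d_alt: "d = a * inverse (tilde b)"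
  proof -
    have "d = (b * tilde b) * inverse (tilde b) * inverse (tilde a)" unfolding cd using tb1 by (simp add: mult.assoc)
    also have "\<dots> = (tilde a * inverse (tilde a)) * (a * inverse (tilde b))" unfolding match[symmetric] by (simp only: mult_ac)
    finally show ?thesis using ta1 by simp
  qed
  have c_alt: "c = tilde b * inverse (tilde a)"
  proof -
    have "c = (a * tilde a) * inverse (tilde a) * inverse b" unfolding cd using ta1 by (simp add: mult.assoc)
    also have "\<dots> = (b * inverse b) * (tilde b * inverse (tilde a))" unfolding match by (simp only: mult_ac)
    finally show ?thesis using b1 by simp
  qed
  \<comment> \<open>Shifting the symbol d by its index makes the Toeplitz operator bijective, also for the adjoint.\<close>
  define k where "k = nat \<kappa>2"
  have k: "int k = \<kappa>2" using assms(8) by (simp add: k_def)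
  define g where "g = d * tpow \<kappa>2"
  have g: "toeplitz_bij g"
    using fredholm_toeplitz_bijective[OF dL d1 F, of k] assms(6) dL by (simp add: toeplitz_bij_def g_def k Linf_mult)
  define G where "G = conj_fun g"
  have G: "qp.toeplitz_bij G" unfolding G_def by (rule toeplitz_bij_conj[OF g])
  obtain u where u: "u \<in> Hp p" "toeplitz p g u = 1" using g Hp_one by (auto simp: toeplitz_bij_def)
  obtain v where v: "v \<in> Hp q" "toeplitz q G v = 1" using G qp.Hp_one by (auto simp: qp.toeplitz_bij_def)
  have cG: "conj_fun G = g" by (simp add: G_def)
  have v': "toeplitz q (conj_fun g) v = 1" using v(2) by (simp add: G_def)
  have u': "toeplitz p (conj_fun G) u = 1" using u(2) by (simp add: cG)
  have "g * tpow (- \<kappa>2) = d" by (simp add: g_def mult.assoc)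
  with wiener_hopf_of_bijective[OF g u v(1) v', of "- \<kappa>2"] have "wh_minus p q d = g * u" using wh_minus_eq by metis
  then have dm: "conj_fun (inverse (wh_minus p q d)) = cscale (cnj (inverse (fourier u 0))) v"
    using bijective_minus(2)[OF g u v(1) v'] by simp
  define \<sigma> where "\<sigma> = fourier (inverse v) 0"
  have "G * tpow \<kappa>2 = conj_fun d" by (simp add: G_def g_def mult.assoc)
  with qp.wiener_hopf_of_bijective[OF G v u(1) u', of \<kappa>2] have "wh_plus q p (conj_fun d) = inverse v" using qp.wh_plus_eq by metis
  then have sig: "signature q p (conj_fun d) = \<sigma>" by (simp add: signature_def \<sigma>_def)
  define \<alpha> \<beta> where "\<alpha> = conj_fun a * tpow (- int m)" and "\<beta> = tilde (conj_fun b) * tpow (int m)"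
  define \<kappa> where "\<kappa> = 2 * int m - \<kappa>2"
  have \<kappa>: "\<kappa> = 0 \<or> \<kappa> = 1" using assms(10,11) by (auto simp: \<kappa>_def)
  have \<alpha>1: "\<alpha> \<in> Linf" "inverse \<alpha> \<in> Linf"
    using aL Linf_conj[OF a1(2)] by (simp_all add: \<alpha>_def Linf_mult)
  have \<beta>1: "\<beta> \<in> Linf" using bL by (simp add: \<beta>_def Linf_mult Linf_tilde)
  have \<alpha>2: "\<alpha> * inverse \<alpha> = 1"
  proof -
    have "\<alpha> * inverse \<alpha> = conj_fun (a * inverse a) * (tpow (- int m) * tpow (int m))"
      by (simp only: \<alpha>_def inverse_mult_tfun inverse_tpow conj_simps tilde_simps tilde_tpow tilde_conj minus_minus mult_ac)
    then show ?thesis using a1 by simp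
  qed
  have \<beta>2: "\<beta> * inverse \<beta> = 1"
  proof -
    have "\<beta> * inverse \<beta> = conj_fun (tilde b * inverse (tilde b)) * (tpow (int m) * tpow (- int m))"
      by (simp only: \<beta>_def inverse_mult_tfun inverse_tpow conj_simps tilde_simps tilde_tpow tilde_conj minus_minus mult_ac)
    then show ?thesis using tb1 by simp
  qed
  have match': "\<alpha> * tilde \<alpha> = \<beta> * tilde \<beta>"
  proof -
    have "\<alpha> * tilde \<alpha> = conj_fun (a * tilde a) * (tpow (- int m) * tpow (int m))"
      by (simp only: \<alpha>_def inverse_mult_tfun inverse_tpow conj_simps tilde_simps tilde_tpow tilde_conj minus_minus mult_ac)
    also have "\<dots> = conj_fun (b * tilde b) * (tpow (int m) * tpow (- int m))" by (simp only: match tpow_inverse)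
    also have "\<dots> = \<beta> * tilde \<beta>"
      by (simp only: \<beta>_def inverse_mult_tfun inverse_tpow conj_simps tilde_simps tilde_tpow tilde_conj minus_minus mult_ac)
    finally show ?thesis .
  qed
  define \<gamma> where "\<gamma> = \<alpha> * inverse \<beta>"
  have \<gamma>G: "\<gamma> = G * tpow (- \<kappa>)"
  proof -
    have "\<gamma> = conj_fun d * (tpow (- int m) * tpow (- int m))"
      by (simp only: \<gamma>_def \<alpha>_def \<beta>_def d_alt inverse_mult_tfun inverse_tpow conj_simps tilde_simps tilde_tpow tilde_conj minus_minus mult_ac)
    also have "tpow (- int m) * tpow (- int m) = tpow (- \<kappa>2) * tpow (- \<kappa>)" by (simp add: \<kappa>_def flip: tpow_add)
    finally show ?thesis by (simp add: G_def g_def mult.assoc)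
  qed
  have \<gamma>L: "\<gamma> \<in> Linf" using G unfolding \<gamma>G by (auto simp: qp.toeplitz_bij_def intro!: Linf_mult)
  have \<delta>c: "conj_fun c = \<beta> * inverse (tilde \<alpha>)"
  proof -
    have "\<beta> * inverse (tilde \<alpha>) = conj_fun c * (tpow (int m) * tpow (- int m))"
      by (simp only: \<alpha>_def \<beta>_def c_alt inverse_mult_tfun inverse_tpow conj_simps tilde_simps tilde_tpow tilde_conj minus_minus mult_ac)
    then show ?thesis by simp
  qed
  have cL: "conj_fun c \<in> Linf" unfolding c_alt by (intro Linf_conj Linf_mult Linf_tilde bL iaL)
  define V where "V = phi \<epsilon> q p \<alpha> \<beta> ` im_bold_P \<epsilon> q (conj_fun c)"
  define U' where "U' = {f \<in> Hp q. \<gamma> * f = cscale (- \<epsilon>) (flip_J f)}"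
  define U where "U = {cscale ((1 - \<epsilon> * \<sigma>) / 2 * z) (conj_fun (inverse (wh_minus p q d))) | z. True}"
  note kernel = qp.ker_toeplitz_hankel[OF \<alpha>1(1) \<alpha>2 \<alpha>1(2) \<beta>1 \<beta>2 match' \<epsilon> \<gamma>_def \<gamma>L \<delta>c cL qp.toeplitz_rinv_bij[OF G \<kappa> \<gamma>G]]
  have ker: "ker_op q (\<lambda>f. toeplitz q \<alpha> f + cscale \<epsilon> (hankel q \<beta> f)) = {u + v | u v. u \<in> U' \<and> v \<in> V}"
    and direct: "U' \<inter> V = {0}" using kernel unfolding U'_def V_def by auto
  have "cnj \<epsilon> = \<epsilon>" using \<epsilon> by auto
  then have C: "coker_op p q (\<lambda>f. toeplitz p a f + cscale \<epsilon> (hankel p b f)) =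
      toeplitz q (tpow (- int m)) ` ({u + v | u v. u \<in> U' \<and> v \<in> V} \<inter> im_op q (toeplitz q (tpow (int m))))"
    using coker_toeplitz_hankel[OF aL bL] qp.ker_toeplitz_hankel_shift[of "conj_fun a" "tilde (conj_fun b)" \<epsilon> m]
      ker aL bL by (simp add: \<alpha>_def \<beta>_def Linf_tilde)
  have U'_ker: "U' \<subseteq> ker_op q (toeplitz q \<gamma>)"
  proof
    fix f assume "f \<in> U'"
    then have f: "f \<in> Hp q" "\<gamma> * f = cscale (- \<epsilon>) (flip_J f)" by (auto simp: U'_def)
    have "\<gamma> * f \<in> Hp_minus q" unfolding f(2) using f(1) qp.p_nonneg by (intro qp.Hp_minus_cscale) (simp add: flip_J_Hp)
    then show "f \<in> ker_op q (toeplitz q \<gamma>)" using f(1) qp.toeplitz_eq_0_iff[OF \<gamma>L f(1)] by (simp add: ker_op_def)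
  qed
  have odd_case: "U' = U" if "odd \<kappa>2"
  proof -
    have k1: "\<kappa> = 1" using that \<kappa> by (auto simp: \<kappa>_def)
    have GG: "G * tilde G = 1"
    proof -
      have "d * tilde d = (b * inverse b) * (tilde a * inverse (tilde a)) * 1"
      proof -
        have "d * tilde d = (b * tilde b) * (inverse a * inverse (tilde a))" by (simp add: cd mult_ac)
        also have "\<dots> = (a * inverse a) * (tilde a * inverse (tilde a))" unfolding match[symmetric] by (simp only: mult_ac)
        finally show ?thesis using a1 b1 by simp
      qed
      then have dd: "d * tilde d = 1" using b1 ta1 by simp
      have "G * tilde G = conj_fun (d * tilde d) * (tpow (- \<kappa>2) * tpow \<kappa>2)"
        by (simp only: G_def g_def conj_tpow inverse_mult_tfun inverse_tpow conj_simps tilde_simps tilde_tpow tilde_conj minus_minus mult_ac)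
      then show ?thesis using dd by simp
    qed
    note sg = qp.signature_generator[OF G GG v u(1) u', folded \<sigma>_def]
    have \<sigma>: "\<sigma> = 1 \<or> \<sigma> = -1" using sg(1) by (simp only: square_eq_1_iff)
    have v0: "v \<noteq> 0" using v(2) by (auto simp: toeplitz_def qp.riesz_P_id)
    have u0: "fourier u 0 \<noteq> 0" by (rule bijective_u0[OF g u v(1) v'])
    have kerv: "ker_op q (toeplitz q \<gamma>) = range (\<lambda>z. cscale z v)"
      using qp.ker_toeplitz_index_one[OF G v] by (simp add: \<gamma>G k1)
    \<comment> \<open>Flip eigenvalue \<open>\<sigma>\<close> against the required \<open>-\<epsilon>\<close>: the generator survives only if they agree.\<close>
    have U'_mem: "cscale z v \<in> U' \<longleftrightarrow> z = 0 \<or> \<sigma> = - \<epsilon>" for z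
    proof -
      have "\<gamma> * cscale z v = cscale (z * \<sigma>) (flip_J v)" using sg(2) by (simp add: \<gamma>G k1)
      then have "cscale z v \<in> U' \<longleftrightarrow> cscale (z * \<sigma>) (flip_J v) = cscale (z * - \<epsilon>) (flip_J v)"
        using qp.Hp_cscale[OF v(1)] by (simp add: U'_def mult.commute)
      also have "\<dots> \<longleftrightarrow> z * \<sigma> = z * - \<epsilon>"
        using v0 flip_J_inj[of v 0] by (simp only: cvs.scale_cancel_right) simp
      also have "\<dots> \<longleftrightarrow> z = 0 \<or> \<sigma> = - \<epsilon>" by (simp only: mult_cancel_left)
      finally show ?thesis .
    qed
    show ?thesis
    proof (intro equalityI subsetI)
      fix f assume f: "f \<in> U'"
      then obtain z where z: "f = cscale z v" using U'_ker kerv by blast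
      have "z = (1 - \<epsilon> * \<sigma>) / 2 * (z / cnj (inverse (fourier u 0))) * cnj (inverse (fourier u 0))"
        using f U'_mem[of z] \<epsilon> \<sigma> u0 unfolding z by auto
      then have "f = cscale ((1 - \<epsilon> * \<sigma>) / 2 * (z / cnj (inverse (fourier u 0)))) (conj_fun (inverse (wh_minus p q d)))"
        unfolding dm z cscale_cscale by simp
      then show "f \<in> U" unfolding U_def by blast
    next
      fix f assume "f \<in> U"
      then obtain z where "f = cscale ((1 - \<epsilon> * \<sigma>) / 2 * z) (cscale (cnj (inverse (fourier u 0))) v)" unfolding U_def dm by blast
      then show "f \<in> U'" using U'_mem[of "(1 - \<epsilon> * \<sigma>) / 2 * z * cnj (inverse (fourier u 0))"] \<epsilon> \<sigma> by auto
    qed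
  qed
  have even_case: "{u + v | u v. u \<in> U' \<and> v \<in> V} = V" if "even \<kappa>2"
  proof -
    have "\<kappa> = 0" using that \<kappa> by (auto simp: \<kappa>_def)
    then have "\<gamma> = G" by (simp add: \<gamma>G)
    then have "U' = {0}" using U'_ker qp.ker_toeplitz_bij[OF G] direct by auto
    then show ?thesis by auto
  qed
  show ?thesis
    unfolding Let_def sig \<alpha>_def[symmetric] \<beta>_def[symmetric] V_def[symmetric] U_def[symmetric] C
    using odd_case even_case direct by auto
qed

end
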